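(* Let $0<\alpha<1<\beta$, $a\in(0,1)$ and $p\in P_{\alpha,\beta}$. Then all the eigenvalues of the problem $$ \begin{cases} e''''(x)=\lambda \,p(x)\, e(x) \qquad x\in I\\ e(\pm\pi)=e''(\pm \pi)=0\\ e(\pm a\pi)=0 \end{cases} $$ (understood in the weak sense) are simple and can be represented by means of an increasing and divergent sequence $\lambda_j(p)$, $j\in\{1,2,3,\dots\}$. Furthermore, the corresponding eigenfunctions $e_j$ form a complete system in $L^2_p(I)$ and in $V(I)$.
   Context: $I=(-\pi,\pi)$. For $0<\alpha<1<\beta$, $$P_{\alpha, \beta}:=\Big\{p\in L^\infty(I):\ \int_I p\,dx=2\pi,\ \alpha\leq p\leq\beta \text{ and } p(x)=p(-x) \text{ a.e. in } I\Big\}.$$ $L^2_p(I)$ is $L^2(I)$ endowed with the scalar product $(u,v)_p=\int_I p\,uv\,dx$. For $a\in(0,1)$, $$V(I):=\{u\in H^2(I)\cap H^1_0(I): u(\pm a\pi)=0\},$$ a Hilbert space with scalar product $(u,v)_V:=\int_I u''v''\,dx$. A function $e$ solves the problem in the weak sense (for a given $\lambda$) if $e\in V(I)$ and $\int_I e''v''\,dx=\lambda\int_I p\,ev\,dx$ for all $v\in V(I)$. An eigenvalue is a $\lambda$ for which there is a weak solution $e\not\equiv 0$ (an eigenfunction); it is simple if the space of its weak solutions is one-dimensional. A complete system in a Hilbert space is a family whose linear span is dense. *)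

theory Defs
  imports "HOL-Analysis.Analysis"
begin

text \<open>
  Elements of \<open>L\<^sup>2(I)\<close>, of the Sobolev spaces and of \<open>V(I)\<close> are represented by functions
  \<open>real \<Rightarrow> real\<close>, identified when they agree almost everywhere in \<open>I\<close>; the values outside \<open>I\<close>
  never matter.
\<close>

definition I :: "real set" where
  "I = {-pi<..<pi}"

definition L2 :: "(real \<Rightarrow> real) set" where
  "L2 = {u \<in> borel_measurable (lebesgue_on I). integrable (lebesgue_on I) (\<lambda>x. (u x)\<^sup>2)}"

definition Linf :: "(real \<Rightarrow> real) set" where
  "Linf = {u \<in> borel_measurable (lebesgue_on I). \<exists>C. AE x in lebesgue_on I. \<bar>u x\<bar> \<le> C}"

definition P :: "real \<Rightarrow> real \<Rightarrow> (real \<Rightarrow> real) set" where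
  "P \<alpha> \<beta> = {p \<in> Linf.
     (\<integral>x. p x \<partial>lebesgue_on I) = 2 * pi \<and>
     (AE x in lebesgue_on I. \<alpha> \<le> p x \<and> p x \<le> \<beta>) \<and>
     (AE x in lebesgue_on I. p x = p (- x))}"

text \<open>The space \<open>C\<^sub>c\<^sup>\<infinity>(I)\<close>, each function being extended by zero to the whole line.\<close>

definition test_fun :: "(real \<Rightarrow> real) set" where
  "test_fun = {\<phi>. (\<forall>n x. (deriv ^^ n) \<phi> field_differentiable at x) \<and>
     (\<exists>K. compact K \<and> K \<subseteq> I \<and> (\<forall>x. x \<notin> K \<longrightarrow> \<phi> x = 0))}"

definition is_weak_deriv :: "nat \<Rightarrow> (real \<Rightarrow> real) \<Rightarrow> (real \<Rightarrow> real) \<Rightarrow> bool" where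
  "is_weak_deriv k u g \<longleftrightarrow> (\<forall>\<phi>\<in>test_fun.
     (\<integral>x. u x * (deriv ^^ k) \<phi> x \<partial>lebesgue_on I) =
     (-1) ^ k * (\<integral>x. g x * \<phi> x \<partial>lebesgue_on I))"

definition H :: "nat \<Rightarrow> (real \<Rightarrow> real) set" where
  "H k = {u \<in> L2. \<forall>j\<in>{1..k}. \<exists>g\<in>L2. is_weak_deriv j u g}"

text \<open>The choice is unique up to a null set.\<close>

definition wderiv :: "nat \<Rightarrow> (real \<Rightarrow> real) \<Rightarrow> real \<Rightarrow> real" where
  "wderiv k u = (SOME g. g \<in> L2 \<and> is_weak_deriv k u g)"

definition H1_norm :: "(real \<Rightarrow> real) \<Rightarrow> real" where
  "H1_norm u = sqrt ((\<integral>x. (u x)\<^sup>2 \<partial>lebesgue_on I) + (\<integral>x. (wderiv 1 u x)\<^sup>2 \<partial>lebesgue_on I))"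

text \<open>The closure of \<open>C\<^sub>c\<^sup>\<infinity>(I)\<close> in \<open>H\<^sup>1(I)\<close>.\<close>

definition H10 :: "(real \<Rightarrow> real) set" where
  "H10 = {u \<in> H 1. \<forall>\<epsilon>>0. \<exists>\<phi>\<in>test_fun. H1_norm (\<lambda>x. u x - \<phi> x) < \<epsilon>}"

text \<open>
  Point values of a Sobolev function are those of its continuous representative, which is
  uniquely determined on \<open>I\<close>.
\<close>

definition cont_rep :: "(real \<Rightarrow> real) \<Rightarrow> real \<Rightarrow> real" where
  "cont_rep u = (SOME w. continuous_on I w \<and> (AE x in lebesgue_on I. u x = w x))"

definition V :: "real \<Rightarrow> (real \<Rightarrow> real) set" where
  "V a = {u \<in> H 2 \<inter> H10. cont_rep u (a * pi) = 0 \<and> cont_rep u (- a * pi) = 0}"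

definition inner_p :: "(real \<Rightarrow> real) \<Rightarrow> (real \<Rightarrow> real) \<Rightarrow> (real \<Rightarrow> real) \<Rightarrow> real" where
  "inner_p p u v = (\<integral>x. p x * u x * v x \<partial>lebesgue_on I)"

definition inner_V :: "(real \<Rightarrow> real) \<Rightarrow> (real \<Rightarrow> real) \<Rightarrow> real" where
  "inner_V u v = (\<integral>x. wderiv 2 u x * wderiv 2 v x \<partial>lebesgue_on I)"

definition weak_solution :: "real \<Rightarrow> (real \<Rightarrow> real) \<Rightarrow> real \<Rightarrow> (real \<Rightarrow> real) \<Rightarrow> bool" where
  "weak_solution a p \<mu> e \<longleftrightarrow> e \<in> V a \<and> (\<forall>v\<in>V a. inner_V e v = \<mu> * inner_p p e v)"

definition eigenfunction :: "real \<Rightarrow> (real \<Rightarrow> real) \<Rightarrow> real \<Rightarrow> (real \<Rightarrow> real) \<Rightarrow> bool" where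
  "eigenfunction a p \<mu> e \<longleftrightarrow> weak_solution a p \<mu> e \<and> \<not> (AE x in lebesgue_on I. e x = 0)"

definition eigenvalue :: "real \<Rightarrow> (real \<Rightarrow> real) \<Rightarrow> real \<Rightarrow> bool" where
  "eigenvalue a p \<mu> \<longleftrightarrow> (\<exists>e. eigenfunction a p \<mu> e)"

text \<open>The space of weak solutions, modulo equality almost everywhere, is a line.\<close>

definition simple_eigenvalue :: "real \<Rightarrow> (real \<Rightarrow> real) \<Rightarrow> real \<Rightarrow> bool" where
  "simple_eigenvalue a p \<mu> \<longleftrightarrow>
     (\<exists>e. eigenfunction a p \<mu> e \<and>
       (\<forall>u. weak_solution a p \<mu> u \<longrightarrow> (\<exists>c. AE x in lebesgue_on I. u x = c * e x)))"

text \<open>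
  The linear span of the family \<open>e\<close>, indexed by \<open>J\<close>, is dense in the space \<open>X\<close> for the norm
  induced by the scalar product \<open>ip\<close>.
\<close>

definition complete_system ::
  "(real \<Rightarrow> real) set \<Rightarrow> ((real \<Rightarrow> real) \<Rightarrow> (real \<Rightarrow> real) \<Rightarrow> real) \<Rightarrow>
   'j set \<Rightarrow> ('j \<Rightarrow> real \<Rightarrow> real) \<Rightarrow> bool" where
  "complete_system X ip J e \<longleftrightarrow>
     (\<forall>j\<in>J. e j \<in> X) \<and>
     (\<forall>f\<in>X. \<forall>\<epsilon>>0. \<exists>F c. finite F \<and> F \<subseteq> J \<and>
        (let r = (\<lambda>x. f x - (\<Sum>j\<in>F. c j * e j x)) in sqrt (ip r r) < \<epsilon>))"

end

theory Submission
  imports Defs "HOL-Real_Asymp.Real_Asymp" "HOL-Complex_Analysis.Great_Picard"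
begin

text \<open>A weak solution is a function \<open>e\<close> for which the energy form \<open>inner_V e\<close> is \<open>\<mu>\<close> times the
weighted form \<open>inner_p p e\<close> on the space \<open>V a\<close>. The energy makes \<open>V a\<close> a Hilbert space, and the
weighted form is compact for it. The spectral theory needed for such a pair of forms rests on one
extremal problem: on the orthogonal complement of all eigenfunctions, if it is not null, the
weighted form attains its maximum over the unit sphere (\<open>constrained_maximizer\<close>), and a maximiser
would be a further eigenfunction. So the eigenfunctions are total (\<open>eig_total\<close>). Compactness allows
only finitely many eigenvalues below any bound (\<open>finite_eigenvalues_le\<close>), and functions with
disjoint supports show that there are infinitely many (\<open>infinite_eigenvalues\<close>).

The Sobolev space is made concrete by the Green operator \<open>G\<close>, which solves \<open>u'' = m\<close> with
\<open>u(\<plusminus>\<pi>) = 0\<close>: the elements of \<open>V a\<close> are, up to null sets, the functions \<open>G m\<close> with \<open>m\<close> square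
integrable that vanish at the two piers (\<open>V_I\<close>, \<open>V_D\<close>), and \<open>m\<close> is the weak second derivative. Hence
\<open>V a\<close> is isometric to the kernel of two continuous functionals on \<open>L2\<close>, which gives its
completeness; since \<open>G m\<close> is Lipschitz with a constant controlled by the norm of \<open>m\<close>, the
theorem of Arzela and Ascoli gives the compactness.

For the simplicity, testing with all \<open>G n\<close> that vanish at the piers shows that \<open>e''\<close> equals the Green
potential of the load \<open>\<mu> p e\<close> up to two multipliers, the reactions of the piers
(\<open>solution_shape\<close>). So \<open>e''\<close> is continuous, it vanishes at \<open>-\<pi>\<close>, and \<open>e'''' = \<mu> p e\<close> on each of the
three spans. If moreover \<open>e'(-\<pi>) = 0\<close>, then \<open>e\<close>, \<open>e'\<close> and \<open>e''\<close> all vanish at the left end of the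
first span, and the sign of \<open>e'''\<close> there propagates to \<open>e\<close>: a nonzero \<open>e\<close> could not vanish at the next
pier (\<open>segment_sign\<close>). Hence \<open>e\<close> vanishes on the first span, and the argument moves on from span to
span (\<open>solution_slope_zero\<close>). The slope \<open>e'(-\<pi>)\<close> is therefore an injective functional on the
weak solutions, and each eigenvalue is simple.

With simple eigenvalues, any choice of one eigenfunction per eigenvalue is total in \<open>V a\<close>, hence
its span is dense there. Density passes to \<open>L2\<close> because the test functions that vanish at the piers
belong to \<open>V a\<close>, and only the null function is orthogonal to all of them (\<open>V_total_in_L2\<close>).\<close>

section \<open>Spaces of functions with a scalar product\<close>

text \<open>The first-order condition at a minimum, for a quadratic polynomial in \<open>t\<close>.\<close>

lemma linear_quadratic_nonneg:
  fixes L q :: real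
  assumes "\<And>t. 0 \<le> 2 * t * L + t\<^sup>2 * q" and "0 \<le> q"
  shows "L = 0"
proof (rule ccontr)
  assume "L \<noteq> 0"
  define s where "s = L / (q + 1)"
  have L: "L = s * (q + 1)" using assms(2) by (simp add: s_def)
  have "0 \<le> 2 * (- s) * L + (- s)\<^sup>2 * q" by (rule assms)
  also have "\<dots> = - s\<^sup>2 * (q + 2)"
    by (simp add: L algebra_simps power2_eq_square)
  also have "\<dots> < 0"
    using \<open>L \<noteq> 0\<close> assms(2) L by (intro mult_neg_pos) auto
  finally show False by simp
qed

text \<open>The form is only semidefinite, so that functions which agree almost everywhere need not be
  identified: all results below speak of null vectors instead of the zero vector.\<close>

locale form_space =
  fixes X :: "('a \<Rightarrow> real) set" and ip :: "('a \<Rightarrow> real) \<Rightarrow> ('a \<Rightarrow> real) \<Rightarrow> real"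
  assumes zero_mem: "(\<lambda>x. 0) \<in> X"
    and comb_mem: "\<lbrakk>f \<in> X; g \<in> X\<rbrakk> \<Longrightarrow> (\<lambda>x. f x + c * g x) \<in> X"
    and ip_sym: "\<lbrakk>f \<in> X; g \<in> X\<rbrakk> \<Longrightarrow> ip f g = ip g f"
    and ip_comb: "\<lbrakk>f \<in> X; g \<in> X; h \<in> X\<rbrakk> \<Longrightarrow> ip (\<lambda>x. f x + c * g x) h = ip f h + c * ip g h"
    and ip_nonneg: "f \<in> X \<Longrightarrow> 0 \<le> ip f f"
begin

lemma add_mem: "\<lbrakk>f \<in> X; g \<in> X\<rbrakk> \<Longrightarrow> (\<lambda>x. f x + g x) \<in> X"
  using comb_mem[of f g 1] by simp

lemma diff_mem: "\<lbrakk>f \<in> X; g \<in> X\<rbrakk> \<Longrightarrow> (\<lambda>x. f x - g x) \<in> X"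
  using comb_mem[of f g "-1"] by simp

lemma scale_mem: "f \<in> X \<Longrightarrow> (\<lambda>x. c * f x) \<in> X"
  using comb_mem[OF zero_mem, of f c] by simp

lemma sum_mem: "(\<And>j. j \<in> F \<Longrightarrow> e j \<in> X) \<Longrightarrow> (\<lambda>x. \<Sum>j\<in>F. c j * e j x) \<in> X"
proof (induction F rule: infinite_finite_induct)
  case (insert i F)
  then have "(\<lambda>x. (\<Sum>j\<in>F. c j * e j x) + c i * e i x) \<in> X"
    by (intro comb_mem) auto
  with insert show ?case by (simp add: add.commute)
qed (simp_all add: zero_mem)

lemma ip_zero: "g \<in> X \<Longrightarrow> ip (\<lambda>x. 0) g = 0"
  using ip_comb[OF zero_mem zero_mem, of g 1] by simp

lemma ip_comb_right: "\<lbrakk>f \<in> X; g \<in> X; h \<in> X\<rbrakk> \<Longrightarrow> ip h (\<lambda>x. f x + c * g x) = ip h f + c * ip h g"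
  by (simp add: ip_sym[of h] comb_mem ip_comb)

lemma ip_diff: "\<lbrakk>f \<in> X; g \<in> X; h \<in> X\<rbrakk> \<Longrightarrow> ip (\<lambda>x. f x - g x) h = ip f h - ip g h"
  using ip_comb[of f g h "-1"] by simp

lemma ip_diff_right: "\<lbrakk>f \<in> X; g \<in> X; h \<in> X\<rbrakk> \<Longrightarrow> ip h (\<lambda>x. f x - g x) = ip h f - ip h g"
  using ip_comb_right[of f g h "-1"] by simp

lemma ip_scale: "\<lbrakk>g \<in> X; h \<in> X\<rbrakk> \<Longrightarrow> ip (\<lambda>x. c * g x) h = c * ip g h"
  using ip_comb[OF zero_mem, of g h c] by (simp add: ip_zero)

lemma ip_sum: "\<lbrakk>\<And>j. j \<in> F \<Longrightarrow> e j \<in> X; h \<in> X\<rbrakk> \<Longrightarrow>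
   ip (\<lambda>x. \<Sum>j\<in>F. c j * e j x) h = (\<Sum>j\<in>F. c j * ip (e j) h)"
proof (induction F rule: infinite_finite_induct)
  case (insert i F)
  have "ip (\<lambda>x. (\<Sum>j\<in>F. c j * e j x) + c i * e i x) h = (\<Sum>j\<in>F. c j * ip (e j) h) + c i * ip (e i) h"
    using insert by (subst ip_comb) (auto intro: sum_mem)
  with insert show ?case by (simp add: add.commute)
qed (simp_all add: ip_zero)

lemma sq_comb: "\<lbrakk>f \<in> X; g \<in> X\<rbrakk> \<Longrightarrow>
    ip (\<lambda>x. f x + c * g x) (\<lambda>x. f x + c * g x) = ip f f + 2 * c * ip f g + c\<^sup>2 * ip g g"
  by (simp add: ip_comb ip_comb_right comb_mem ip_sym[of g f] algebra_simps power2_eq_square)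

lemma sq_diff: "\<lbrakk>f \<in> X; g \<in> X\<rbrakk> \<Longrightarrow>
    ip (\<lambda>x. f x - g x) (\<lambda>x. f x - g x) = ip f f - 2 * ip f g + ip g g"
  using sq_comb[of f g "-1"] by simp

lemma sq_add: "\<lbrakk>f \<in> X; g \<in> X\<rbrakk> \<Longrightarrow>
    ip (\<lambda>x. f x + g x) (\<lambda>x. f x + g x) = ip f f + 2 * ip f g + ip g g"
  using sq_comb[of f g "1"] by simp

lemma cauchy_schwarz:
  assumes "f \<in> X" "g \<in> X"
  shows "(ip f g)\<^sup>2 \<le> ip f f * ip g g"
proof (cases "ip g g = 0")
  case True
  have "ip f g = 0 \<or> 0 < ip f g \<or> ip f g < 0" by linarith
  have *: "0 \<le> ip f f + 2 * c * ip f g" for c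
    using ip_nonneg[OF comb_mem[OF assms, of c]] True by (simp add: sq_comb assms)
  have "ip f g = 0"
  proof (rule ccontr)
    assume "ip f g \<noteq> 0"
    then show False using *[of "- (ip f f + 1) / (2 * ip f g)"] by (simp add: field_simps)
  qed
  then show ?thesis using True by simp
next
  case False
  then have pos: "0 < ip g g" using ip_nonneg[OF assms(2)] by simp
  have "0 \<le> ip f f + 2 * (- ip f g / ip g g) * ip f g + (- ip f g / ip g g)\<^sup>2 * ip g g"
    using ip_nonneg[OF comb_mem[OF assms, of "- ip f g / ip g g"]] unfolding sq_comb[OF assms] .
  also have "\<dots> = ip f f - (ip f g)\<^sup>2 / ip g g"
    using pos by (simp add: field_simps power2_eq_square)
  finally show ?thesis using pos by (simp add: field_simps)
qed

definition conv :: "(nat \<Rightarrow> 'a \<Rightarrow> real) \<Rightarrow> ('a \<Rightarrow> real) \<Rightarrow> bool" where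
  "conv u w \<longleftrightarrow> (\<lambda>n. ip (\<lambda>x. u n x - w x) (\<lambda>x. u n x - w x)) \<longlonglongrightarrow> 0"

lemma conv_ip:
  assumes "conv u w" "\<And>n. u n \<in> X" "w \<in> X" "h \<in> X"
  shows "(\<lambda>n. ip (u n) h) \<longlonglongrightarrow> ip w h"
proof -
  have "(\<lambda>n. sqrt (ip (\<lambda>x. u n x - w x) (\<lambda>x. u n x - w x) * ip h h)) \<longlonglongrightarrow> sqrt (0 * ip h h)"
    using assms(1) unfolding conv_def by (intro tendsto_intros)
  then have "(\<lambda>n. sqrt (ip (\<lambda>x. u n x - w x) (\<lambda>x. u n x - w x) * ip h h)) \<longlonglongrightarrow> 0" by simp
  moreover have "\<forall>\<^sub>F n in sequentially. norm (ip (\<lambda>x. u n x - w x) h) \<le>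
        sqrt (ip (\<lambda>x. u n x - w x) (\<lambda>x. u n x - w x) * ip h h)"
      using cauchy_schwarz[OF diff_mem[OF assms(2,3)] assms(4)]
      by (intro always_eventually allI) (auto intro!: real_le_rsqrt)
  ultimately have "(\<lambda>n. ip (\<lambda>x. u n x - w x) h) \<longlonglongrightarrow> 0"
    by (rule Lim_null_comparison[rotated])
  then have "(\<lambda>n. ip (u n) h - ip w h) \<longlonglongrightarrow> 0" by (simp add: ip_diff assms)
  then show ?thesis by (rule LIM_zero_cancel)
qed

lemma conv_sq:
  assumes "conv u w" "\<And>n. u n \<in> X" "w \<in> X"
  shows "(\<lambda>n. ip (u n) (u n)) \<longlonglongrightarrow> ip w w"
proof -
  have "(\<lambda>n. ip (\<lambda>x. u n x - w x) (\<lambda>x. u n x - w x) + 2 * ip (u n) w - ip w w) \<longlonglongrightarrow> 0 + 2 * ip w w - ip w w"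
    using assms(1) conv_ip[OF assms assms(3)] unfolding conv_def by (intro tendsto_intros)
  then show ?thesis by (simp add: sq_diff assms)
qed

definition span_of :: "'j set \<Rightarrow> ('j \<Rightarrow> 'a \<Rightarrow> real) \<Rightarrow> ('a \<Rightarrow> real) set" where
  "span_of J e = {\<lambda>x. \<Sum>j\<in>F. c j * e j x | F c. finite F \<and> F \<subseteq> J}"

lemma span_of_subspace:
  assumes "\<And>j. j \<in> J \<Longrightarrow> e j \<in> X"
  shows "span_of J e \<subseteq> X" "(\<lambda>x. 0) \<in> span_of J e"
    "\<And>f g c. \<lbrakk>f \<in> span_of J e; g \<in> span_of J e\<rbrakk> \<Longrightarrow> (\<lambda>x. f x + c * g x) \<in> span_of J e"
    "\<And>j. j \<in> J \<Longrightarrow> e j \<in> span_of J e"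
proof -
  show "span_of J e \<subseteq> X" using assms by (auto simp: span_of_def intro!: sum_mem)
  show "(\<lambda>x. 0) \<in> span_of J e" unfolding span_of_def by (rule CollectI, rule exI[of _ "{}"]) auto
  show "e j \<in> span_of J e" if "j \<in> J" for j
    unfolding span_of_def by (rule CollectI, rule exI[of _ "{j}"], rule exI[of _ "\<lambda>_. 1"]) (use that in auto)
  fix f g c assume "f \<in> span_of J e" "g \<in> span_of J e"
  then obtain F c1 G c2 where f: "f = (\<lambda>x. \<Sum>j\<in>F. c1 j * e j x)" "finite F" "F \<subseteq> J"
    and g: "g = (\<lambda>x. \<Sum>j\<in>G. c2 j * e j x)" "finite G" "G \<subseteq> J" by (auto simp: span_of_def)
  have "f x + c * g x = (\<Sum>j\<in>F \<union> G. ((if j \<in> F then c1 j else 0) + c * (if j \<in> G then c2 j else 0)) * e j x)" for x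
  proof -
    have "f x = (\<Sum>j\<in>F \<union> G. (if j \<in> F then c1 j else 0) * e j x)"
      unfolding f using f g by (intro sum.mono_neutral_cong_left) auto
    moreover have "g x = (\<Sum>j\<in>F \<union> G. (if j \<in> G then c2 j else 0) * e j x)"
      unfolding g using f g by (intro sum.mono_neutral_cong_left) auto
    ultimately show ?thesis by (simp add: sum_distrib_left sum.distrib algebra_simps)
  qed
  then show "(\<lambda>x. f x + c * g x) \<in> span_of J e"
    unfolding span_of_def using f g
    by (intro CollectI exI[of _ "F \<union> G"] exI[of _ "\<lambda>j. (if j \<in> F then c1 j else 0) + c * (if j \<in> G then c2 j else 0)"]) auto
qed

lemma ip_cong_null:
  assumes "f \<in> X" "g \<in> X" "h \<in> X" "ip (\<lambda>x. f x - g x) (\<lambda>x. f x - g x) = 0"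
  shows "ip f h = ip g h"
  using cauchy_schwarz[OF diff_mem[OF assms(1,2)] assms(3)] assms by (simp add: ip_diff)

end

locale hilbert_space = form_space +
  assumes complete: "\<lbrakk>\<And>n. u n \<in> X;
      \<And>\<epsilon>. 0 < \<epsilon> \<Longrightarrow> \<exists>N. \<forall>m\<ge>N. \<forall>n\<ge>N. ip (\<lambda>x. u m x - u n x) (\<lambda>x. u m x - u n x) < \<epsilon>\<rbrakk>
    \<Longrightarrow> \<exists>w\<in>X. conv u w"
begin

lemma complete_of_tendsto:
  assumes u: "\<And>n. u n \<in> X" and \<delta>: "\<delta> \<longlonglongrightarrow> 0"
    and bd: "\<And>m n. ip (\<lambda>x. u m x - u n x) (\<lambda>x. u m x - u n x) \<le> \<delta> m + \<delta> n"
  obtains w where "w \<in> X" "conv u w"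
proof -
  have "\<exists>w\<in>X. conv u w"
  proof (rule complete[OF u])
    fix \<epsilon> :: real assume "0 < \<epsilon>"
    then obtain N where N: "\<And>n. n \<ge> N \<Longrightarrow> \<delta> n < \<epsilon> / 2"
      using order_tendstoD(2)[OF \<delta>, of "\<epsilon>/2"] unfolding eventually_sequentially by auto
    have "ip (\<lambda>x. u m x - u n x) (\<lambda>x. u m x - u n x) < \<epsilon>" if "m \<ge> N" "n \<ge> N" for m n
      using bd[of m n] N[OF that(1)] N[OF that(2)] by linarith
    then show "\<exists>N. \<forall>m\<ge>N. \<forall>n\<ge>N. ip (\<lambda>x. u m x - u n x) (\<lambda>x. u m x - u n x) < \<epsilon>" by blast
  qed
  then show ?thesis using that by blast
qed

text \<open>A minimising sequence for the distance to \<open>Y\<close> is Cauchy, so the orthogonal projection of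
  \<open>f\<close> to the closure of \<open>Y\<close> exists. The sequence \<open>y\<close> records that \<open>w\<close> lies in this closure.\<close>

lemma projection:
  assumes Y: "Y \<subseteq> X" "(\<lambda>x. 0) \<in> Y" "\<And>f g c. \<lbrakk>f \<in> Y; g \<in> Y\<rbrakk> \<Longrightarrow> (\<lambda>x. f x + c * g x) \<in> Y"
    and f: "f \<in> X"
  obtains w y where "w \<in> X" "\<And>n. y n \<in> Y" "conv y w" "\<And>z. z \<in> Y \<Longrightarrow> ip (\<lambda>x. f x - w x) z = 0"
proof -
  define D where "D y = ip (\<lambda>x. f x - y x) (\<lambda>x. f x - y x)" for y
  define d where "d = Inf (D ` Y)"
  have Dnn: "0 \<le> D y" if "y \<in> Y" for y
    unfolding D_def using that Y f by (intro ip_nonneg diff_mem) auto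
  have bdd: "bdd_below (D ` Y)" using Dnn by (auto intro: bdd_belowI[of _ 0])
  have dle: "d \<le> D y" if "y \<in> Y" for y
    unfolding d_def using bdd that by (rule cINF_lower)
  have "\<exists>y\<in>Y. D y < d + 1 / real (Suc n)" for n
    unfolding d_def using bdd Y(2) cINF_less_iff[of Y D "Inf (D ` Y) + 1 / real (Suc n)"] by auto
  then obtain y where y: "\<And>n. y n \<in> Y" "\<And>n. D (y n) < d + 1 / real (Suc n)" by metis
  define \<delta> where "\<delta> n = 1 / real (Suc n)" for n
  have \<delta>: "\<delta> \<longlonglongrightarrow> 0" unfolding \<delta>_def by (intro LIMSEQ_Suc[OF lim_1_over_n])
  have yD: "D (y n) < d + \<delta> n" for n using y(2) by (simp add: \<delta>_def)
  have yX: "y n \<in> X" for n using y Y by auto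
  \<comment> \<open>The parallelogram law at the midpoint of two near-minimisers makes them close to each other.\<close>
  have par: "ip (\<lambda>x. y m x - y n x) (\<lambda>x. y m x - y n x) \<le> 2 * \<delta> m + 2 * \<delta> n" for m n
  proof -
    define A where "A = (\<lambda>x. f x - y n x)"
    define B where "B = (\<lambda>x. y m x - y n x)"
    define z where "z = (\<lambda>x. y n x + (1/2) * (y m x + (-1) * y n x))"
    have AB: "A \<in> X" "B \<in> X" unfolding A_def B_def using f yX by (auto intro: diff_mem)
    have zY: "z \<in> Y" unfolding z_def by (intro Y y)
    have "D (y n) = ip A A" by (simp add: D_def A_def)
    moreover have "D (y m) = ip A A - 2 * ip A B + ip B B"
      using sq_diff[OF AB] by (simp add: D_def A_def B_def)
    moreover have "D z = ip A A + 2 * (-1/2) * ip A B + (-1/2)\<^sup>2 * ip B B"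
      unfolding sq_comb[OF AB, symmetric] by (simp add: D_def A_def B_def z_def algebra_simps)
    ultimately have "ip B B = 2 * (D (y n) + D (y m) - 2 * D z)"
      by (simp add: power2_eq_square)
    then have "ip B B \<le> 2 * \<delta> m + 2 * \<delta> n" using dle[OF zY] yD[of n] yD[of m] by argo
    then show ?thesis unfolding B_def .
  qed
  have "(\<lambda>n. 2 * \<delta> n) \<longlonglongrightarrow> 2 * 0"
    by (intro tendsto_intros \<delta>)
  then obtain w where w: "w \<in> X" "conv y w"
    using complete_of_tendsto[of y, OF yX _ par] by auto
  have "ip (\<lambda>x. f x - w x) z = 0" if z: "z \<in> Y" for z
  proof (rule linear_quadratic_nonneg)
    have zX: "z \<in> X" using z Y by auto
    show "0 \<le> ip z z" by (rule ip_nonneg[OF zX])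
    fix t :: real
    have "d \<le> (d + \<delta> n) + 2 * t * (ip f z - ip (y n) z) + t\<^sup>2 * ip z z" for n
    proof -
      have "D (\<lambda>x. y n x + (-t) * z x) = D (y n) + 2 * t * ip (\<lambda>x. f x - y n x) z + t\<^sup>2 * ip z z"
        unfolding D_def using sq_comb[OF diff_mem[OF f yX] zX, of n t] by (simp add: algebra_simps)
      moreover have "d \<le> D (\<lambda>x. y n x + (-t) * z x)" by (intro dle Y y z)
      ultimately show ?thesis using yD[of n] ip_diff[OF f yX zX, of n] by simp
    qed
    moreover have "(\<lambda>n. (d + \<delta> n) + 2 * t * (ip f z - ip (y n) z) + t\<^sup>2 * ip z z) \<longlonglongrightarrow>
       (d + 0) + 2 * t * (ip f z - ip w z) + t\<^sup>2 * ip z z"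
      by (intro tendsto_intros \<delta> conv_ip w yX zX)
    ultimately have "d \<le> (d + 0) + 2 * t * (ip f z - ip w z) + t\<^sup>2 * ip z z"
      by (intro LIMSEQ_le_const) auto
    then show "0 \<le> 2 * t * ip (\<lambda>x. f x - w x) z + t\<^sup>2 * ip z z"
      by (simp add: ip_diff[OF f w(1) zX])
  qed
  then show ?thesis using that w y by blast
qed

text \<open>The projection of \<open>f\<close> leaves a remainder orthogonal to \<open>Y\<close>, which totality makes null.\<close>

lemma dense_of_total:
  assumes Y: "Y \<subseteq> X" "(\<lambda>x. 0) \<in> Y" "\<And>f g c. \<lbrakk>f \<in> Y; g \<in> Y\<rbrakk> \<Longrightarrow> (\<lambda>x. f x + c * g x) \<in> Y"
    and total: "\<And>g. \<lbrakk>g \<in> X; \<And>y. y \<in> Y \<Longrightarrow> ip g y = 0\<rbrakk> \<Longrightarrow> ip g g = 0"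
    and f: "f \<in> X" and "0 < \<epsilon>"
  shows "\<exists>y\<in>Y. ip (\<lambda>x. f x - y x) (\<lambda>x. f x - y x) < \<epsilon>"
proof -
  obtain w y where w: "w \<in> X" and y: "\<And>n. y n \<in> Y" "conv y w"
    and orth: "\<And>z. z \<in> Y \<Longrightarrow> ip (\<lambda>x. f x - w x) z = 0"
    using projection[OF Y f] by metis
  have yX: "y n \<in> X" for n using y Y by auto
  have "(\<lambda>n. ip f f - 2 * ip (y n) f + ip (y n) (y n)) \<longlonglongrightarrow> ip f f - 2 * ip w f + ip w w"
    by (intro tendsto_intros conv_ip conv_sq y w yX f)
  then have "(\<lambda>n. ip (\<lambda>x. f x - y n x) (\<lambda>x. f x - y n x)) \<longlonglongrightarrow> ip (\<lambda>x. f x - w x) (\<lambda>x. f x - w x)"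
    by (simp add: sq_diff f w yX ip_sym[OF f yX] ip_sym[OF f w])
  also have "ip (\<lambda>x. f x - w x) (\<lambda>x. f x - w x) = 0"
    by (intro total diff_mem f w orth)
  finally obtain n where "ip (\<lambda>x. f x - y n x) (\<lambda>x. f x - y n x) < \<epsilon>"
    using order_tendstoD(2)[of _ 0 sequentially \<epsilon>] \<open>0 < \<epsilon>\<close> by (auto simp: eventually_sequentially)
  then show ?thesis using y by blast
qed

lemma dense_span_sequence:
  assumes e: "\<And>j. j \<in> J \<Longrightarrow> e j \<in> X"
    and total: "\<And>g. \<lbrakk>g \<in> X; \<And>j. j \<in> J \<Longrightarrow> ip g (e j) = 0\<rbrakk> \<Longrightarrow> ip g g = 0"
    and f: "f \<in> X"
  obtains y where "\<And>n. y n \<in> span_of J e" "conv y f"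
proof -
  note sub = span_of_subspace[of J e, OF e]
  have "\<exists>y\<in>span_of J e. ip (\<lambda>x. f x - y x) (\<lambda>x. f x - y x) < 1 / real (Suc n)" for n
    by (rule dense_of_total[OF sub(1-3) _ f]) (use total sub(4) in auto)
  then obtain y where y: "\<And>n. y n \<in> span_of J e"
    "\<And>n. ip (\<lambda>x. f x - y n x) (\<lambda>x. f x - y n x) < 1 / real (Suc n)" by metis
  have yX: "y n \<in> X" for n using y(1) sub(1) by auto
  have "conv y f"
    unfolding conv_def
  proof (rule tendsto_sandwich)
    show "\<forall>\<^sub>F n in sequentially. 0 \<le> ip (\<lambda>x. y n x - f x) (\<lambda>x. y n x - f x)"
      using yX f by (auto intro!: always_eventually ip_nonneg diff_mem)
    have "ip (\<lambda>x. y n x - f x) (\<lambda>x. y n x - f x) \<le> 1 / real (Suc n)" for n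
      using y(2)[of n] unfolding sq_diff[OF f yX] sq_diff[OF yX f] ip_sym[OF f yX] by linarith
    then show "\<forall>\<^sub>F n in sequentially. ip (\<lambda>x. y n x - f x) (\<lambda>x. y n x - f x) \<le> 1 / real (Suc n)"
      by (intro always_eventually) auto
    show "(\<lambda>n. 1 / real (Suc n)) \<longlonglongrightarrow> 0" by (rule LIMSEQ_Suc[OF lim_1_over_n])
  qed auto
  then show ?thesis using that y(1) by blast
qed

end

section \<open>Spectrum of a compact form\<close>

text \<open>In the application \<open>ip\<close> is the energy and \<open>b\<close> the weighted \<open>L\<^sup>2\<close> product. Compactness is
  stated through Cauchy subsequences because limits for \<open>b\<close> may exist only in a larger space.\<close>

locale compact_pair = hilbert_space X ip + B: form_space X b for X ip b +
  fixes K :: real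
  assumes b_bound: "f \<in> X \<Longrightarrow> b f f \<le> K * ip f f"
    and b_definite: "\<lbrakk>f \<in> X; b f f = 0\<rbrakk> \<Longrightarrow> ip f f = 0"
    and compact: "\<lbrakk>\<And>n. u n \<in> X; \<And>n. ip (u n) (u n) \<le> C\<rbrakk> \<Longrightarrow>
      \<exists>r::nat \<Rightarrow> nat. strict_mono r \<and> (\<forall>\<epsilon>>0. \<exists>N. \<forall>m\<ge>N. \<forall>n\<ge>N.
        b (\<lambda>x. u (r m) x - u (r n) x) (\<lambda>x. u (r m) x - u (r n) x) < \<epsilon>)"
begin

definition eig :: "real \<Rightarrow> ('a \<Rightarrow> real) \<Rightarrow> bool" where
  "eig \<mu> e \<longleftrightarrow> e \<in> X \<and> ip e e \<noteq> 0 \<and> (\<forall>v\<in>X. ip e v = \<mu> * b e v)"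

lemma eigD:
  assumes "eig \<mu> e"
  shows "e \<in> X" "ip e e > 0" "v \<in> X \<Longrightarrow> ip e v = \<mu> * b e v" "0 < \<mu>" "0 < b e e"
proof -
  show e: "e \<in> X" and ev: "v \<in> X \<Longrightarrow> ip e v = \<mu> * b e v" using assms by (auto simp: eig_def)
  show pos: "ip e e > 0" using assms ip_nonneg[OF e] unfolding eig_def by (metis less_eq_real_def)
  have eq: "ip e e = \<mu> * b e e" using assms by (auto simp: eig_def)
  have "b e e \<noteq> 0" using pos eq by auto
  then show b: "0 < b e e" using B.ip_nonneg[OF e] by simp
  show "0 < \<mu>" using pos b unfolding eq by (simp add: zero_less_mult_iff)
qed

lemma conv_B: "\<lbrakk>conv u w; \<And>n. u n \<in> X; w \<in> X\<rbrakk> \<Longrightarrow> B.conv u w"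
proof -
  assume a: "conv u w" "\<And>n. u n \<in> X" "w \<in> X"
  show "B.conv u w" unfolding B.conv_def
  proof (rule tendsto_sandwich)
    show "\<forall>\<^sub>F n in sequentially. 0 \<le> b (\<lambda>x. u n x - w x) (\<lambda>x. u n x - w x)"
      using a by (auto intro!: always_eventually B.ip_nonneg diff_mem)
    show "\<forall>\<^sub>F n in sequentially. b (\<lambda>x. u n x - w x) (\<lambda>x. u n x - w x) \<le> K * ip (\<lambda>x. u n x - w x) (\<lambda>x. u n x - w x)"
      using a by (auto intro!: always_eventually b_bound diff_mem)
    show "(\<lambda>n. K * ip (\<lambda>x. u n x - w x) (\<lambda>x. u n x - w x)) \<longlonglongrightarrow> 0"
      using a(1) unfolding conv_def by (rule tendsto_mult_right_zero)
  qed auto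
qed

lemma normalize:
  assumes "f \<in> X" "ip f f \<noteq> 0"
  shows "ip (\<lambda>x. inverse (sqrt (ip f f)) * f x) (\<lambda>x. inverse (sqrt (ip f f)) * f x) = 1"
proof -
  have pos: "0 < ip f f" using assms ip_nonneg[of f] by simp
  have "ip (\<lambda>x. c * f x) (\<lambda>x. c * f x) = c\<^sup>2 * ip f f" for c
    using ip_sym[OF assms(1) scale_mem[OF assms(1)], of c]
    by (simp add: ip_scale assms scale_mem power2_eq_square)
  then show ?thesis using pos by (simp add: power_inverse)
qed

text \<open>A maximising sequence has a subsequence that is Cauchy for \<open>b\<close>. By the parallelogram laws of
  the two forms, and since \<open>b\<close> is at most \<open>M\<close> times \<open>ip\<close> on \<open>Y\<close>, it is then Cauchy for \<open>ip\<close>, so the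
  maximum is attained in norm without an appeal to weak compactness. The last conclusion is
  the Euler equation.\<close>

lemma constrained_maximizer:
  assumes Y: "Y \<subseteq> X" "(\<lambda>x. 0) \<in> Y" "\<And>f g c. \<lbrakk>f \<in> Y; g \<in> Y\<rbrakk> \<Longrightarrow> (\<lambda>x. f x + c * g x) \<in> Y"
    and closed: "\<And>u w. \<lbrakk>\<And>n. u n \<in> Y; w \<in> X; conv u w\<rbrakk> \<Longrightarrow> w \<in> Y"
    and y0: "y0 \<in> Y" "ip y0 y0 \<noteq> 0"
  obtains w M where "w \<in> Y" "ip w w = 1" "0 < M" "\<And>v. v \<in> Y \<Longrightarrow> b w v = M * ip w v"
proof -
  define S where "S = (\<lambda>y. b y y) ` {y \<in> Y. ip y y = 1}"
  have normY: "(\<lambda>x. inverse (sqrt (ip y y)) * y x) \<in> {y \<in> Y. ip y y = 1}" if "y \<in> Y" "ip y y \<noteq> 0" for y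
    using normalize[of y] that Y(1) Y(3)[OF Y(2) that(1), of "inverse (sqrt (ip y y))"] by auto
  have bdd: "bdd_above S"
    unfolding S_def using b_bound Y(1) by (intro bdd_aboveI[of _ K]) fastforce
  have ne: "S \<noteq> {}" unfolding S_def using normY[OF y0] by blast
  define M where "M = Sup S"
  have scaleb: "b (\<lambda>x. c * y x) (\<lambda>x. c * y x) = c\<^sup>2 * b y y" if "y \<in> X" for c y
    using B.ip_sym[OF that scale_mem[OF that], of c]
    by (simp add: B.ip_scale that scale_mem power2_eq_square)
  have leM: "b y y \<le> M * ip y y" if "y \<in> Y" for y
  proof (cases "ip y y = 0")
    case True
    then show ?thesis using b_bound[of y] that Y(1) by auto
  next
    case False
    have yX: "y \<in> X" using that Y by auto
    have pos: "0 < ip y y" using False ip_nonneg[OF yX] by simp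
    have "b (\<lambda>x. inverse (sqrt (ip y y)) * y x) (\<lambda>x. inverse (sqrt (ip y y)) * y x) \<in> S"
      unfolding S_def using normY[OF that False] by blast
    then have "b (\<lambda>x. inverse (sqrt (ip y y)) * y x) (\<lambda>x. inverse (sqrt (ip y y)) * y x) \<le> M"
      unfolding M_def by (intro cSup_upper bdd)
    then have "inverse (ip y y) * b y y \<le> M"
      unfolding scaleb[OF yX] using pos by (simp add: power_inverse)
    then show ?thesis using pos by (simp add: field_simps)
  qed
  have "M > 0"
  proof -
    have y0X: "y0 \<in> X" using y0 Y by auto
    have "b y0 y0 > 0" using b_definite[OF y0X] y0(2) B.ip_nonneg[OF y0X] by fastforce
    then have "0 < M * ip y0 y0" using leM[OF y0(1)] by linarith
    then show ?thesis using ip_nonneg[OF y0X] by (auto simp: zero_less_mult_iff)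
  qed
  define \<delta> where "\<delta> n = 1 / real (Suc n)" for n
  have \<delta>: "\<delta> \<longlonglongrightarrow> 0" unfolding \<delta>_def by (intro LIMSEQ_Suc[OF lim_1_over_n])
  have "\<exists>u. u \<in> Y \<and> ip u u = 1 \<and> M - \<delta> n < b u u" for n
  proof -
    have "0 < \<delta> n" by (simp add: \<delta>_def)
    then have "\<exists>s\<in>S. M - \<delta> n < s"
      using less_cSup_iff[OF ne bdd, of "M - \<delta> n"] unfolding M_def[symmetric] by simp
    then show ?thesis unfolding S_def by auto
  qed
  then obtain u where u: "\<And>n. u n \<in> Y" "\<And>n. ip (u n) (u n) = 1" "\<And>n. M - \<delta> n < b (u n) (u n)"
    by metis
  have uX: "u n \<in> X" for n using u Y by auto
  obtain r :: "nat \<Rightarrow> nat" where r: "strict_mono r" and cauchy: "\<And>\<epsilon>. \<epsilon> > 0 \<Longrightarrow> \<exists>N. \<forall>m\<ge>N. \<forall>n\<ge>N.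
        b (\<lambda>x. u (r m) x - u (r n) x) (\<lambda>x. u (r m) x - u (r n) x) < \<epsilon>"
    using compact[of u 1, OF uX] u(2) by auto
  define v where "v = u \<circ> r"
  have v: "v n \<in> Y" "v n \<in> X" "ip (v n) (v n) = 1" for n using u uX by (auto simp: v_def)
  have vb: "M - \<delta> n < b (v n) (v n)" for n
  proof -
    have "\<delta> (r n) \<le> \<delta> n" using seq_suble[OF r, of n] by (simp add: \<delta>_def frac_le)
    then show ?thesis using u(3)[of "r n"] by (simp add: v_def)
  qed
  have vbM: "b (v n) (v n) \<le> M" for n using leM[OF v(1)[of n]] v(3) by simp
  \<comment> \<open>The parallelogram law for both forms turns the smallness of the second form on
    differences into smallness of the first one.\<close>
  have "\<exists>w\<in>X. conv v w"
  proof (rule complete[OF v(2)])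
    fix \<epsilon> :: real assume \<epsilon>: "0 < \<epsilon>"
    then have pos: "0 < M * \<epsilon> / 5" using \<open>M > 0\<close> by simp
    obtain N1 where N1: "\<And>m n. m \<ge> N1 \<Longrightarrow> n \<ge> N1 \<Longrightarrow> b (\<lambda>x. v m x - v n x) (\<lambda>x. v m x - v n x) < M * \<epsilon> / 5"
      using cauchy[OF pos] by (auto simp: v_def)
    obtain N2 where N2: "\<And>n. n \<ge> N2 \<Longrightarrow> \<delta> n < M * \<epsilon> / 5"
      using order_tendstoD(2)[OF \<delta> pos] by (auto simp: eventually_sequentially)
    have "ip (\<lambda>x. v m x - v n x) (\<lambda>x. v m x - v n x) < \<epsilon>" if mn: "m \<ge> max N1 N2" "n \<ge> max N1 N2" for m n
    proof -
      have "(\<lambda>x. v m x + v n x) \<in> Y" using Y(3)[OF v(1) v(1), of m 1 n] by simp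
      then have "b (\<lambda>x. v m x + v n x) (\<lambda>x. v m x + v n x) \<le> M * ip (\<lambda>x. v m x + v n x) (\<lambda>x. v m x + v n x)"
        by (rule leM)
      then have "b (v m) (v m) + 2 * b (v m) (v n) + b (v n) (v n) \<le> M * (2 + 2 * ip (v m) (v n))"
        by (simp add: sq_add B.sq_add v)
      moreover have "b (v m) (v m) - 2 * b (v m) (v n) + b (v n) (v n) < M * \<epsilon> / 5"
        using N1[of m n] mn by (simp add: B.sq_diff v)
      moreover have "M - M * \<epsilon> / 5 < b (v m) (v m)" "M - M * \<epsilon> / 5 < b (v n) (v n)"
        using vb[of m] vb[of n] N2[of m] N2[of n] mn by auto
      ultimately have "M * (2 - 2 * ip (v m) (v n)) < M * \<epsilon>"
        by (simp add: right_diff_distrib distrib_left)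
      then show ?thesis using \<open>M > 0\<close> by (simp add: sq_diff v)
    qed
    then show "\<exists>N. \<forall>m\<ge>N. \<forall>n\<ge>N. ip (\<lambda>x. v m x - v n x) (\<lambda>x. v m x - v n x) < \<epsilon>" by blast
  qed
  then obtain w where w: "w \<in> X" "conv v w" by blast
  have wY: "w \<in> Y" using closed[OF v(1) w] .
  have "(\<lambda>n. ip (v n) (v n)) \<longlonglongrightarrow> ip w w" by (intro conv_sq w v)
  then have w1: "ip w w = 1" using v(3) by (simp add: LIMSEQ_const_iff)
  have "(\<lambda>n. b (v n) (v n)) \<longlonglongrightarrow> b w w" by (intro B.conv_sq conv_B w v)
  moreover have "(\<lambda>n. b (v n) (v n)) \<longlonglongrightarrow> M"
  proof (rule tendsto_sandwich)
    show "\<forall>\<^sub>F n in sequentially. M - \<delta> n \<le> b (v n) (v n)" using vb by (auto intro!: always_eventually less_imp_le)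
    show "\<forall>\<^sub>F n in sequentially. b (v n) (v n) \<le> M" using vbM by auto
    show "(\<lambda>n. M - \<delta> n) \<longlonglongrightarrow> M" using tendsto_diff[OF tendsto_const \<delta>, of M] by simp
  qed auto
  ultimately have wM: "b w w = M" by (rule LIMSEQ_unique)
  have "b w v = M * ip w v" if vY: "v \<in> Y" for v
  proof -
    have vX: "v \<in> X" using vY Y by auto
    have "M * ip w v - b w v = 0"
    proof (rule linear_quadratic_nonneg)
      show "0 \<le> M * ip v v - b v v" using leM[OF vY] by simp
      fix t :: real
      show "0 \<le> 2 * t * (M * ip w v - b w v) + t\<^sup>2 * (M * ip v v - b v v)"
        using leM[OF Y(3)[OF wY vY, of t]] unfolding sq_comb[OF w(1) vX] B.sq_comb[OF w(1) vX] wM w1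
        by (simp add: algebra_simps)
    qed
    then show ?thesis by simp
  qed
  then show ?thesis using that wY w1 \<open>M > 0\<close> by blast
qed

text \<open>Otherwise \<open>b\<close> has a maximiser \<open>w\<close> on the complement of all eigenvectors. Its Euler equation
  holds for test vectors in the complement; the other part of a test vector is a limit of combinations of
  eigenvectors, to which \<open>w\<close> is orthogonal for both forms. So \<open>w\<close> is an eigenvector orthogonal to itself.\<close>

lemma eig_total:
  assumes f: "f \<in> X" and orth: "\<And>\<mu> e. eig \<mu> e \<Longrightarrow> ip f e = 0"
  shows "ip f f = 0"
proof (rule ccontr)
  assume nz: "ip f f \<noteq> 0"
  define E where "E = {e. \<exists>\<mu>. eig \<mu> e}"
  define Y where "Y = {y \<in> X. \<forall>e\<in>E. ip y e = 0}"
  have EX: "e \<in> X" if "e \<in> E" for e using that by (auto simp: E_def eig_def)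
  obtain w M where w: "w \<in> Y" "ip w w = 1" "0 < M" "\<And>v. v \<in> Y \<Longrightarrow> b w v = M * ip w v"
  proof (rule constrained_maximizer[of Y f])
    show "Y \<subseteq> X" "(\<lambda>x. 0) \<in> Y" "f \<in> Y"
      using f orth EX by (auto simp: Y_def E_def zero_mem ip_zero)
    show "(\<lambda>x. f x + c * g x) \<in> Y" if "f \<in> Y" "g \<in> Y" for f g c
      using that EX by (auto simp: Y_def comb_mem ip_comb)
    show "w \<in> Y" if "\<And>n. u n \<in> Y" "w \<in> X" "conv u w" for u w
    proof -
      have "ip w e = 0" if "e \<in> E" for e
      proof -
        have "(\<lambda>n. ip (u n) e) \<longlonglongrightarrow> ip w e"
          by (rule conv_ip) (use \<open>\<And>n. u n \<in> Y\<close> \<open>w \<in> X\<close> \<open>conv u w\<close> EX[OF that] in \<open>auto simp: Y_def\<close>)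
        moreover have "ip (u n) e = 0" for n using \<open>\<And>n. u n \<in> Y\<close> that by (auto simp: Y_def)
        ultimately show ?thesis by (simp add: LIMSEQ_const_iff)
      qed
      then show ?thesis using that by (auto simp: Y_def)
    qed
  qed (use nz in auto)
  have wX: "w \<in> X" using w by (auto simp: Y_def)
  define S where "S = span_of E (\<lambda>e. e)"
  have sub: "S \<subseteq> X" "(\<lambda>x. 0) \<in> S" "\<And>f g c. \<lbrakk>f \<in> S; g \<in> S\<rbrakk> \<Longrightarrow> (\<lambda>x. f x + c * g x) \<in> S"
    "\<And>e. e \<in> E \<Longrightarrow> e \<in> S"
    unfolding S_def by (rule span_of_subspace[of E "\<lambda>e. e"]; simp add: EX)+
  have "b w v = M * ip w v" if v: "v \<in> X" for v
  proof -
    obtain z y where z: "z \<in> X" and y: "\<And>n. y n \<in> S" "conv y z"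
      and orthz: "\<And>g. g \<in> S \<Longrightarrow> ip (\<lambda>x. v x - z x) g = 0"
    proof (rule projection[OF sub(1,2) _ v])
      show "(\<lambda>x. f x + c * g x) \<in> S" if "f \<in> S" "g \<in> S" for f g c
        using that by (rule sub(3))
    qed (rule that)
    have yX: "y n \<in> X" for n using y sub(1) by auto
    have vz: "(\<lambda>x. v x - z x) \<in> Y"
      using orthz sub(4) by (auto simp: Y_def diff_mem v z)
    have "ip g w = 0 \<and> b g w = 0" if "g \<in> S" for g
    proof -
      obtain F c where g: "g = (\<lambda>x. \<Sum>e\<in>F. c e * e x)" "F \<subseteq> E" using \<open>g \<in> S\<close> by (auto simp: S_def span_of_def)
      have "ip e w = 0 \<and> b e w = 0" if "e \<in> F" for e
      proof -
        have eE: "e \<in> E" using that g by auto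
        then obtain \<mu> where \<mu>: "eig \<mu> e" by (auto simp: E_def)
        have "ip e w = 0" using w(1) eE ip_sym[OF EX[OF eE] wX] by (auto simp: Y_def)
        then show ?thesis using eigD(3)[OF \<mu> wX] eigD(4)[OF \<mu>] by simp
      qed
      moreover have "\<And>e. e \<in> F \<Longrightarrow> e \<in> X" using g EX by auto
      ultimately show ?thesis unfolding g(1)
        by (simp add: ip_sum[of F "\<lambda>e. e", OF _ wX] B.ip_sum[of F "\<lambda>e. e", OF _ wX])
    qed
    then have "ip (y n) w = 0" "b (y n) w = 0" for n using y by auto
    moreover have "(\<lambda>n. ip (y n) w) \<longlonglongrightarrow> ip z w" "(\<lambda>n. b (y n) w) \<longlonglongrightarrow> b z w"
      using conv_ip[OF y(2) yX z wX] B.conv_ip[OF conv_B[OF y(2) yX z] yX z wX] by auto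
    ultimately have "ip z w = 0" "b z w = 0" by (simp_all add: LIMSEQ_const_iff)
    then show ?thesis
      using w(4)[OF vz] by (simp add: ip_diff_right B.ip_diff_right v z wX ip_sym[OF z wX] B.ip_sym[OF z wX])
  qed
  then have "eig (1 / M) w" unfolding eig_def using w wX by auto
  then have "ip w w = 0" using w(1) by (auto simp: Y_def E_def)
  then show False using w(2) by simp
qed

lemma eig_orthogonal:
  assumes e: "eig \<mu> e" and f: "eig \<nu> f" and ne: "\<mu> \<noteq> \<nu>"
  shows "b e f = 0" "ip e f = 0"
proof -
  have "\<mu> * b e f = \<nu> * b e f"
    using eigD(3)[OF e eigD(1)[OF f]] eigD(3)[OF f eigD(1)[OF e]]
      ip_sym[OF eigD(1)[OF e] eigD(1)[OF f]] B.ip_sym[OF eigD(1)[OF e] eigD(1)[OF f]] by metis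
  then show "b e f = 0" using ne by simp
  then show "ip e f = 0" using eigD(3)[OF e eigD(1)[OF f]] by simp
qed

lemma eig_normalize:
  assumes "eig \<mu> e" obtains e' where "eig \<mu> e'" "ip e' e' = 1"
proof -
  define c where "c = inverse (sqrt (ip e e))"
  have "ip (\<lambda>x. c * e x) (\<lambda>x. c * e x) = 1"
    unfolding c_def using normalize eigD(1,2)[OF assms] by auto
  moreover have "eig \<mu> (\<lambda>x. c * e x)"
    unfolding eig_def
  proof (intro conjI ballI)
    show "(\<lambda>x. c * e x) \<in> X" using eigD(1)[OF assms] by (rule scale_mem)
    show "ip (\<lambda>x. c * e x) (\<lambda>x. c * e x) \<noteq> 0" using calculation by simp
    show "ip (\<lambda>x. c * e x) v = \<mu> * b (\<lambda>x. c * e x) v" if "v \<in> X" for v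
      using eigD(3)[OF assms that] eigD(1)[OF assms] that by (simp add: ip_scale B.ip_scale)
  qed
  ultimately show ?thesis using that by blast
qed

text \<open>Two far terms of a \<open>b\<close>-Cauchy subsequence are \<open>b\<close>-close, and by orthogonality the square of
  their distance is the sum of their squares.\<close>

lemma orthogonal_sequence_small:
  assumes u: "\<And>n::nat. u n \<in> X" "\<And>n. ip (u n) (u n) \<le> C" and orth: "\<And>m n. m \<noteq> n \<Longrightarrow> b (u m) (u n) = 0"
    and \<epsilon>: "0 < \<epsilon>"
  obtains n where "b (u n) (u n) < \<epsilon>"
proof -
  obtain r :: "nat \<Rightarrow> nat" where r: "strict_mono r" and small: "\<forall>\<epsilon>>0. \<exists>N. \<forall>m\<ge>N. \<forall>n\<ge>N.
        b (\<lambda>x. u (r m) x - u (r n) x) (\<lambda>x. u (r m) x - u (r n) x) < \<epsilon>"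
    using compact[of u C, OF u] by auto
  obtain N where N: "\<forall>m\<ge>N. \<forall>n\<ge>N.
        b (\<lambda>x. u (r m) x - u (r n) x) (\<lambda>x. u (r m) x - u (r n) x) < \<epsilon>"
    using small \<epsilon> by auto
  have "r (Suc N) \<noteq> r N" using strict_mono_eq[OF r] by simp
  then have "b (u (r (Suc N))) (u (r (Suc N))) + b (u (r N)) (u (r N)) < \<epsilon>"
    using N[rule_format, of "Suc N" N] by (simp add: B.sq_diff u(1) orth)
  then show ?thesis using that[of "r N"] B.ip_nonneg[OF u(1), of "r (Suc N)"] by auto
qed

text \<open>Normalised eigenvectors of distinct eigenvalues below \<open>R\<close> are \<open>b\<close>-orthogonal and have \<open>b\<close>-square at least
  \<open>1 / R\<close>, which compactness forbids for infinitely many of them.\<close>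

lemma finite_eigenvalues_le: "finite {\<mu>. (\<exists>e. eig \<mu> e) \<and> \<mu> \<le> R}"
proof (rule ccontr)
  assume "infinite {\<mu>. (\<exists>e. eig \<mu> e) \<and> \<mu> \<le> R}"
  then obtain m :: "nat \<Rightarrow> real" where m: "inj m" "range m \<subseteq> {\<mu>. (\<exists>e. eig \<mu> e) \<and> \<mu> \<le> R}"
    using infinite_countable_subset by blast
  have "\<exists>e. eig (m n) e \<and> ip e e = 1" for n
    using m(2) eig_normalize by blast
  then obtain e where e: "\<And>n. eig (m n) (e n)" "\<And>n. ip (e n) (e n) = 1" by metis
  have pos: "0 < m n" "m n \<le> R" for n using eigD(4)[OF e(1)] m(2) by auto
  have R: "0 < R" using pos[of 0] by linarith
  obtain n where n: "b (e n) (e n) < 1 / R"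
  proof (rule orthogonal_sequence_small[of e 1 "1 / R"])
    show "b (e i) (e j) = 0" if "i \<noteq> j" for i j
      by (rule eig_orthogonal(1)[OF e(1) e(1)]) (use that m(1) in \<open>auto dest: injD\<close>)
  qed (use eigD(1)[OF e(1)] e(2) R in auto)
  have "m n * b (e n) (e n) = 1" using eigD(3)[OF e(1) eigD(1)[OF e(1)]] e(2) by metis
  moreover have "m n * b (e n) (e n) \<le> R * b (e n) (e n)"
    using pos eigD(5)[OF e(1)] by (intro mult_right_mono) (auto intro: less_imp_le)
  ultimately show False using n R by (simp add: field_simps)
qed

text \<open>A family that meets every eigenspace up to scaling and null vectors inherits totality.\<close>

lemma eig_family_total:
  assumes e: "\<And>j. j \<in> J \<Longrightarrow> e j \<in> X"
    and all: "\<And>\<mu> h. eig \<mu> h \<Longrightarrow> \<exists>j\<in>J. \<exists>c. ip (\<lambda>x. h x - c * e j x) (\<lambda>x. h x - c * e j x) = 0"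
    and f: "f \<in> X" and orth: "\<And>j. j \<in> J \<Longrightarrow> ip f (e j) = 0"
  shows "ip f f = 0"
proof (rule eig_total[OF f])
  fix \<mu> h assume h: "eig \<mu> h"
  then obtain j c where jc: "j \<in> J" "ip (\<lambda>x. h x - c * e j x) (\<lambda>x. h x - c * e j x) = 0"
    using all by blast
  have "ip h f = ip (\<lambda>x. c * e j x) f"
    by (rule ip_cong_null[OF eigD(1)[OF h] scale_mem[OF e[OF jc(1)]] f]) (use jc in auto)
  then show "ip f h = 0"
    using orth[OF jc(1)] ip_sym[OF f eigD(1)[OF h]] ip_sym[OF f e[OF jc(1)]]
    by (simp add: ip_scale f e jc)
qed

text \<open>If there were finitely many eigenvalues, \<open>ip\<close> would be at most \<open>R\<close> times \<open>b\<close> on the span of the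
  eigenvectors, with \<open>R\<close> the largest eigenvalue, and by density everywhere. A normalised
  \<open>b\<close>-orthogonal sequence contradicts this, because \<open>b\<close> becomes arbitrarily small along it.\<close>

lemma infinite_eigenvalues:
  assumes simple: "\<And>\<mu> e h. \<lbrakk>eig \<mu> e; eig \<mu> h\<rbrakk> \<Longrightarrow> \<exists>c. ip (\<lambda>x. h x - c * e x) (\<lambda>x. h x - c * e x) = 0"
    and \<phi>: "\<And>n::nat. \<phi> n \<in> X" "\<And>n. ip (\<phi> n) (\<phi> n) \<noteq> 0" "\<And>m n. m \<noteq> n \<Longrightarrow> b (\<phi> m) (\<phi> n) = 0"
  shows "infinite {\<mu>. \<exists>e. eig \<mu> e}"
proof
  define A where "A = {\<mu>. \<exists>e. eig \<mu> e}"
  assume "finite {\<mu>. \<exists>e. eig \<mu> e}"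
  then have fin: "finite A" by (simp add: A_def)
  have "\<forall>\<mu>\<in>A. \<exists>e. eig \<mu> e" by (auto simp: A_def)
  then obtain e where e: "\<And>\<mu>. \<mu> \<in> A \<Longrightarrow> eig \<mu> (e \<mu>)" by metis
  have eX: "\<And>\<mu>. \<mu> \<in> A \<Longrightarrow> e \<mu> \<in> X" using e eigD(1) by blast
  \<comment> \<open>The element \<open>1\<close> covers the case that there is no eigenvalue at all.\<close>
  define R where "R = Max (insert 1 A)"
  have R: "1 \<le> R" "\<And>\<mu>. \<mu> \<in> A \<Longrightarrow> \<mu> \<le> R" using fin by (auto simp: R_def)
  have span_le: "ip y y \<le> R * b y y" if ys: "y \<in> span_of A e" for y
  proof -
    obtain F c where y: "y = (\<lambda>x. \<Sum>j\<in>F. c j * e j x)" "finite F" "F \<subseteq> A" using ys by (auto simp: span_of_def)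
    have yX: "y \<in> X" using span_of_subspace(1)[of A e] eX ys by blast
    have eF: "\<And>j. j \<in> F \<Longrightarrow> e j \<in> X" using y eX by auto
    have coef: "b y (e k) = c k * b (e k) (e k)" if "k \<in> F" for k
    proof -
      have "b y (e k) = (\<Sum>j\<in>F. c j * b (e j) (e k))"
        unfolding y(1) by (rule B.ip_sum) (use that eF in auto)
      also have "\<dots> = (\<Sum>j\<in>F. if j = k then c k * b (e k) (e k) else 0)"
        using eig_orthogonal(1)[OF e e] y(3) that by (intro sum.cong) auto
      finally show ?thesis using that y(2) by simp
    qed
    have b_yy: "b y y = (\<Sum>j\<in>F. (c j)\<^sup>2 * b (e j) (e j))"
    proof -
      have "b y y = (\<Sum>j\<in>F. c j * b (e j) y)"
        by (subst (1) y(1)) (rule B.ip_sum, use eF yX in auto)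
      also have "\<dots> = (\<Sum>j\<in>F. (c j)\<^sup>2 * b (e j) (e j))"
        using B.ip_sym[OF eF yX] coef by (intro sum.cong) (auto simp: power2_eq_square)
      finally show ?thesis .
    qed
    have "ip y y = (\<Sum>j\<in>F. c j * ip (e j) y)"
      by (subst (1) y(1)) (rule ip_sum, use eF yX in auto)
    also have "\<dots> = (\<Sum>j\<in>F. j * ((c j)\<^sup>2 * b (e j) (e j)))"
    proof (rule sum.cong)
      fix j assume "j \<in> F"
      then have "ip (e j) y = j * b (e j) y" using eigD(3)[OF e yX] y(3) by auto
      then show "c j * ip (e j) y = j * ((c j)\<^sup>2 * b (e j) (e j))"
        using B.ip_sym[OF eF yX] coef[of j] \<open>j \<in> F\<close> by (auto simp: power2_eq_square)
    qed simp
    also have "\<dots> \<le> (\<Sum>j\<in>F. R * ((c j)\<^sup>2 * b (e j) (e j)))"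
      using y(3) R(2) B.ip_nonneg[OF eF] by (intro sum_mono mult_right_mono) auto
    finally show ?thesis unfolding b_yy by (simp add: sum_distrib_left)
  qed
  have le: "ip f f \<le> R * b f f" if f: "f \<in> X" for f
  proof -
    obtain y where y: "\<And>n. y n \<in> span_of A e" "conv y f"
    proof (rule dense_span_sequence[of A e f])
      show "ip g g = 0" if g: "g \<in> X" "\<And>j. j \<in> A \<Longrightarrow> ip g (e j) = 0" for g
      proof (rule eig_family_total[OF eX _ g])
        fix \<mu> h assume h: "eig \<mu> h"
        then have "\<mu> \<in> A" by (auto simp: A_def)
        then show "\<exists>j\<in>A. \<exists>c. ip (\<lambda>x. h x - c * e j x) (\<lambda>x. h x - c * e j x) = 0"
          using simple[OF e h] by blast
      qed
    qed (use eX f in auto)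
    have yX: "y n \<in> X" for n using y span_of_subspace(1)[of A e] eX by blast
    have "(\<lambda>n. ip (y n) (y n)) \<longlonglongrightarrow> ip f f" "(\<lambda>n. R * b (y n) (y n)) \<longlonglongrightarrow> R * b f f"
      by (intro tendsto_intros conv_sq B.conv_sq conv_B y yX f)+
    then show ?thesis using span_le[OF y(1)] by (intro LIMSEQ_le) auto
  qed
  define \<psi> where "\<psi> n = (\<lambda>x. inverse (sqrt (ip (\<phi> n) (\<phi> n))) * \<phi> n x)" for n
  have \<psi>: "\<psi> n \<in> X" "ip (\<psi> n) (\<psi> n) = 1" for n
    using normalize[OF \<phi>(1,2)] by (auto simp: \<psi>_def scale_mem \<phi>)
  obtain n where n: "b (\<psi> n) (\<psi> n) < 1 / R"
  proof (rule orthogonal_sequence_small[of \<psi> 1 "1 / R"])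
    show "b (\<psi> i) (\<psi> j) = 0" if "i \<noteq> j" for i j
    proof -
      have "b (\<psi> i) (\<psi> j) = inverse (sqrt (ip (\<phi> i) (\<phi> i))) * b (\<phi> i) (\<psi> j)"
        by (subst (1) \<psi>_def) (rule B.ip_scale[OF \<phi>(1) \<psi>(1)])
      also have "b (\<phi> i) (\<psi> j) = b (\<psi> j) (\<phi> i)" by (rule B.ip_sym[OF \<phi>(1) \<psi>(1)])
      also have "b (\<psi> j) (\<phi> i) = inverse (sqrt (ip (\<phi> j) (\<phi> j))) * b (\<phi> j) (\<phi> i)"
        by (subst (1) \<psi>_def) (rule B.ip_scale[OF \<phi>(1) \<phi>(1)])
      finally show ?thesis using \<phi>(3)[of j i] that by simp
    qed
  qed (use \<psi> R(1) in auto)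
  then show False using le[OF \<psi>(1), of n] \<psi>(2)[of n] R(1) by (simp add: field_simps)
qed

end

text \<open>Each element has a successor, since only finitely many elements lie below any bound; iterating it
  from the least element reaches every element for the same reason.\<close>

lemma enumerate_locally_finite:
  fixes A :: "real set"
  assumes inf: "infinite A" and fin: "\<And>R. finite {x \<in> A. x \<le> R}"
  obtains \<Lambda> :: "nat \<Rightarrow> real" where "A = \<Lambda> ` {1..}" "strict_mono_on {1..} \<Lambda>" "filterlim \<Lambda> at_top sequentially"
proof -
  have least: "\<exists>m\<in>B. \<forall>x\<in>B. m \<le> x" if B: "B \<subseteq> A" "B \<noteq> {}" for B
  proof -
    obtain y where y: "y \<in> B" using B by auto
    have f: "finite {x \<in> B. x \<le> y}" by (rule finite_subset[OF _ fin[of y]]) (use B in auto)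
    define m where "m = Min {x \<in> B. x \<le> y}"
    have "m \<in> {x \<in> B. x \<le> y}" unfolding m_def using f y by (intro Min_in) auto
    moreover have "m \<le> x" if "x \<in> B" for x
    proof (cases "x \<le> y")
      case True then show ?thesis unfolding m_def using f that by (intro Min_le) auto
    next
      case False then show ?thesis using calculation by simp
    qed
    ultimately show ?thesis by auto
  qed
  have above: "{x \<in> A. R < x} \<noteq> {}" for R
  proof
    assume "{x \<in> A. R < x} = {}"
    then have "A = {x \<in> A. x \<le> R}" by fastforce
    then show False using inf fin[of R] by simp
  qed
  define nxt where "nxt R = (SOME m. m \<in> A \<and> R < m \<and> (\<forall>x\<in>A. R < x \<longrightarrow> m \<le> x))" for R
  have nxt: "nxt R \<in> A" "R < nxt R" "\<And>x. x \<in> A \<Longrightarrow> R < x \<Longrightarrow> nxt R \<le> x" for R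
  proof -
    have "\<exists>m. m \<in> A \<and> R < m \<and> (\<forall>x\<in>A. R < x \<longrightarrow> m \<le> x)"
      using least[OF _ above[of R]] by auto
    from someI_ex[OF this] show "nxt R \<in> A" "R < nxt R" "\<And>x. x \<in> A \<Longrightarrow> R < x \<Longrightarrow> nxt R \<le> x"
      unfolding nxt_def by auto
  qed
  obtain a0 where a0: "a0 \<in> A" "\<And>x. x \<in> A \<Longrightarrow> a0 \<le> x" using least[of A] inf by fastforce
  define L where "L = (\<lambda>n. (nxt ^^ n) a0)"
  have L0: "L 0 = a0" and LS: "L (Suc n) = nxt (L n)" for n by (auto simp: L_def)
  have LA: "L n \<in> A" for n by (cases n) (auto simp: L0 LS a0 nxt)
  have sm: "strict_mono L" by (rule strict_monoI_Suc) (simp add: LS nxt)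
  have range: "A = range L"
  proof (rule ccontr)
    assume "A \<noteq> range L"
    then obtain x where x: "x \<in> A" "x \<notin> range L" using LA by auto
    have "L n < x" for n
    proof (induction n)
      case 0 then show ?case using a0(2)[OF x(1)] x(2) L0 by (metis less_eq_real_def rangeI)
    next
      case (Suc n) then show ?case using nxt(3)[OF x(1) Suc] x(2) LS by (metis less_eq_real_def rangeI)
    qed
    then have "range L \<subseteq> {y \<in> A. y \<le> x}" using LA by (auto intro: less_imp_le)
    then have "finite (range L)" using fin finite_subset by blast
    then show False using range_inj_infinite[OF strict_mono_imp_inj_on[OF sm]] by simp
  qed
  have lim: "filterlim L at_top sequentially"
    unfolding filterlim_at_top
  proof
    fix Z
    have "\<exists>n. Z < L n"
    proof (rule ccontr)
      assume "\<not> ?thesis"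
      then have "range L \<subseteq> {y \<in> A. y \<le> Z}" using LA by (auto simp: not_less)
      then have "finite (range L)" using fin finite_subset by blast
      then show False using range_inj_infinite[OF strict_mono_imp_inj_on[OF sm]] by simp
    qed
    then obtain n where n: "Z < L n" by blast
    have "Z \<le> L k" if "k \<ge> n" for k using strict_mono_leD[OF sm that] n by linarith
    then show "\<forall>\<^sub>F n in sequentially. Z \<le> L n" by (auto simp: eventually_sequentially)
  qed
  define \<Lambda> where "\<Lambda> n = L (n - 1)" for n
  have "A = \<Lambda> ` {1..}"
  proof -
    have "{1..} = range Suc" by (auto simp: image_iff Suc_le_eq dest: gr0_implies_Suc)
    then have "range L = \<Lambda> ` {1..}" by (simp add: \<Lambda>_def image_image)
    then show ?thesis using range by simp
  qed
  moreover have "strict_mono_on {1..} \<Lambda>"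
    unfolding \<Lambda>_def by (intro strict_mono_onI strict_monoD[OF sm]) auto
  moreover have "filterlim \<Lambda> at_top sequentially"
  proof -
    have "(\<lambda>n. \<Lambda> (Suc n)) = L" by (simp add: \<Lambda>_def)
    then show ?thesis using filterlim_sequentially_Suc[of \<Lambda> at_top] lim by simp
  qed
  ultimately show ?thesis using that by blast
qed

section \<open>Smooth functions and test functions\<close>

definition smooth :: "(real \<Rightarrow> real) \<Rightarrow> bool" where
  "smooth f \<longleftrightarrow> (\<forall>n x. (deriv ^^ n) f field_differentiable at x)"

text \<open>Smoothness is shown by exhibiting a family of functions closed under differentiation, which
  avoids formulas for higher derivatives.\<close>

lemma smooth_coinduct:
  assumes "f \<in> S" and S: "\<And>f. f \<in> S \<Longrightarrow> \<exists>f'\<in>S. \<forall>x. (f has_field_derivative f' x) (at x)"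
  shows "smooth f"
proof -
  have "(deriv ^^ n) f \<in> S" for n
  proof (induction n)
    case (Suc n)
    then obtain f' where f': "f' \<in> S" "\<And>x. ((deriv ^^ n) f has_field_derivative f' x) (at x)" using S by blast
    then have "deriv ((deriv ^^ n) f) = f'" by (intro ext DERIV_imp_deriv)
    then show ?case using f' by simp
  qed (simp add: assms)
  then show ?thesis unfolding smooth_def field_differentiable_def using S by blast
qed

lemma smooth_DERIV: "smooth f \<Longrightarrow> (f has_field_derivative deriv f x) (at x)"
  using DERIV_deriv_iff_field_differentiable[of f x] unfolding smooth_def by (metis funpow_0)

lemma smooth_deriv: "smooth f \<Longrightarrow> smooth (deriv f)"
  unfolding smooth_def by (metis funpow_Suc_right comp_apply)

lemma smooth_continuous: "smooth f \<Longrightarrow> continuous_on A f"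
  by (meson DERIV_isCont continuous_at_imp_continuous_on smooth_DERIV)

text \<open>Closing the smooth functions under sums and products gives a family stable under
  differentiation, so coinduction replaces the Leibniz formula for higher derivatives.\<close>

inductive_set smooth_closure :: "(real \<Rightarrow> real) set" where
  base: "smooth f \<Longrightarrow> f \<in> smooth_closure"
| add: "\<lbrakk>f \<in> smooth_closure; g \<in> smooth_closure\<rbrakk> \<Longrightarrow> (\<lambda>x. f x + g x) \<in> smooth_closure"
| mult: "\<lbrakk>f \<in> smooth_closure; g \<in> smooth_closure\<rbrakk> \<Longrightarrow> (\<lambda>x. f x * g x) \<in> smooth_closure"

lemma smooth_closure_smooth: "f \<in> smooth_closure \<Longrightarrow> smooth f"
proof (rule smooth_coinduct)
  fix f assume "f \<in> smooth_closure"
  then show "\<exists>f'\<in>smooth_closure. \<forall>x. (f has_field_derivative f' x) (at x)"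
  proof induction
    case (base f)
    then show ?case using smooth_DERIV smooth_deriv smooth_closure.base by blast
  next
    case (add f g)
    then obtain f' g' where "f' \<in> smooth_closure" "\<And>x. (f has_field_derivative f' x) (at x)"
      "g' \<in> smooth_closure" "\<And>x. (g has_field_derivative g' x) (at x)" by blast
    then show ?case
      by (intro bexI[of _ "\<lambda>x. f' x + g' x"] allI DERIV_add smooth_closure.add) auto
  next
    case (mult f g)
    then obtain f' g' where *: "f' \<in> smooth_closure" "\<And>x. (f has_field_derivative f' x) (at x)"
      "g' \<in> smooth_closure" "\<And>x. (g has_field_derivative g' x) (at x)" by blast
    have "((\<lambda>x. f x * g x) has_field_derivative f' x * g x + g' x * f x) (at x)" for x
      using DERIV_mult[OF *(2,4)] .
    then show ?case
      by (intro bexI[of _ "\<lambda>x. f' x * g x + g' x * f x"] allI smooth_closure.intros * mult.hyps)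
  qed
qed

lemma smooth_add: "\<lbrakk>smooth f; smooth g\<rbrakk> \<Longrightarrow> smooth (\<lambda>x. f x + g x)"
  and smooth_mult: "\<lbrakk>smooth f; smooth g\<rbrakk> \<Longrightarrow> smooth (\<lambda>x. f x * g x)"
  by (auto intro: smooth_closure_smooth smooth_closure.intros)

lemma smooth_affine: "smooth (\<lambda>x. s * x + t)"
proof (rule smooth_coinduct[of _ "{f. \<exists>s t. f = (\<lambda>x. s * x + t)}"])
  fix f :: "real \<Rightarrow> real" assume "f \<in> {f. \<exists>s t. f = (\<lambda>x. s * x + t)}"
  then obtain s t where f: "f = (\<lambda>x. s * x + t)" by blast
  have "(f has_field_derivative 0 * x + s) (at x)" for x
    unfolding f by (auto intro!: derivative_eq_intros)
  then show "\<exists>f'\<in>{f. \<exists>s t. f = (\<lambda>x. s * x + t)}. \<forall>x. (f has_field_derivative f' x) (at x)"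
    by (intro bexI[of _ "\<lambda>x. 0 * x + s"]) blast+
qed blast

lemma smooth_const: "smooth (\<lambda>x. c)"
  using smooth_affine[of 0 c] by simp

lemma smooth_compose_affine:
  assumes "smooth f" shows "smooth (\<lambda>x. f (s * x + t))"
proof (rule smooth_coinduct[of _ "{g. \<exists>k f. smooth f \<and> g = (\<lambda>x. k * f (s * x + t))}"])
  show "(\<lambda>x. f (s * x + t)) \<in> {g. \<exists>k f. smooth f \<and> g = (\<lambda>x. k * f (s * x + t))}"
    using assms by (auto intro!: exI[of _ 1] exI[of _ f])
  fix g assume "g \<in> {g. \<exists>k f. smooth f \<and> g = (\<lambda>x. k * f (s * x + t))}"
  then obtain k f where f: "smooth f" "g = (\<lambda>x. k * f (s * x + t))" by auto
  have "(g has_field_derivative (k * s) * deriv f (s * x + t)) (at x)" for x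
  proof -
    have "((\<lambda>x. f (s * x + t)) has_field_derivative deriv f (s * x + t) * s) (at x)"
      by (rule DERIV_chain2[OF smooth_DERIV[OF f(1)]]) (auto intro!: derivative_eq_intros)
    from DERIV_cmult[OF this, of k] show ?thesis unfolding f by (simp add: mult_ac)
  qed
  then show "\<exists>f'\<in>{g. \<exists>k f. smooth f \<and> g = (\<lambda>x. k * f (s * x + t))}. \<forall>x. (g has_field_derivative f' x) (at x)"
    using smooth_deriv[OF f(1)] by (intro bexI[of _ "\<lambda>x. (k * s) * deriv f (s * x + t)"]) auto
qed

text \<open>For \<open>q = 1\<close> this is the standard flat function \<open>exp (- 1 / x)\<close>; the polynomial factor makes the
  family closed under differentiation.\<close>

definition flat :: "real poly \<Rightarrow> real \<Rightarrow> real" where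
  "flat q x = (if x \<le> 0 then 0 else poly q (1 / x) * exp (- (1 / x)))"

lemma poly_exp_decay: "((\<lambda>z::real. poly q z * exp (- z)) \<longlongrightarrow> 0) at_top"
proof -
  have "((\<lambda>z::real. \<Sum>i\<le>degree q. coeff q i * (z ^ i / exp z)) \<longlongrightarrow> (\<Sum>i\<le>degree q. coeff q i * 0)) at_top"
    by (intro tendsto_intros tendsto_power_div_exp_0)
  moreover have "(\<lambda>z::real. \<Sum>i\<le>degree q. coeff q i * (z ^ i / exp z)) = (\<lambda>z. poly q z * exp (- z))"
    by (simp add: poly_altdef sum_distrib_right exp_minus divide_inverse mult.assoc)
  ultimately show ?thesis by simp
qed

lemma flat_DERIV:
  "(flat q has_field_derivative flat (monom 1 2 * (q - pderiv q)) x) (at x)"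
proof -
  consider "x < 0" | "x = 0" | "x > 0" by linarith
  then show ?thesis
  proof cases
    case 1
    have "((\<lambda>_. 0::real) has_field_derivative 0) (at x)" by simp
    then have "(flat q has_field_derivative 0) (at x)"
      by (rule has_field_derivative_transform_within_open[of _ _ _ "{..<0}"]) (use 1 in \<open>auto simp: flat_def\<close>)
    then show ?thesis using 1 by (simp add: flat_def)
  next
    case 3
    have "((\<lambda>x. poly q (1 / x) * exp (- (1 / x))) has_field_derivative
       poly (monom 1 2 * (q - pderiv q)) (1 / x) * exp (- (1 / x))) (at x)"
      using 3 by (auto intro!: derivative_eq_intros simp: poly_monom power2_eq_square field_simps)
    then have "(flat q has_field_derivative poly (monom 1 2 * (q - pderiv q)) (1 / x) * exp (- (1 / x))) (at x)"
      by (rule has_field_derivative_transform_within_open[of _ _ _ "{0<..}"]) (use 3 in \<open>auto simp: flat_def\<close>)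
    then show ?thesis using 3 by (simp add: flat_def)
  next
    case 2
    have "((\<lambda>y. (flat q y - flat q 0) / (y - 0)) \<longlongrightarrow> 0) (at 0)"
    proof (rule filterlim_split_at)
      have "\<forall>\<^sub>F y in at_left 0. (flat q y - flat q 0) / (y - 0) = 0"
        by (auto simp: flat_def eventually_at_filter)
      then show "((\<lambda>y. (flat q y - flat q 0) / (y - 0)) \<longlongrightarrow> 0) (at_left 0)"
        by (simp add: tendsto_eventually)
      have "((\<lambda>y::real. poly (monom 1 1 * q) (1 / y) * exp (- (1 / y))) \<longlongrightarrow> 0) (at_right 0)"
        by (rule filterlim_compose[OF poly_exp_decay])
           (simp add: filterlim_inverse_at_top_right inverse_eq_divide[symmetric])
      moreover have "\<forall>\<^sub>F y in at_right 0. poly (monom 1 1 * q) (1 / y) * exp (- (1 / y)) = (flat q y - flat q 0) / (y - 0)"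
        by (auto simp: flat_def eventually_at_filter poly_monom)
      ultimately show "((\<lambda>y. (flat q y - flat q 0) / (y - 0)) \<longlongrightarrow> 0) (at_right 0)"
        by (rule Lim_transform_eventually)
    qed
    then show ?thesis using 2 by (simp add: has_field_derivative_iff flat_def)
  qed
qed

lemma smooth_flat: "smooth (flat q)"
  by (rule smooth_coinduct[of _ "range flat"]) (use flat_DERIV in auto)

text \<open>Smooth approximations of the indicator of the positive half line. The shift by \<open>1\<close> keeps the support
  away from \<open>0\<close>, so that bumps on an interval with end points \<open>\<plusminus>\<pi>\<close> still have compact support in \<open>I\<close>.\<close>

definition step :: "nat \<Rightarrow> real \<Rightarrow> real" where
  "step n x = flat 1 (real (Suc n) * x - 1)"

lemma smooth_step: "smooth (\<lambda>x. step n (s * x + t))"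
proof -
  have "(\<lambda>x. step n (s * x + t)) = (\<lambda>x. flat 1 ((real (Suc n) * s) * x + (real (Suc n) * t - 1)))"
    by (simp add: step_def algebra_simps)
  then show ?thesis using smooth_compose_affine[OF smooth_flat] by simp
qed

lemma step_nonneg: "0 \<le> step n x" and step_le_1: "step n x \<le> 1"
  by (auto simp: step_def flat_def)

lemma step_eq_0: "x \<le> 1 / real (Suc n) \<Longrightarrow> step n x = 0"
  by (auto simp: step_def flat_def field_simps)

lemma step_tendsto: "(\<lambda>n. step n x) \<longlonglongrightarrow> (if 0 < x then 1 else 0)"
proof (cases "0 < x")
  case True
  have lim: "filterlim (\<lambda>n. real (Suc n) * x - 1) at_top sequentially"
    using True by real_asymp
  have "(\<lambda>n. exp (- (inverse (real (Suc n) * x - 1)))) \<longlonglongrightarrow> exp (- 0)"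
    by (intro tendsto_intros tendsto_inverse_0_at_top lim)
  moreover have "\<forall>\<^sub>F n in sequentially. exp (- (inverse (real (Suc n) * x - 1))) = step n x"
    using filterlim_at_top_dense[THEN iffD1, OF lim, rule_format, of 0]
    by (auto elim!: eventually_mono simp: step_def flat_def inverse_eq_divide)
  ultimately show ?thesis using True by (simp add: Lim_transform_eventually)
next
  case False
  then have "step n x = 0" for n
    by (intro step_eq_0) (simp add: order_trans[of x 0])
  then show ?thesis using False by simp
qed

definition bump :: "real \<Rightarrow> real \<Rightarrow> nat \<Rightarrow> real \<Rightarrow> real" where
  "bump c d n x = step n (x - c) * step n (d - x)"

lemma bump_tendsto: "(\<lambda>n. bump c d n x) \<longlonglongrightarrow> indicator {c<..<d} x"
  using tendsto_mult[OF step_tendsto[of "x - c"] step_tendsto[of "d - x"]]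
  by (auto simp: bump_def indicator_def split: if_splits)

text \<open>A compact subset of the open interval lies in a closed subinterval; bounds \<open>c\<close> and \<open>d\<close> are more
  convenient than a compact set.\<close>

lemma test_fun_iff:
  "\<phi> \<in> test_fun \<longleftrightarrow> smooth \<phi> \<and> (\<exists>c d. -pi < c \<and> d < pi \<and> (\<forall>x. x \<notin> {c..d} \<longrightarrow> \<phi> x = 0))"
proof
  assume "\<phi> \<in> test_fun"
  then obtain K where sm: "smooth \<phi>" and K: "compact K" "K \<subseteq> I" "\<And>x. x \<notin> K \<Longrightarrow> \<phi> x = 0"
    by (auto simp: test_fun_def smooth_def)
  show "smooth \<phi> \<and> (\<exists>c d. -pi < c \<and> d < pi \<and> (\<forall>x. x \<notin> {c..d} \<longrightarrow> \<phi> x = 0))"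
  proof (cases "K = {}")
    case True
    then show ?thesis using sm K by (auto intro!: exI[of _ 0])
  next
    case False
    obtain c d where cd: "c \<in> K" "\<And>x. x \<in> K \<Longrightarrow> c \<le> x" "d \<in> K" "\<And>x. x \<in> K \<Longrightarrow> x \<le> d"
      using compact_attains_inf[OF K(1) False] compact_attains_sup[OF K(1) False] by blast
    have "\<phi> x = 0" if "x \<notin> {c..d}" for x using K(3)[of x] cd(2,4)[of x] that by auto
    moreover have "-pi < c" "d < pi" using cd(1,3) K(2) by (auto simp: I_def)
    ultimately show ?thesis using sm by metis
  qed
next
  assume "smooth \<phi> \<and> (\<exists>c d. -pi < c \<and> d < pi \<and> (\<forall>x. x \<notin> {c..d} \<longrightarrow> \<phi> x = 0))"
  then obtain c d where sm: "smooth \<phi>" and cd: "-pi < c" "d < pi" "\<forall>x. x \<notin> {c..d} \<longrightarrow> \<phi> x = 0"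
    by (elim conjE exE) (rule that)
  have "compact {c..d} \<and> {c..d} \<subseteq> I \<and> (\<forall>x. x \<notin> {c..d} \<longrightarrow> \<phi> x = 0)"
    using cd by (auto simp: I_def)
  then show "\<phi> \<in> test_fun"
    using sm unfolding test_fun_def smooth_def by (intro CollectI conjI exI[of _ "{c..d}"]) simp_all
qed

lemma bump_test_fun:
  assumes "-pi \<le> c" "d \<le> pi" shows "bump c d n \<in> test_fun"
  unfolding test_fun_iff
proof (intro conjI exI allI impI)
  show "smooth (bump c d n)"
    using smooth_mult[OF smooth_step[of n 1 "-c"] smooth_step[of n "-1" d]] by (simp add: bump_def[abs_def])
  have "0 < 1 / real (Suc n)" by simp
  then show "-pi < c + 1 / real (Suc n)" "d - 1 / real (Suc n) < pi"
    using assms by linarith+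
  show "bump c d n x = 0" if x: "x \<notin> {c + 1 / real (Suc n)..d - 1 / real (Suc n)}" for x
  proof (cases "x < c + 1 / real (Suc n)")
    case True
    then show ?thesis using step_eq_0[of "x - c" n] by (simp add: bump_def)
  next
    case False
    then have "d - x \<le> 1 / real (Suc n)" using x unfolding atLeastAtMost_iff by linarith
    then show ?thesis using step_eq_0[of "d - x" n] by (simp add: bump_def)
  qed
qed

lemma test_fun_deriv: "\<phi> \<in> test_fun \<Longrightarrow> deriv \<phi> \<in> test_fun"
proof -
  assume "\<phi> \<in> test_fun"
  then obtain c d where sm: "smooth \<phi>" and cd: "-pi < c" "d < pi" "\<And>x. x \<notin> {c..d} \<Longrightarrow> \<phi> x = 0"
    by (auto simp: test_fun_iff)
  have "deriv \<phi> x = 0" if "x \<notin> {c..d}" for x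
  proof -
    have "((\<lambda>_. 0::real) has_field_derivative 0) (at x)" by simp
    then have "(\<phi> has_field_derivative 0) (at x)"
      by (rule has_field_derivative_transform_within_open[of _ _ _ "- {c..d}"]) (use that cd(3) in auto)
    then show ?thesis by (rule DERIV_imp_deriv)
  qed
  then show ?thesis using cd smooth_deriv[OF sm] by (auto simp: test_fun_iff)
qed

lemma test_fun_mult: "\<lbrakk>\<phi> \<in> test_fun; smooth f\<rbrakk> \<Longrightarrow> (\<lambda>x. \<phi> x * f x) \<in> test_fun"
  using smooth_mult[of \<phi> f] by (auto simp: test_fun_iff)

lemma test_fun_comb:
  assumes "\<phi> \<in> test_fun" "\<psi> \<in> test_fun" shows "(\<lambda>x. \<phi> x + k * \<psi> x) \<in> test_fun"
proof -
  obtain c d where 1: "-pi < c" "d < pi" "\<And>x. x \<notin> {c..d} \<Longrightarrow> \<phi> x = 0"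
    using assms(1) by (auto simp: test_fun_iff)
  obtain c' d' where 2: "-pi < c'" "d' < pi" "\<And>x. x \<notin> {c'..d'} \<Longrightarrow> \<psi> x = 0"
    using assms(2) by (auto simp: test_fun_iff)
  have "-pi < min c c'" "max d d' < pi" using 1 2 by auto
  moreover have "\<phi> x + k * \<psi> x = 0" if "x \<notin> {min c c'..max d d'}" for x
    using 1(3)[of x] 2(3)[of x] that by (auto simp: min_le_iff_disj le_max_iff_disj)
  moreover have "smooth (\<lambda>x. \<phi> x + k * \<psi> x)"
    using assms by (intro smooth_add smooth_mult smooth_const) (auto simp: test_fun_iff)
  ultimately show ?thesis unfolding test_fun_iff by blast
qed

lemma test_fun_zero: "(\<lambda>x. 0) \<in> test_fun"
  unfolding test_fun_iff using smooth_const pi_gt_zero by (auto intro!: exI[of _ 0])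

lemma test_fun_D: "\<phi> \<in> test_fun \<Longrightarrow> smooth \<phi>" "\<phi> \<in> test_fun \<Longrightarrow> x \<notin> I \<Longrightarrow> \<phi> x = 0"
  by (auto simp: test_fun_def smooth_def)

section \<open>The fundamental lemma of the calculus of variations\<close>

abbreviation M :: "real measure" where "M \<equiv> lebesgue_on I"

lemma space_M [simp]: "space M = I"
  by (simp add: space_restrict_space)

lemma I_sets [measurable, simp]: "I \<in> sets lebesgue" "I \<in> sets lborel" "I \<in> sets borel"
  by (auto simp: I_def)

lemma measure_M_I: "measure M I = 2 * pi" "emeasure M I = 2 * pi"
proof -
  show "emeasure M I = 2 * pi"
    by (subst emeasure_restrict_space) (auto simp: I_def)
  then show "measure M I = 2 * pi" by (simp add: measure_def)
qed

interpretation M: finite_measure M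
  by (rule finite_measureI) (simp add: measure_M_I)

lemma borel_measurable_M: "f \<in> borel_measurable borel \<Longrightarrow> f \<in> borel_measurable M"
  by (intro measurable_restrict_space1 measurable_completion) simp

lemma integrable_M_bounded:
  fixes f :: "real \<Rightarrow> real"
  assumes "f \<in> borel_measurable M" "\<And>x. x \<in> I \<Longrightarrow> \<bar>f x\<bar> \<le> B"
  shows "integrable M f"
  by (rule M.integrable_const_bound[of _ B]) (use assms in \<open>auto intro!: AE_I2\<close>)

lemma integral_M_lborel:
  fixes f :: "real \<Rightarrow> real"
  assumes "f \<in> borel_measurable borel"
  shows "(\<integral>x. f x \<partial>M) = (\<integral>x. indicator I x * f x \<partial>lborel)"
proof -
  have "(\<integral>x. f x \<partial>M) = (\<integral>x. indicator I x * f x \<partial>lebesgue)"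
    by (subst integral_restrict_space) (auto simp: mult.commute)
  also have "\<dots> = (\<integral>x. indicator I x * f x \<partial>lborel)"
    using assms by (intro integral_completion) auto
  finally show ?thesis .
qed

lemma FTC_M:
  assumes F: "\<And>x. (F has_field_derivative f x) (at x)" and f: "\<And>x. isCont f x"
    and ab: "-pi \<le> a" "a \<le> b" "b \<le> pi"
  shows "(\<integral>x. indicator {a..b} x * f x \<partial>M) = F b - F a"
proof -
  have fm [measurable]: "f \<in> borel_measurable borel"
    using f by (intro borel_measurable_continuous_onI) (simp add: continuous_at_imp_continuous_on)
  have "(\<integral>x. indicator {a..b} x * f x \<partial>M) = (\<integral>x. indicator I x * (indicator {a..b} x * f x) \<partial>lborel)"
    by (rule integral_M_lborel) simp
  also have "\<dots> = (\<integral>x. f x * indicator {a..b} x \<partial>lborel)"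
  proof (rule integral_cong_AE)
    have "AE x in lborel. x \<noteq> pi" "AE x in lborel. x \<noteq> -pi"
      by (auto intro: AE_lborel_singleton)
    then show "AE x in lborel. indicator I x * (indicator {a..b} x * f x) = f x * indicator {a..b} x"
      by eventually_elim (use ab in \<open>auto simp: I_def indicator_def\<close>)
  qed simp_all
  also have "\<dots> = F b - F a"
    by (rule integral_FTC_Icc_real) (use ab F f in auto)
  finally show ?thesis .
qed

lemma integrable_M_continuous:
  fixes f :: "real \<Rightarrow> real"
  assumes "continuous_on UNIV f"
  shows "integrable M f"
proof -
  have "bounded (f ` {-pi..pi})"
    by (intro compact_imp_bounded compact_continuous_image continuous_on_subset[OF assms]) auto
  then obtain B where "\<forall>x\<in>{-pi..pi}. \<bar>f x\<bar> \<le> B" by (auto simp: bounded_iff)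
  then show ?thesis
    by (intro integrable_M_bounded[of _ B] borel_measurable_M borel_measurable_continuous_onI assms) (auto simp: I_def)
qed

text \<open>The positive and the negative part of \<open>g\<close> are densities of finite measures that agree on half lines,
  hence on all Borel sets.\<close>

lemma AE_zero_if_half_lines:
  fixes g :: "real \<Rightarrow> real"
  assumes g: "integrable lborel g" and zero: "\<And>x. (\<integral>y. g y * indicator {x<..} y \<partial>lborel) = 0"
  shows "AE x in lborel. g x = 0"
proof -
  have gm [measurable]: "g \<in> borel_measurable borel" using g by auto
  let ?p = "\<lambda>x. max 0 (g x)" and ?n = "\<lambda>x. max 0 (- g x)"
  have pn: "integrable lborel ?p" "integrable lborel ?n" using g by auto
  have em: "emeasure (density lborel (\<lambda>x. ennreal (h x))) {x<..} = ennreal (\<integral>y. h y * indicator {x<..} y \<partial>lborel)"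
    if "integrable lborel h" "\<And>x. 0 \<le> h x" for h :: "real \<Rightarrow> real" and x
  proof -
    have "emeasure (density lborel (\<lambda>x. ennreal (h x))) {x<..} = (\<integral>\<^sup>+y. ennreal (h y) * indicator {x<..} y \<partial>lborel)"
      using that by (subst emeasure_density) auto
    also have "\<dots> = (\<integral>\<^sup>+y. ennreal (h y * indicator {x<..} y) \<partial>lborel)"
      by (intro nn_integral_cong) (auto simp: indicator_def)
    also have "\<dots> = ennreal (\<integral>y. h y * indicator {x<..} y \<partial>lborel)"
      using that by (intro nn_integral_eq_integral integrable_real_mult_indicator) (auto simp: indicator_def)
    finally show ?thesis .
  qed
  have "density lborel (\<lambda>x. ennreal (?p x)) = density lborel (\<lambda>x. ennreal (?n x))"
  proof (rule measure_eqI_lessThan)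
    fix x
    show "emeasure (density lborel (\<lambda>x. ennreal (?p x))) {x<..} < \<infinity>"
      by (subst em[OF pn(1)]) auto
    have "(\<integral>y. ?p y * indicator {x<..} y \<partial>lborel) - (\<integral>y. ?n y * indicator {x<..} y \<partial>lborel) =
       (\<integral>y. ?p y * indicator {x<..} y - ?n y * indicator {x<..} y \<partial>lborel)"
      using pn by (intro Bochner_Integration.integral_diff[symmetric] integrable_real_mult_indicator) auto
    also have "\<dots> = (\<integral>y. g y * indicator {x<..} y \<partial>lborel)"
      by (intro Bochner_Integration.integral_cong) (auto simp: indicator_def max_def)
    also have "\<dots> = 0" by (rule zero)
    finally show "emeasure (density lborel (\<lambda>x. ennreal (?p x))) {x<..} = emeasure (density lborel (\<lambda>x. ennreal (?n x))) {x<..}"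
      by (subst (1 2) em) (use pn in auto)
  qed auto
  then have "AE x in lborel. ennreal (?p x) = ennreal (?n x)"
    by (rule sigma_finite_measure.density_unique[OF sigma_finite_lborel, rotated 2]) auto
  then show ?thesis
    by eventually_elim (auto simp: max_def split: if_splits)
qed

text \<open>Bumps converge boundedly to the indicator of an interval, so the integrals of \<open>f\<close> over
  intervals vanish. To apply the result on half lines, \<open>f\<close> is extended by zero and replaced by a Borel
  function.\<close>

lemma fundamental_lemma:
  fixes f :: "real \<Rightarrow> real"
  assumes f: "integrable M f" and orth: "\<And>\<phi>. \<phi> \<in> test_fun \<Longrightarrow> (\<integral>x. f x * \<phi> x \<partial>M) = 0"
  shows "AE x in M. f x = 0"
proof -
  have int0: "(\<integral>x. f x * indicator {c<..<d} x \<partial>M) = 0" if cd: "-pi \<le> c" "d \<le> pi" for c d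
  proof -
    have "(\<lambda>n. \<integral>x. f x * bump c d n x \<partial>M) \<longlonglongrightarrow> (\<integral>x. f x * indicator {c<..<d} x \<partial>M)"
    proof (rule integral_dominated_convergence[where w = "\<lambda>x. \<bar>f x\<bar>"])
      have "bump c d n \<in> borel_measurable M" for n
        using test_fun_D(1)[OF bump_test_fun[OF cd]] smooth_continuous
        by (intro borel_measurable_M borel_measurable_continuous_onI) auto
      then show "(\<lambda>x. f x * bump c d n x) \<in> borel_measurable M" for n using f by measurable
      have "{c<..<d} \<in> sets borel" by simp
      then have "(\<lambda>x. indicator {c<..<d} x :: real) \<in> borel_measurable M" by (intro borel_measurable_M) simp
      then show "(\<lambda>x. f x * indicator {c<..<d} x) \<in> borel_measurable M" using f by measurable
      show "AE x in M. (\<lambda>n. f x * bump c d n x) \<longlonglongrightarrow> f x * indicator {c<..<d} x"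
        by (intro AE_I2 tendsto_intros bump_tendsto)
      have "\<bar>bump c d n x\<bar> \<le> 1" for n x
        unfolding bump_def abs_mult using step_nonneg step_le_1 by (simp add: mult_le_one)
      then show "AE x in M. norm (f x * bump c d n x) \<le> \<bar>f x\<bar>" for n
        by (intro AE_I2) (simp add: abs_mult mult_left_le)
      show "integrable M (\<lambda>x. \<bar>f x\<bar>)" using f by simp
    qed
    then show ?thesis using orth[OF bump_test_fun[OF cd]] by (simp add: LIMSEQ_const_iff)
  qed
  have fI: "integrable lebesgue (\<lambda>x. indicator I x * f x)"
    using f by (simp add: integrable_restrict_space)
  obtain g where g: "g \<in> borel_measurable lborel" "AE x in lborel. indicator I x * f x = g x"
    using completion_ex_borel_measurable_real[of "\<lambda>x. indicator I x * f x" lborel] fI by auto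
  have gm [measurable]: "g \<in> borel_measurable borel" using g(1) by simp
  have ae: "AE x in lebesgue. indicator I x * f x = g x" using g(2) by (rule AE_completion)
  have "integrable lebesgue g"
    using fI ae g(1) by (subst integrable_cong_AE[of g _ "\<lambda>x. indicator I x * f x"]) (auto intro: measurable_completion)
  then have gi: "integrable lborel g" using g(1) by (subst (asm) integrable_completion)
  have "AE x in lborel. g x = 0"
  proof (rule AE_zero_if_half_lines[OF gi])
    fix x
    have "(\<integral>y. g y * indicator {x<..} y \<partial>lborel) = (\<integral>y. g y * indicator {x<..} y \<partial>lebesgue)"
      by (rule integral_completion[symmetric]) simp
    also have "\<dots> = (\<integral>y. indicator I y * f y * indicator {x<..} y \<partial>lebesgue)"
    proof (rule integral_cong_AE)
      show "AE y in lebesgue. g y * indicator {x<..} y = indicator I y * f y * indicator {x<..} y"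
        using ae by eventually_elim simp
      have "indicator {x<..} \<in> borel_measurable lebesgue" by (intro borel_measurable_indicator) auto
      then show "(\<lambda>y. g y * indicator {x<..} y) \<in> borel_measurable lebesgue"
        "(\<lambda>y. indicator I y * f y * indicator {x<..} y) \<in> borel_measurable lebesgue"
        using borel_measurable_integrable[OF fI] measurable_completion[OF g(1)]
        by (auto intro!: borel_measurable_times)
    qed
    also have "\<dots> = (\<integral>y. indicator I y *\<^sub>R (f y * indicator {max x (-pi)<..<pi} y) \<partial>lebesgue)"
      by (intro Bochner_Integration.integral_cong) (auto simp: indicator_def I_def)
    also have "\<dots> = (\<integral>y. f y * indicator {max x (-pi)<..<pi} y \<partial>M)"
      by (subst integral_restrict_space) auto
    also have "\<dots> = 0" by (rule int0) auto
    finally show "(\<integral>y. g y * indicator {x<..} y \<partial>lborel) = 0" .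
  qed
  then have "AE x in lebesgue. g x = 0" by (rule AE_completion)
  with ae have "AE x in lebesgue. indicator I x * f x = 0" by eventually_elim simp
  then show ?thesis
    by (subst AE_restrict_space_iff) (auto elim!: eventually_mono)
qed

section \<open>The Hilbert space of square integrable functions\<close>

definition ip2 :: "(real \<Rightarrow> real) \<Rightarrow> (real \<Rightarrow> real) \<Rightarrow> real" where
  "ip2 f g = (\<integral>x. f x * g x \<partial>M)"

lemma L2_D: "f \<in> L2 \<Longrightarrow> f \<in> borel_measurable M" "f \<in> L2 \<Longrightarrow> integrable M (\<lambda>x. (f x)\<^sup>2)"
  by (auto simp: L2_def)

lemma L2_mult_integrable:
  assumes "f \<in> L2" "g \<in> L2" shows "integrable M (\<lambda>x. f x * g x)"
proof (rule Bochner_Integration.integrable_bound)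
  show "integrable M (\<lambda>x. (f x)\<^sup>2 + (g x)\<^sup>2)" using assms by (intro Bochner_Integration.integrable_add L2_D)
  show "(\<lambda>x. f x * g x) \<in> borel_measurable M" using assms by (intro borel_measurable_times L2_D)
  have "\<bar>f x * g x\<bar> \<le> (f x)\<^sup>2 + (g x)\<^sup>2" for x
  proof -
    have "2 * \<bar>f x\<bar> * \<bar>g x\<bar> \<le> (f x)\<^sup>2 + (g x)\<^sup>2"
      using sum_squares_bound[of "\<bar>f x\<bar>" "\<bar>g x\<bar>"] by simp
    moreover have "0 \<le> \<bar>f x\<bar> * \<bar>g x\<bar>" by simp
    ultimately show ?thesis unfolding abs_mult by argo
  qed
  then show "AE x in M. norm (f x * g x) \<le> norm ((f x)\<^sup>2 + (g x)\<^sup>2)" by auto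
qed

lemma L2_bounded:
  assumes "f \<in> borel_measurable M" "\<And>x. x \<in> I \<Longrightarrow> \<bar>f x\<bar> \<le> B" shows "f \<in> L2"
  unfolding L2_def
proof (intro CollectI conjI assms(1))
  have "(f x)\<^sup>2 \<le> B\<^sup>2" if "x \<in> I" for x
    using power_mono[OF assms(2)[OF that], of 2] by simp
  then show "integrable M (\<lambda>x. (f x)\<^sup>2)"
    using assms(1) by (intro integrable_M_bounded[of _ "B\<^sup>2"]) auto
qed

lemma L2_continuous:
  assumes "continuous_on UNIV f" shows "f \<in> L2"
  unfolding L2_def using assms
  by (auto intro!: borel_measurable_M borel_measurable_continuous_onI integrable_M_continuous continuous_intros)

lemma L2_integrable: "f \<in> L2 \<Longrightarrow> integrable M f"
  using L2_mult_integrable[of f "\<lambda>_. 1"] L2_continuous[of "\<lambda>_. 1"] by simp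

lemma L2_comb:
  assumes "f \<in> L2" "g \<in> L2" shows "(\<lambda>x. f x + c * g x) \<in> L2"
  unfolding L2_def
proof (intro CollectI conjI)
  show "(\<lambda>x. f x + c * g x) \<in> borel_measurable M"
    using assms by (intro borel_measurable_add borel_measurable_times L2_D borel_measurable_const)
  have "integrable M (\<lambda>x. (f x)\<^sup>2 + ((2 * c) * (f x * g x) + c\<^sup>2 * (g x)\<^sup>2))"
    using assms by (intro Bochner_Integration.integrable_add Bochner_Integration.integrable_mult_right L2_D L2_mult_integrable)
  moreover have "(f x)\<^sup>2 + ((2 * c) * (f x * g x) + c\<^sup>2 * (g x)\<^sup>2) = (f x + c * g x)\<^sup>2" for x
    by (simp add: power2_eq_square algebra_simps)
  ultimately show "integrable M (\<lambda>x. (f x + c * g x)\<^sup>2)" by simp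
qed

lemma L2_mult_Linf:
  assumes "h \<in> borel_measurable M" "AE x in M. \<bar>h x\<bar> \<le> B" "f \<in> L2" shows "(\<lambda>x. h x * f x) \<in> L2"
  unfolding L2_def
proof (intro CollectI conjI)
  show m: "(\<lambda>x. h x * f x) \<in> borel_measurable M"
    by (rule borel_measurable_times[OF assms(1) L2_D(1)[OF assms(3)]])
  show "integrable M (\<lambda>x. (h x * f x)\<^sup>2)"
  proof (rule Bochner_Integration.integrable_bound)
    show "integrable M (\<lambda>x. B\<^sup>2 * (f x)\<^sup>2)" using assms(3) by (intro Bochner_Integration.integrable_mult_right L2_D)
    show "(\<lambda>x. (h x * f x)\<^sup>2) \<in> borel_measurable M" using m by measurable
    show "AE x in M. norm ((h x * f x)\<^sup>2) \<le> norm (B\<^sup>2 * (f x)\<^sup>2)"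
      using assms(2)
    proof eventually_elim
      case (elim x)
      then have "(h x)\<^sup>2 \<le> B\<^sup>2" using power_mono[OF elim, of 2] by simp
      then show ?case by (simp add: power_mult_distrib mult_right_mono)
    qed
  qed
qed

interpretation L2: form_space L2 ip2
proof
  show "(\<lambda>x. 0) \<in> L2" by (rule L2_continuous) simp
  show "(\<lambda>x. f x + c * g x) \<in> L2" if "f \<in> L2" "g \<in> L2" for f g c using that by (rule L2_comb)
  show "ip2 f g = ip2 g f" for f g by (simp add: ip2_def mult.commute)
  show "ip2 (\<lambda>x. f x + c * g x) h = ip2 f h + c * ip2 g h" if "f \<in> L2" "g \<in> L2" "h \<in> L2" for f g h c
  proof -
    have "ip2 (\<lambda>x. f x + c * g x) h = (\<integral>x. f x * h x + c * (g x * h x) \<partial>M)"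
      by (simp add: ip2_def algebra_simps)
    also have "\<dots> = ip2 f h + c * ip2 g h"
      using that by (simp add: ip2_def L2_mult_integrable)
    finally show ?thesis .
  qed
  show "0 \<le> ip2 f f" for f by (simp add: ip2_def)
qed

lemma ip2_sq: "ip2 f f = (\<integral>x. (f x)\<^sup>2 \<partial>M)"
  by (simp add: ip2_def power2_eq_square)

lemma ip2_zero_iff: "f \<in> L2 \<Longrightarrow> ip2 f f = 0 \<longleftrightarrow> (AE x in M. f x = 0)"
  unfolding ip2_sq by (subst integral_nonneg_eq_0_iff_AE) (auto simp: L2_D)

lemma ip2_cong_AE:
  assumes "f \<in> borel_measurable M" "f' \<in> borel_measurable M" "g \<in> borel_measurable M" "g' \<in> borel_measurable M"
    and "AE x in M. f x = f' x" "AE x in M. g x = g' x"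
  shows "ip2 f g = ip2 f' g'"
proof -
  have "AE x in M. f x * g x = f' x * g' x" using assms(5,6) by eventually_elim simp
  then show ?thesis unfolding ip2_def
    by (intro integral_cong_AE borel_measurable_times assms(1-4))
qed

lemma ip2_le: "\<lbrakk>f \<in> L2; g \<in> L2\<rbrakk> \<Longrightarrow> \<bar>ip2 f g\<bar> \<le> sqrt (ip2 f f) * sqrt (ip2 g g)"
  using L2.cauchy_schwarz[of f g] by (metis real_sqrt_abs real_sqrt_le_mono real_sqrt_mult)

lemma L2_abs: "f \<in> L2 \<Longrightarrow> (\<lambda>x. \<bar>f x\<bar>) \<in> L2"
  by (auto simp: L2_def)

lemma L1_le_L2:
  assumes "f \<in> L2" shows "(\<integral>x. \<bar>f x\<bar> \<partial>M) \<le> sqrt (2 * pi) * sqrt (ip2 f f)"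
proof -
  have 1: "(\<lambda>_. 1) \<in> L2" by (rule L2_continuous) simp
  have "(\<integral>x. \<bar>f x\<bar> \<partial>M) = ip2 (\<lambda>x. 1) (\<lambda>x. \<bar>f x\<bar>)" by (simp add: ip2_def)
  also have "\<dots> \<le> sqrt (ip2 (\<lambda>x. 1) (\<lambda>x. 1)) * sqrt (ip2 (\<lambda>x. \<bar>f x\<bar>) (\<lambda>x. \<bar>f x\<bar>))"
    using ip2_le[OF 1 L2_abs[OF assms]] by simp
  also have "\<dots> = sqrt (2 * pi) * sqrt (ip2 f f)" by (simp add: ip2_def measure_M_I)
  finally show ?thesis .
qed

text \<open>The Riesz--Fischer theorem. Along a subsequence with distances below \<open>2 ^ (- k)\<close> the increments are
  summable almost everywhere, which defines the limit \<open>w\<close>; Fatou's lemma turns the Cauchy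
  condition into convergence to \<open>w\<close>.\<close>

lemma L2_complete:
  assumes u: "\<And>n. u n \<in> L2"
    and cauchy: "\<And>\<epsilon>. 0 < \<epsilon> \<Longrightarrow> \<exists>N. \<forall>m\<ge>N. \<forall>n\<ge>N. ip2 (\<lambda>x. u m x - u n x) (\<lambda>x. u m x - u n x) < \<epsilon>"
  shows "\<exists>w\<in>L2. L2.conv u w"
proof -
  have um [measurable]: "u n \<in> borel_measurable M" for n using u L2_D by blast
  have "\<exists>N. \<forall>m\<ge>N. \<forall>n\<ge>N. ip2 (\<lambda>x. u m x - u n x) (\<lambda>x. u m x - u n x) < (1/4)^k" for k
    by (rule cauchy) simp
  then obtain N where N: "\<And>k m n. m \<ge> N k \<Longrightarrow> n \<ge> N k \<Longrightarrow> ip2 (\<lambda>x. u m x - u n x) (\<lambda>x. u m x - u n x) < (1/4)^k"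
    by metis
  define r where "r k = (\<Sum>i\<le>k. N i)" for k
  have rN: "N k \<le> r k" for k unfolding r_def by (rule member_le_sum) auto
  have rS: "r k \<le> r (Suc k)" for k by (simp add: r_def)
  define d where "d k x = u (r (Suc k)) x - u (r k) x" for k x
  have dL2: "d k \<in> L2" for k unfolding d_def using L2.diff_mem[OF u u] .
  have dm [measurable]: "d k \<in> borel_measurable M" for k using dL2 L2_D by blast
  have d_le: "(\<integral>x. \<bar>d k x\<bar> \<partial>M) \<le> sqrt (2 * pi) * (1/2) ^ k" for k
  proof -
    have "ip2 (d k) (d k) \<le> (1/4)^k"
      using N[of k "r (Suc k)" "r k"] rN[of k] rS[of k] by (auto simp: d_def[abs_def])
    then have "sqrt (ip2 (d k) (d k)) \<le> sqrt ((1/4)^k)" by (rule real_sqrt_le_mono)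
    also have "\<dots> = (1/2)^k"
      by (simp add: real_sqrt_power real_sqrt_divide)
    finally have "sqrt (2 * pi) * sqrt (ip2 (d k) (d k)) \<le> sqrt (2 * pi) * (1/2)^k"
      by (intro mult_left_mono) auto
    then show ?thesis using L1_le_L2[OF dL2, of k] by linarith
  qed
  have "AE x in M. (\<Sum>k. ennreal \<bar>d k x\<bar>) \<noteq> \<infinity>"
  proof (rule nn_integral_PInf_AE)
    have "(\<integral>\<^sup>+x. (\<Sum>k. ennreal \<bar>d k x\<bar>) \<partial>M) = (\<Sum>k. \<integral>\<^sup>+x. ennreal \<bar>d k x\<bar> \<partial>M)"
      by (rule nn_integral_suminf) simp
    also have "\<dots> \<le> (\<Sum>k. ennreal (sqrt (2 * pi) * (1/2) ^ k))"
    proof (rule suminf_le)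
      fix k
      have "(\<integral>\<^sup>+x. ennreal \<bar>d k x\<bar> \<partial>M) = ennreal (\<integral>x. \<bar>d k x\<bar> \<partial>M)"
        using L2_integrable[OF dL2] by (intro nn_integral_eq_integral) auto
      then show "(\<integral>\<^sup>+x. ennreal \<bar>d k x\<bar> \<partial>M) \<le> ennreal (sqrt (2 * pi) * (1/2) ^ k)"
        using d_le by (simp add: ennreal_leI)
    qed auto
    also have "\<dots> = ennreal (\<Sum>k. sqrt (2 * pi) * (1/2) ^ k)"
      by (rule suminf_ennreal2) (auto intro!: summable_mult summable_geometric)
    also have "\<dots> < \<infinity>" by simp
    finally show "(\<integral>\<^sup>+x. (\<Sum>k. ennreal \<bar>d k x\<bar>) \<partial>M) \<noteq> \<infinity>" by simp
  qed measurable
  then have conv: "AE x in M. convergent (\<lambda>k. u (r k) x)"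
  proof eventually_elim
    case (elim x)
    have "summable (\<lambda>k. \<bar>d k x\<bar>)" by (rule summable_suminf_not_top) (use elim in auto)
    then have "summable (\<lambda>k. d k x)" by (rule summable_rabs_cancel)
    then have "convergent (\<lambda>n. \<Sum>k<n. d k x)" by (simp add: summable_iff_convergent)
    moreover have "(\<Sum>k<n. d k x) = u (r n) x - u (r 0) x" for n
      unfolding d_def by (rule sum_lessThan_telescope)
    ultimately have "convergent (\<lambda>n. u (r n) x - u (r 0) x)" by simp
    then show ?case using convergent_add_const_right_iff[of "\<lambda>n. u (r n) x" "- u (r 0) x"] by simp
  qed
  define w where "w x = lim (\<lambda>k. u (r k) x)" for x
  have wm [measurable]: "w \<in> borel_measurable M"
    unfolding w_def by (rule borel_measurable_lim_metric) simp
  have key: "(\<integral>\<^sup>+x. ennreal ((u n x - w x)\<^sup>2) \<partial>M) \<le> ennreal ((1/4)^k)" if n: "n \<ge> N k" for n k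
  proof -
    have "(\<integral>\<^sup>+x. ennreal ((u n x - w x)\<^sup>2) \<partial>M) = (\<integral>\<^sup>+x. liminf (\<lambda>j. ennreal ((u n x - u (r j) x)\<^sup>2)) \<partial>M)"
    proof (rule nn_integral_cong_AE)
      show "AE x in M. ennreal ((u n x - w x)\<^sup>2) = liminf (\<lambda>j. ennreal ((u n x - u (r j) x)\<^sup>2))"
        using conv
      proof eventually_elim
        case (elim x)
        then have "(\<lambda>j. u (r j) x) \<longlonglongrightarrow> w x" unfolding w_def convergent_LIMSEQ_iff .
        then have "(\<lambda>j. ennreal ((u n x - u (r j) x)\<^sup>2)) \<longlonglongrightarrow> ennreal ((u n x - w x)\<^sup>2)"
          by (intro tendsto_ennrealI tendsto_intros)
        then show ?case by (intro lim_imp_Liminf[symmetric]) auto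
      qed
    qed
    also have "\<dots> \<le> liminf (\<lambda>j. \<integral>\<^sup>+x. ennreal ((u n x - u (r j) x)\<^sup>2) \<partial>M)"
      by (rule nn_integral_liminf) measurable
    also have "\<dots> \<le> liminf (\<lambda>j. ennreal ((1/4)^k))"
    proof (rule Liminf_mono)
      have "(\<integral>\<^sup>+x. ennreal ((u n x - u (r j) x)\<^sup>2) \<partial>M) \<le> ennreal ((1/4)^k)" if "j \<ge> k" for j
      proof -
        have "r k \<le> r j" using that rS by (rule lift_Suc_mono_le[rotated])
        then have "r j \<ge> N k" using rN[of k] by linarith
        then have "ip2 (\<lambda>x. u n x - u (r j) x) (\<lambda>x. u n x - u (r j) x) \<le> (1/4)^k"
          using N[OF n, of "r j"] by simp
        moreover have "(\<integral>\<^sup>+x. ennreal ((u n x - u (r j) x)\<^sup>2) \<partial>M) = ennreal (ip2 (\<lambda>x. u n x - u (r j) x) (\<lambda>x. u n x - u (r j) x))"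
          unfolding ip2_sq by (intro nn_integral_eq_integral L2_D(2)[OF L2.diff_mem] u) auto
        ultimately show ?thesis by (simp add: ennreal_leI)
      qed
      then show "\<forall>\<^sub>F j in sequentially. (\<integral>\<^sup>+x. ennreal ((u n x - u (r j) x)\<^sup>2) \<partial>M) \<le> ennreal ((1/4)^k)"
        by (auto simp: eventually_sequentially)
    qed
    also have "\<dots> = ennreal ((1/4)^k)" by (simp add: Liminf_const)
    finally show ?thesis .
  qed
  have diffL2: "(\<lambda>x. u n x - w x) \<in> L2" if "n \<ge> N 0" for n
  proof -
    have "(\<integral>\<^sup>+x. ennreal ((u n x - w x)\<^sup>2) \<partial>M) < \<infinity>"
      using key[OF that] by (rule le_less_trans) simp
    then have "integrable M (\<lambda>x. (u n x - w x)\<^sup>2)" by (intro integrableI_nonneg) auto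
    then show ?thesis unfolding L2_def by simp
  qed
  have wL2: "w \<in> L2"
    using L2.diff_mem[OF u[of "N 0"] diffL2[of "N 0"]] by simp
  have "L2.conv u w"
    unfolding L2.conv_def LIMSEQ_def
  proof (intro allI impI)
    fix e :: real assume "0 < e"
    then obtain k where k: "(1/4::real)^k < e" using real_arch_pow_inv[of e "1/4"] by auto
    have "dist (ip2 (\<lambda>x. u n x - w x) (\<lambda>x. u n x - w x)) 0 < e" if "n \<ge> N k" for n
    proof -
      have "ip2 (\<lambda>x. u n x - w x) (\<lambda>x. u n x - w x) \<le> (1/4)^k"
        unfolding ip2_sq by (rule integral_real_bounded) (use key[OF that] in auto)
      moreover have "0 \<le> ip2 (\<lambda>x. u n x - w x) (\<lambda>x. u n x - w x)" by (simp add: ip2_sq)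
      ultimately show ?thesis using k by simp
    qed
    then show "\<exists>no. \<forall>n\<ge>no. dist (ip2 (\<lambda>x. u n x - w x) (\<lambda>x. u n x - w x)) 0 < e" by blast
  qed
  then show ?thesis using wL2 by blast
qed

interpretation L2: hilbert_space L2 ip2
  by unfold_locales (rule L2_complete)

section \<open>Weak derivatives and primitives\<close>

lemma pair_M_borel:
  assumes "(\<lambda>z. k (fst z) (snd z)) \<in> borel_measurable (borel \<Otimes>\<^sub>M borel)"
  shows "(\<lambda>z. k (fst z) (snd z) :: real) \<in> borel_measurable (M \<Otimes>\<^sub>M M)"
proof -
  have id: "(\<lambda>x. x) \<in> measurable M borel" by (rule borel_measurable_M) simp
  have "(\<lambda>z. (fst z, snd z)) \<in> measurable (M \<Otimes>\<^sub>M M) (borel \<Otimes>\<^sub>M borel)"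
    using measurable_compose[OF measurable_fst id] measurable_compose[OF measurable_snd id]
    by (rule measurable_Pair)
  from measurable_compose[OF this assms] show ?thesis by simp
qed

text \<open>The operator with a bounded kernel \<open>k\<close> and the one with the transposed kernel are adjoint to each
  other. Integration by parts and the symmetry of the Green operator are both instances of this.\<close>

lemma kernel_Fubini:
  fixes k :: "real \<Rightarrow> real \<Rightarrow> real"
  assumes k: "(\<lambda>z. k (fst z) (snd z)) \<in> borel_measurable (borel \<Otimes>\<^sub>M borel)"
    and B: "\<And>x t. x \<in> I \<Longrightarrow> t \<in> I \<Longrightarrow> \<bar>k x t\<bar> \<le> B"
    and f: "integrable M f" and g: "integrable M g"
  shows "(\<integral>x. (\<integral>t. k x t * g t \<partial>M) * f x \<partial>M) = (\<integral>t. g t * (\<integral>x. k x t * f x \<partial>M) \<partial>M)"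
proof -
  interpret pair_sigma_finite M M ..
  note [measurable] = pair_M_borel[of k, OF k] borel_measurable_integrable[OF f] borel_measurable_integrable[OF g]
  have kx: "(\<lambda>t. k x t) \<in> borel_measurable M" for x
    using measurable_compose[OF measurable_Pair1' k, of x] by (intro borel_measurable_M) simp
  let ?F = "\<lambda>(x, t). k x t * g t * f x"
  have Fm: "?F \<in> borel_measurable (M \<Otimes>\<^sub>M M)"
    unfolding case_prod_beta by measurable
  have B0: "0 \<le> B" using B[of 0 0] by (simp add: I_def)
  have int: "integrable M (\<lambda>t. k x t * g t)" if "x \<in> I" for x
  proof (rule Bochner_Integration.integrable_bound)
    show "integrable M (\<lambda>t. B * g t)" using g by simp
    show "(\<lambda>t. k x t * g t) \<in> borel_measurable M" using kx by measurable
    show "AE t in M. norm (k x t * g t) \<le> norm (B * g t)"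
      by (intro AE_I2) (use B[OF that] B0 in \<open>auto simp: abs_mult intro!: mult_right_mono\<close>)
  qed
  have Fi: "integrable (M \<Otimes>\<^sub>M M) ?F"
  proof (rule Fubini_integrable[OF Fm])
    show "AE x in M. integrable M (\<lambda>t. ?F (x, t))"
      using int by (auto intro!: AE_I2)
    show "integrable M (\<lambda>x. \<integral>t. norm (?F (x, t)) \<partial>M)"
    proof (rule Bochner_Integration.integrable_bound)
      show "integrable M (\<lambda>x. B * (\<integral>t. \<bar>g t\<bar> \<partial>M) * \<bar>f x\<bar>)" using f by simp
      show "(\<lambda>x. \<integral>t. norm (?F (x, t)) \<partial>M) \<in> borel_measurable M"
        using Fm by measurable
      have "\<bar>\<integral>t. \<bar>k x t * g t * f x\<bar> \<partial>M\<bar> \<le> \<bar>B * (\<integral>t. \<bar>g t\<bar> \<partial>M) * \<bar>f x\<bar>\<bar>" if x: "x \<in> I" for x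
      proof -
        have "(\<integral>t. \<bar>k x t * g t * f x\<bar> \<partial>M) \<le> (\<integral>t. B * \<bar>g t\<bar> * \<bar>f x\<bar> \<partial>M)"
        proof (rule integral_mono)
          show "integrable M (\<lambda>t. \<bar>k x t * g t * f x\<bar>)" using int[OF x] by simp
          show "\<bar>k x t * g t * f x\<bar> \<le> B * \<bar>g t\<bar> * \<bar>f x\<bar>" if "t \<in> space M" for t
            using B[OF x, of t] that by (auto simp: abs_mult intro!: mult_right_mono)
        qed (use g in simp)
        also have "\<dots> = B * (\<integral>t. \<bar>g t\<bar> \<partial>M) * \<bar>f x\<bar>" by simp
        finally show ?thesis by (simp add: B0)
      qed
      then show "AE x in M. norm (\<integral>t. norm (?F (x, t)) \<partial>M) \<le> norm (B * (\<integral>t. \<bar>g t\<bar> \<partial>M) * \<bar>f x\<bar>)"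
        by (intro AE_I2) simp
    qed
  qed
  have "(\<integral>x. (\<integral>t. k x t * g t \<partial>M) * f x \<partial>M) = (\<integral>x. (\<integral>t. k x t * g t * f x \<partial>M) \<partial>M)"
    by simp
  also have "\<dots> = (\<integral>t. (\<integral>x. k x t * g t * f x \<partial>M) \<partial>M)"
    using Fubini_integral[OF Fi] by simp
  also have "\<dots> = (\<integral>t. g t * (\<integral>x. k x t * f x \<partial>M) \<partial>M)"
  proof (intro Bochner_Integration.integral_cong refl)
    fix t
    have "(\<lambda>x. k x t * g t * f x) = (\<lambda>x. g t * (k x t * f x))" by (simp add: mult_ac)
    then show "(\<integral>x. k x t * g t * f x \<partial>M) = g t * (\<integral>x. k x t * f x \<partial>M)" by simp
  qed
  finally show ?thesis .
qed

definition prim :: "(real \<Rightarrow> real) \<Rightarrow> real \<Rightarrow> real" where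
  "prim g x = (\<integral>t. indicator {..x} t * g t \<partial>M)"

lemma indicator_M: "A \<in> sets borel \<Longrightarrow> (indicator A :: real \<Rightarrow> real) \<in> borel_measurable M"
  by (intro borel_measurable_M borel_measurable_indicator) auto

lemma indicator_mult_integrable:
  fixes g :: "real \<Rightarrow> real"
  assumes "A \<in> sets borel" "integrable M g" shows "integrable M (\<lambda>t. indicator A t * g t)"
proof (rule Bochner_Integration.integrable_bound[OF assms(2)])
  show "(\<lambda>t. indicator A t * g t) \<in> borel_measurable M"
    using assms(2) by (intro borel_measurable_times indicator_M assms(1)) auto
qed (auto simp: indicator_def)

lemma prim_comb:
  assumes "integrable M f" "integrable M g"
  shows "prim (\<lambda>t. f t + c * g t) x = prim f x + c * prim g x"
proof -
  have "prim (\<lambda>t. f t + c * g t) x = (\<integral>t. indicator {..x} t * f t + c * (indicator {..x} t * g t) \<partial>M)"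
    by (simp add: prim_def algebra_simps)
  also have "\<dots> = prim f x + c * prim g x"
    using indicator_mult_integrable[OF _ assms(1), of "{..x}"] indicator_mult_integrable[OF _ assms(2), of "{..x}"]
    by (simp add: prim_def)
  finally show ?thesis .
qed

lemma prim_cong_AE:
  assumes "f \<in> borel_measurable M" "g \<in> borel_measurable M" "AE x in M. f x = g x"
  shows "prim f x = prim g x"
proof -
  have "AE t in M. indicator {..x} t * f t = indicator {..x} t * g t" using assms(3) by eventually_elim simp
  then show ?thesis unfolding prim_def
    by (intro integral_cong_AE borel_measurable_times assms indicator_M) auto
qed

lemma prim_right: "pi \<le> x \<Longrightarrow> prim g x = (\<integral>t. g t \<partial>M)"
  unfolding prim_def by (intro Bochner_Integration.integral_cong) (auto simp: I_def indicator_def)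

lemma measure_M_le: "x \<le> y \<Longrightarrow> measure M (I \<inter> {x<..y}) \<le> y - x"
proof -
  assume "x \<le> y"
  have "measure M (I \<inter> {x<..y}) = measure lebesgue (I \<inter> {x<..y})"
    by (rule measure_restrict_space) auto
  also have "\<dots> \<le> measure lebesgue {x<..y}"
    by (rule measure_mono_fmeasurable) (auto intro!: bounded_set_imp_lmeasurable)
  finally show ?thesis using \<open>x \<le> y\<close> by simp
qed

text \<open>The Cauchy--Schwarz inequality on the interval between \<open>x\<close> and \<open>y\<close>.\<close>

lemma prim_Hoelder:
  assumes g: "g \<in> L2" and "x \<le> y"
  shows "\<bar>prim g y - prim g x\<bar> \<le> sqrt (y - x) * sqrt (ip2 g g)"
proof -
  have i: "indicator {x<..y} \<in> L2"
    by (rule L2_bounded[of _ 1]) (auto intro: indicator_M simp: indicator_def)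
  have "prim g y - prim g x = (\<integral>t. indicator {..y} t * g t - indicator {..x} t * g t \<partial>M)"
    unfolding prim_def using indicator_mult_integrable[OF _ L2_integrable[OF g]]
    by (intro Bochner_Integration.integral_diff[symmetric]) auto
  also have "\<dots> = ip2 (indicator {x<..y}) g"
    unfolding ip2_def using \<open>x \<le> y\<close>
    by (intro Bochner_Integration.integral_cong) (auto simp: indicator_def)
  finally have "\<bar>prim g y - prim g x\<bar> \<le> sqrt (ip2 (indicator {x<..y}) (indicator {x<..y})) * sqrt (ip2 g g)"
    using ip2_le[OF i g] by simp
  also have "ip2 (indicator {x<..y}) (indicator {x<..y}) = measure M (I \<inter> {x<..y})"
  proof -
    have "ip2 (indicator {x<..y}) (indicator {x<..y}) = (\<integral>t. indicator (I \<inter> {x<..y}) t \<partial>M)"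
      unfolding ip2_def by (intro Bochner_Integration.integral_cong) (auto simp: indicator_def)
    also have "\<dots> = measure M (I \<inter> {x<..y})" by (simp add: Int_commute)
    finally show ?thesis .
  qed
  also have "sqrt (measure M (I \<inter> {x<..y})) * sqrt (ip2 g g) \<le> sqrt (y - x) * sqrt (ip2 g g)"
    by (intro mult_right_mono real_sqrt_le_mono measure_M_le \<open>x \<le> y\<close>) (simp add: L2.ip_nonneg g)
  finally show ?thesis .
qed

lemma prim_continuous: assumes "g \<in> L2" shows "continuous_on A (prim g)"
proof -
  have "isCont (prim g) x" for x
    unfolding isCont_iff
  proof (rule LIM_zero_cancel, rule Lim_null_comparison)
    have "\<bar>prim g (x + h) - prim g x\<bar> \<le> sqrt \<bar>h\<bar> * sqrt (ip2 g g)" for h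
      using prim_Hoelder[OF assms, of x "x + h"] prim_Hoelder[OF assms, of "x + h" x]
      by (cases "0 \<le> h") (auto simp: abs_minus_commute)
    then show "\<forall>\<^sub>F h in at 0. norm (prim g (x + h) - prim g x) \<le> sqrt \<bar>h\<bar> * sqrt (ip2 g g)" by auto
    have "((\<lambda>h. sqrt \<bar>h\<bar> * sqrt (ip2 g g)) \<longlongrightarrow> sqrt \<bar>0\<bar> * sqrt (ip2 g g)) (at 0)"
      by (intro tendsto_intros)
    then show "((\<lambda>h. sqrt \<bar>h\<bar> * sqrt (ip2 g g)) \<longlongrightarrow> 0) (at 0)" by simp
  qed
  then show ?thesis by (simp add: continuous_at_imp_continuous_on)
qed

lemma prim_L2: "g \<in> L2 \<Longrightarrow> prim g \<in> L2"
  by (rule L2_continuous[OF prim_continuous])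

lemma prim_bound:
  assumes "g \<in> L2" shows "\<bar>prim g x\<bar> \<le> sqrt (2 * pi) * sqrt (ip2 g g)"
proof -
  have "\<bar>prim g x\<bar> \<le> (\<integral>t. \<bar>indicator {..x} t * g t\<bar> \<partial>M)"
    unfolding prim_def by (rule integral_abs_bound)
  also have "\<dots> \<le> (\<integral>t. \<bar>g t\<bar> \<partial>M)"
    using L2_integrable[OF assms] indicator_mult_integrable[OF _ L2_integrable[OF assms], of "{..x}"]
    by (intro integral_mono) (auto simp: indicator_def)
  also have "\<dots> \<le> sqrt (2 * pi) * sqrt (ip2 g g)" by (rule L1_le_L2[OF assms])
  finally show ?thesis .
qed

lemma test_fun_cont: "\<phi> \<in> test_fun \<Longrightarrow> continuous_on A \<phi>"
  using test_fun_D(1) smooth_continuous by blast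

lemma test_fun_L2: "\<phi> \<in> test_fun \<Longrightarrow> \<phi> \<in> L2"
  by (intro L2_continuous test_fun_cont)

lemma test_fun_FTC:
  assumes \<phi>: "\<phi> \<in> test_fun" and t: "-pi \<le> t" "t \<le> pi"
  shows "(\<integral>x. indicator {t..} x * deriv \<phi> x \<partial>M) = - \<phi> t"
proof -
  have sm: "smooth \<phi>" by (rule test_fun_D(1)[OF \<phi>])
  have "(\<integral>x. indicator {t..} x * deriv \<phi> x \<partial>M) = (\<integral>x. indicator {t..pi} x * deriv \<phi> x \<partial>M)"
    by (intro Bochner_Integration.integral_cong) (auto simp: indicator_def I_def)
  also have "\<dots> = \<phi> pi - \<phi> t"
    using smooth_DERIV[OF smooth_deriv[OF sm]] DERIV_isCont
    by (intro FTC_M t smooth_DERIV[OF sm]) auto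
  also have "\<phi> pi = 0" by (rule test_fun_D(2)[OF \<phi>]) (simp add: I_def)
  finally show ?thesis by simp
qed

lemma test_fun_integral_deriv: "\<phi> \<in> test_fun \<Longrightarrow> (\<integral>x. deriv \<phi> x \<partial>M) = 0"
proof -
  assume \<phi>: "\<phi> \<in> test_fun"
  have "(\<integral>x. deriv \<phi> x \<partial>M) = (\<integral>x. indicator {-pi..} x * deriv \<phi> x \<partial>M)"
    by (intro Bochner_Integration.integral_cong) (auto simp: indicator_def I_def)
  also have "\<dots> = - \<phi> (-pi)" using test_fun_FTC[OF \<phi>, of "-pi"] by simp
  also have "\<phi> (-pi) = 0" by (rule test_fun_D(2)[OF \<phi>]) (simp add: I_def)
  finally show ?thesis by simp
qed

text \<open>The primitive that vanishes at \<open>-\<pi>\<close> is constant outside the support of \<open>\<psi>\<close>, and the constant on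
  the right is the integral of \<open>\<psi>\<close>.\<close>

lemma mean_zero_test_fun_primitive:
  assumes \<psi>: "\<psi> \<in> test_fun" and mean: "(\<integral>x. \<psi> x \<partial>M) = 0"
  obtains \<phi> where "\<phi> \<in> test_fun" "deriv \<phi> = \<psi>"
proof -
  obtain c d where cd: "-pi < c" "d < pi" "\<And>x. x \<notin> {c..d} \<Longrightarrow> \<psi> x = 0" and sm: "smooth \<psi>"
    using \<psi> by (auto simp: test_fun_iff)
  have cont: "isCont \<psi> x" for x using smooth_DERIV[OF sm] DERIV_isCont by blast
  obtain \<Psi> where \<Psi>: "\<And>x. (\<Psi> has_field_derivative \<psi> x) (at x)"
    using einterval_antiderivative[of "-\<infinity>" "\<infinity>" \<psi>] cont
    by (auto simp: has_real_derivative_iff_has_vector_derivative)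
  define \<phi> where "\<phi> x = \<Psi> x - \<Psi> (-pi)" for x
  have D: "(\<phi> has_field_derivative \<psi> x) (at x)" for x
    unfolding \<phi>_def using \<Psi>[of x] by (auto intro!: derivative_eq_intros)
  have "smooth \<phi>"
  proof (rule smooth_coinduct[of _ "insert \<phi> {f. smooth f}"])
    fix f assume f: "f \<in> insert \<phi> {f. smooth f}"
    show "\<exists>f'\<in>insert \<phi> {f. smooth f}. \<forall>x. (f has_field_derivative f' x) (at x)"
    proof (cases "f = \<phi>")
      case True then show ?thesis using D sm by blast
    next
      case False then show ?thesis using f smooth_DERIV smooth_deriv by blast
    qed
  qed simp
  moreover have "\<phi> x = 0" if x: "x \<notin> {c..d}" for x
  proof (cases "x < c")
    case True
    have "\<exists>k. \<forall>y\<in>{..<c}. \<phi> y = k"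
    proof (rule has_field_derivative_zero_constant)
      show "(\<phi> has_field_derivative 0) (at y within {..<c})" if "y \<in> {..<c}" for y
        using has_field_derivative_at_within[OF D[of y]] cd(3)[of y] that by auto
    qed simp
    then have "\<phi> x = \<phi> (-pi)" using True cd(1) by auto
    then show ?thesis by (simp add: \<phi>_def)
  next
    case False
    have "\<exists>k. \<forall>y\<in>{d<..}. \<phi> y = k"
    proof (rule has_field_derivative_zero_constant)
      show "(\<phi> has_field_derivative 0) (at y within {d<..})" if "y \<in> {d<..}" for y
        using has_field_derivative_at_within[OF D[of y]] cd(3)[of y] that by auto
    qed simp
    moreover have "d < x" using x False by auto
    ultimately have "\<phi> x = \<phi> pi" using cd(2) by auto
    also have "\<phi> pi = (\<integral>x. indicator {-pi..pi} x * \<psi> x \<partial>M)"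
      using FTC_M[of \<phi> \<psi> "-pi" pi, OF D cont] by (simp add: \<phi>_def)
    also have "\<dots> = (\<integral>x. \<psi> x \<partial>M)"
      by (intro Bochner_Integration.integral_cong) (auto simp: indicator_def I_def)
    finally show ?thesis using mean by simp
  qed
  ultimately have "\<phi> \<in> test_fun" using cd unfolding test_fun_iff by blast
  moreover have "deriv \<phi> = \<psi>" using D by (intro ext DERIV_imp_deriv)
  ultimately show ?thesis using that by blast
qed

lemma ex_test_fun_nonzero_mean: "\<exists>\<rho>\<in>test_fun. (\<integral>x. \<rho> x \<partial>M) \<noteq> 0"
proof (rule ccontr)
  assume "\<not> ?thesis"
  then have "AE x in M. (1::real) = 0" by (intro fundamental_lemma) auto
  then have "emeasure M (space M) = 0" by (simp add: AE_iff_measurable[OF _ refl])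
  then show False by (simp add: measure_M_I)
qed

lemma is_weak_deriv_1: "is_weak_deriv 1 u g \<longleftrightarrow> (\<forall>\<phi>\<in>test_fun. ip2 u (deriv \<phi>) = - ip2 g \<phi>)"
  and is_weak_deriv_2: "is_weak_deriv 2 u g \<longleftrightarrow> (\<forall>\<phi>\<in>test_fun. ip2 u (deriv (deriv \<phi>)) = ip2 g \<phi>)"
  by (simp_all add: is_weak_deriv_def ip2_def numeral_2_eq_2)

lemma is_weak_deriv_twice:
  assumes "is_weak_deriv 1 u g"
  shows "is_weak_deriv 2 u h \<longleftrightarrow> is_weak_deriv 1 g h"
  using assms test_fun_deriv unfolding is_weak_deriv_1 is_weak_deriv_2 by auto

lemma weak_deriv_unique:
  assumes "is_weak_deriv k u g" "is_weak_deriv k u h" "g \<in> L2" "h \<in> L2"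
  shows "AE x in M. g x = h x"
proof -
  have "AE x in M. g x - h x = 0"
  proof (rule fundamental_lemma)
    show "integrable M (\<lambda>x. g x - h x)" using assms by (intro L2_integrable L2.diff_mem)
    fix \<phi> assume \<phi>: "\<phi> \<in> test_fun"
    have "(-1) ^ k * ip2 g \<phi> = (-1) ^ k * ip2 h \<phi>"
      using assms(1,2) \<phi> by (auto simp: is_weak_deriv_def ip2_def)
    then have "ip2 g \<phi> - ip2 h \<phi> = 0" by simp
    then show "(\<integral>x. (g x - h x) * \<phi> x \<partial>M) = 0"
      using L2.ip_diff[OF assms(3,4) test_fun_L2[OF \<phi>]] by (simp add: ip2_def)
  qed
  then show ?thesis by simp
qed

lemma weak_deriv_cong_AE:
  assumes "u \<in> borel_measurable M" "v \<in> borel_measurable M" "AE x in M. u x = v x" "is_weak_deriv k u g"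
  shows "is_weak_deriv k v g"
proof -
  have "(\<integral>x. v x * (deriv ^^ k) \<phi> x \<partial>M) = (\<integral>x. u x * (deriv ^^ k) \<phi> x \<partial>M)" if "\<phi> \<in> test_fun" for \<phi>
  proof -
    have "(deriv ^^ k) \<phi> \<in> test_fun" by (induction k) (auto intro: that test_fun_deriv)
    then have "(deriv ^^ k) \<phi> \<in> borel_measurable M" using test_fun_L2 L2_D by blast
    moreover have "AE x in M. v x * (deriv ^^ k) \<phi> x = u x * (deriv ^^ k) \<phi> x"
      using assms(3) by eventually_elim simp
    ultimately show ?thesis by (intro integral_cong_AE borel_measurable_times assms)
  qed
  then show ?thesis using assms(4) by (simp add: is_weak_deriv_def)
qed

text \<open>Integration by parts, obtained from an exchange of the order of integration because \<open>prim g\<close> need not be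
  differentiable everywhere.\<close>

lemma prim_weak_deriv:
  assumes g: "g \<in> L2" shows "is_weak_deriv 1 (\<lambda>x. c + prim g x) g"
  unfolding is_weak_deriv_1
proof
  fix \<phi> assume \<phi>: "\<phi> \<in> test_fun"
  have d: "deriv \<phi> \<in> L2" by (intro test_fun_L2 test_fun_deriv \<phi>)
  have "ip2 (prim g) (deriv \<phi>) = (\<integral>t. g t * (\<integral>x. indicator {..x} t * deriv \<phi> x \<partial>M) \<partial>M)"
    unfolding ip2_def prim_def
  proof (rule kernel_Fubini[where B = 1])
    have "(\<lambda>z::real \<times> real. indicator {z. snd z \<le> fst z} z :: real) \<in> borel_measurable (borel \<Otimes>\<^sub>M borel)"
      unfolding borel_prod
      by (intro borel_measurable_indicator borel_closed closed_Collect_le continuous_intros)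
    moreover have "(\<lambda>z::real \<times> real. indicator {..fst z} (snd z) :: real) = (\<lambda>z. indicator {z. snd z \<le> fst z} z)"
      by (auto simp: indicator_def)
    ultimately show "(\<lambda>z::real \<times> real. indicator {..fst z} (snd z) :: real) \<in> borel_measurable (borel \<Otimes>\<^sub>M borel)"
      by simp
  qed (auto simp: indicator_def L2_integrable d g)
  also have "\<dots> = (\<integral>t. g t * (- \<phi> t) \<partial>M)"
  proof (intro Bochner_Integration.integral_cong refl arg_cong2[where f = "(*)"])
    fix t assume "t \<in> space M"
    then have t: "-pi \<le> t" "t \<le> pi" by (auto simp: I_def)
    have "(\<integral>x. indicator {..x} t * deriv \<phi> x \<partial>M) = (\<integral>x. indicator {t..} x * deriv \<phi> x \<partial>M)"
      by (intro Bochner_Integration.integral_cong) (auto simp: indicator_def)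
    then show "(\<integral>x. indicator {..x} t * deriv \<phi> x \<partial>M) = - \<phi> t" using test_fun_FTC[OF \<phi> t] by simp
  qed
  also have "\<dots> = - ip2 g \<phi>" by (simp add: ip2_def)
  finally have *: "ip2 (prim g) (deriv \<phi>) = - ip2 g \<phi>" .
  have "ip2 (\<lambda>x. c) (deriv \<phi>) = 0" using test_fun_integral_deriv[OF \<phi>] by (simp add: ip2_def)
  moreover have "(\<lambda>x. c) \<in> L2" by (rule L2_continuous) simp
  ultimately show "ip2 (\<lambda>x. c + prim g x) (deriv \<phi>) = - ip2 g \<phi>"
    using L2.ip_comb[OF _ prim_L2[OF g] d, of "\<lambda>x. c" 1] * by simp
qed

text \<open>The lemma of du Bois-Reymond. The difference \<open>z\<close> of \<open>u\<close> and the primitive of \<open>g\<close> is orthogonal to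
  derivatives of test functions, that is, to test functions of mean zero. Subtracting a multiple of a fixed
  \<open>\<rho>\<close> from a test function reaches mean zero, so \<open>z\<close> acts on all test functions as a constant.\<close>

lemma weak_deriv_imp_prim:
  assumes u: "u \<in> L2" and g: "g \<in> L2" and ug: "is_weak_deriv 1 u g"
  obtains c where "AE x in M. u x = c + prim g x"
proof -
  define z where "z x = u x - prim g x" for x
  have z: "z \<in> L2" unfolding z_def[abs_def] using L2.diff_mem[OF u prim_L2[OF g]] .
  have zorth: "ip2 z (deriv \<phi>) = 0" if "\<phi> \<in> test_fun" for \<phi>
    using ug[unfolded is_weak_deriv_1] prim_weak_deriv[OF g, of 0, unfolded is_weak_deriv_1] that L2.ip_diff[OF u prim_L2[OF g] test_fun_L2[OF test_fun_deriv[OF that]]]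
    by (simp add: z_def[abs_def])
  obtain \<rho> where \<rho>: "\<rho> \<in> test_fun" "(\<integral>x. \<rho> x \<partial>M) \<noteq> 0" using ex_test_fun_nonzero_mean by blast
  define c where "c = ip2 z \<rho> / (\<integral>x. \<rho> x \<partial>M)"
  have cL2: "(\<lambda>x. c) \<in> L2" by (rule L2_continuous) simp
  have "AE x in M. z x - c = 0"
  proof (rule fundamental_lemma)
    show "integrable M (\<lambda>x. z x - c)" using z cL2 by (intro L2_integrable L2.diff_mem)
    fix \<psi> assume \<psi>: "\<psi> \<in> test_fun"
    define k where "k = (\<integral>x. \<psi> x \<partial>M) / (\<integral>x. \<rho> x \<partial>M)"
    have t: "(\<lambda>x. \<psi> x + (-k) * \<rho> x) \<in> test_fun" by (intro test_fun_comb \<psi> \<rho>)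
    have "(\<integral>x. \<psi> x + (-k) * \<rho> x \<partial>M) = (\<integral>x. \<psi> x \<partial>M) + (-k) * (\<integral>x. \<rho> x \<partial>M)"
      using L2_integrable[OF test_fun_L2] \<psi> \<rho>(1) by simp
    also have "\<dots> = 0" using \<rho>(2) by (simp add: k_def)
    finally obtain \<phi> where "\<phi> \<in> test_fun" "deriv \<phi> = (\<lambda>x. \<psi> x + (-k) * \<rho> x)"
      using mean_zero_test_fun_primitive[OF t] by blast
    then have "ip2 z (\<lambda>x. \<psi> x + (-k) * \<rho> x) = 0" using zorth[of \<phi>] by simp
    moreover have "ip2 z (\<lambda>x. \<psi> x + (-k) * \<rho> x) = ip2 z \<psi> + (-k) * ip2 z \<rho>"
      by (rule L2.ip_comb_right[OF test_fun_L2[OF \<psi>] test_fun_L2[OF \<rho>(1)] z])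
    ultimately have "ip2 z \<psi> = k * ip2 z \<rho>" by simp
    also have "\<dots> = c * (\<integral>x. \<psi> x \<partial>M)" by (simp add: k_def c_def)
    also have "\<dots> = ip2 (\<lambda>x. c) \<psi>" by (simp add: ip2_def)
    finally show "(\<integral>x. (z x - c) * \<psi> x \<partial>M) = 0"
      using L2.ip_diff[OF z cL2 test_fun_L2[OF \<psi>]] by (simp add: ip2_def)
  qed
  then have "AE x in M. u x = c + prim g x" by eventually_elim (simp add: z_def)
  then show ?thesis by (rule that)
qed

section \<open>The Green operator of the second derivative\<close>

text \<open>The kernel of the inverse of the second derivative with zero boundary values at \<open>\<plusminus>\<pi>\<close>.\<close>

definition green :: "real \<Rightarrow> real \<Rightarrow> real" where
  "green x t = max 0 (x - t) - (x + pi) * (pi - t) / (2 * pi)"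

definition G :: "(real \<Rightarrow> real) \<Rightarrow> real \<Rightarrow> real" where
  "G m x = (\<integral>t. green x t * m t \<partial>M)"

lemma green_sym: "green x t = green t x"
proof -
  have "max 0 (x - t) = max 0 (t - x) + (x - t)" by (auto simp: max_def)
  moreover have "(x + pi) * (pi - t) / (2 * pi) = (t + pi) * (pi - x) / (2 * pi) + (x - t)"
    by (simp add: field_simps)
  ultimately show ?thesis by (simp add: green_def)
qed

lemma green_lipschitz: assumes "t \<in> I" shows "\<bar>green x t - green y t\<bar> \<le> 2 * \<bar>x - y\<bar>"
proof -
  have t: "0 \<le> pi - t" "pi - t \<le> 2 * pi" using assms by (auto simp: I_def)
  have "green x t - green y t = (max 0 (x - t) - max 0 (y - t)) - (x - y) * ((pi - t) / (2 * pi))"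
    by (simp add: green_def field_simps)
  then have "\<bar>green x t - green y t\<bar> \<le> \<bar>max 0 (x - t) - max 0 (y - t)\<bar> + \<bar>(x - y) * ((pi - t) / (2 * pi))\<bar>"
    using abs_triangle_ineq4 by metis
  moreover have "\<bar>max 0 (x - t) - max 0 (y - t)\<bar> \<le> \<bar>x - y\<bar>" by (auto simp: max_def)
  moreover have "\<bar>(x - y) * ((pi - t) / (2 * pi))\<bar> \<le> \<bar>x - y\<bar> * 1"
    unfolding abs_mult using t by (intro mult_left_mono) auto
  ultimately show ?thesis by linarith
qed

lemma green_left: "t \<in> I \<Longrightarrow> green (-pi) t = 0" and green_right: "t \<in> I \<Longrightarrow> green pi t = 0"
  by (auto simp: green_def I_def field_simps)

lemma green_bound: assumes "t \<in> I" "-pi \<le> x" "x \<le> pi" shows "\<bar>green x t\<bar> \<le> 4 * pi"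
  using green_lipschitz[OF assms(1), of x "-pi"] green_left[OF assms(1)] assms(2,3) by auto

lemma green_continuous: "continuous_on UNIV (\<lambda>z. green (fst z) (snd z))"
  unfolding green_def by (intro continuous_intros) auto

lemma green_borel: "(\<lambda>z. green (fst z) (snd z)) \<in> borel_measurable (borel \<Otimes>\<^sub>M borel)"
  unfolding borel_prod by (intro borel_measurable_continuous_onI green_continuous)

lemma green_section: "continuous_on UNIV (green x)"
  unfolding green_def by (intro continuous_intros) auto

lemma green_L2: "green x \<in> L2" by (rule L2_continuous[OF green_section])

lemma G_ip2: "G m x = ip2 (green x) m"
  by (simp add: G_def ip2_def)

lemma G_comb: "\<lbrakk>m \<in> L2; n \<in> L2\<rbrakk> \<Longrightarrow> G (\<lambda>t. m t + c * n t) x = G m x + c * G n x"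
  by (simp add: G_ip2 L2.ip_comb_right green_L2)

lemma G_lipschitz:
  assumes "m \<in> L2" shows "\<bar>G m x - G m y\<bar> \<le> 2 * sqrt (2 * pi) * sqrt (ip2 m m) * \<bar>x - y\<bar>"
proof -
  have "G m x - G m y = (\<integral>t. (green x t - green y t) * m t \<partial>M)"
    using L2.ip_diff[OF green_L2 green_L2 assms, of x y] by (simp add: G_ip2 ip2_def)
  also have "\<bar>\<dots>\<bar> \<le> (\<integral>t. \<bar>(green x t - green y t) * m t\<bar> \<partial>M)" by (rule integral_abs_bound)
  also have "\<dots> \<le> (\<integral>t. 2 * \<bar>x - y\<bar> * \<bar>m t\<bar> \<partial>M)"
  proof (rule integral_mono)
    show "integrable M (\<lambda>t. \<bar>(green x t - green y t) * m t\<bar>)"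
      using L2_mult_integrable[OF L2.diff_mem[OF green_L2 green_L2] assms] by simp
    show "integrable M (\<lambda>t. 2 * \<bar>x - y\<bar> * \<bar>m t\<bar>)" using L2_integrable[OF assms] by simp
    show "\<bar>(green x t - green y t) * m t\<bar> \<le> 2 * \<bar>x - y\<bar> * \<bar>m t\<bar>" if "t \<in> space M" for t
      using green_lipschitz[of t x y] that by (auto simp: abs_mult intro!: mult_right_mono)
  qed
  also have "\<dots> = 2 * \<bar>x - y\<bar> * (\<integral>t. \<bar>m t\<bar> \<partial>M)" by simp
  also have "\<dots> \<le> 2 * \<bar>x - y\<bar> * (sqrt (2 * pi) * sqrt (ip2 m m))"
    by (intro mult_left_mono L1_le_L2 assms) auto
  finally show ?thesis by (simp add: mult_ac)
qed

lemma G_left: "G m (-pi) = 0" and G_right: "G m pi = 0"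
proof -
  have "G m (-pi) = (\<integral>t. 0 \<partial>M)"
    unfolding G_def by (intro Bochner_Integration.integral_cong) (auto simp: green_left)
  then show "G m (-pi) = 0" by simp
  have "G m pi = (\<integral>t. 0 \<partial>M)"
    unfolding G_def by (intro Bochner_Integration.integral_cong) (auto simp: green_right)
  then show "G m pi = 0" by simp
qed

lemma G_bound:
  assumes "m \<in> L2" "-pi \<le> x" "x \<le> pi"
  shows "\<bar>G m x\<bar> \<le> 4 * pi * sqrt (2 * pi) * sqrt (ip2 m m)"
proof -
  have "\<bar>G m x\<bar> \<le> 2 * sqrt (2 * pi) * sqrt (ip2 m m) * \<bar>x - - pi\<bar>"
    using G_lipschitz[OF assms(1), of x "-pi"] by (simp add: G_left)
  also have "\<dots> \<le> 2 * sqrt (2 * pi) * sqrt (ip2 m m) * (2 * pi)"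
    using assms L2.ip_nonneg[OF assms(1)] by (intro mult_left_mono) auto
  finally show ?thesis by (simp add: mult_ac)
qed

lemma lipschitz_continuous:
  fixes f :: "real \<Rightarrow> real"
  assumes "\<And>x y. \<bar>f x - f y\<bar> \<le> L * \<bar>x - y\<bar>" shows "continuous_on A f"
proof -
  have "isCont f x" for x
    unfolding isCont_iff
  proof (rule LIM_zero_cancel, rule Lim_null_comparison)
    show "\<forall>\<^sub>F h in at 0. norm (f (x + h) - f x) \<le> L * \<bar>h\<bar>"
      using assms[of "x + _" x] by (auto intro!: always_eventually)
    have "((\<lambda>h. L * \<bar>h\<bar>) \<longlongrightarrow> L * \<bar>0\<bar>) (at 0)" by (intro tendsto_intros)
    then show "((\<lambda>h. L * \<bar>h\<bar>) \<longlongrightarrow> 0) (at 0)" by simp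
  qed
  then show ?thesis by (simp add: continuous_at_imp_continuous_on)
qed

lemma G_continuous: "m \<in> L2 \<Longrightarrow> continuous_on A (G m)"
  by (rule lipschitz_continuous[OF G_lipschitz])

lemma G_L2: "m \<in> L2 \<Longrightarrow> G m \<in> L2"
  by (rule L2_continuous[OF G_continuous])

lemma G_symmetric:
  assumes "m \<in> L2" "q \<in> L2" shows "ip2 (G m) q = ip2 m (G q)"
proof -
  have "ip2 (G m) q = (\<integral>t. m t * (\<integral>x. green x t * q x \<partial>M) \<partial>M)"
    unfolding ip2_def G_def
  proof (rule kernel_Fubini[OF green_borel, of "4 * pi"])
    show "\<bar>green x t\<bar> \<le> 4 * pi" if "x \<in> I" "t \<in> I" for x t
      using green_bound[OF that(2), of x] that(1) by (simp add: I_def)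
  qed (intro L2_integrable assms)+
  also have "\<dots> = ip2 m (G q)"
    unfolding ip2_def G_def
    by (intro Bochner_Integration.integral_cong refl arg_cong2[where f = "(*)"] green_sym)
  finally show ?thesis .
qed

text \<open>The derivative of \<open>G m\<close> at \<open>-\<pi>\<close>, as \<open>G_prim\<close> shows.\<close>

definition slope :: "(real \<Rightarrow> real) \<Rightarrow> real" where
  "slope m = - (\<integral>t. (pi - t) * m t \<partial>M) / (2 * pi)"

text \<open>Cauchy's formula for the twofold primitive that vanishes to first order at \<open>-\<pi>\<close>; see \<open>prim_prim\<close>.\<close>

definition prim2 :: "(real \<Rightarrow> real) \<Rightarrow> real \<Rightarrow> real" where
  "prim2 m x = (\<integral>t. max 0 (x - t) * m t \<partial>M)"

lemma ramp_L2: "(\<lambda>t. max 0 (x - t)) \<in> L2" and affine_L2: "(\<lambda>t. pi - t) \<in> L2"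
  by (intro L2_continuous continuous_intros)+

lemma G_slope_prim2:
  assumes "m \<in> L2" shows "G m x = prim2 m x + slope m * (x + pi)"
proof -
  have "green x = (\<lambda>t. max 0 (x - t) + (- ((x + pi) / (2 * pi))) * (pi - t))"
    by (auto simp: green_def)
  then have "G m x = prim2 m x + (- ((x + pi) / (2 * pi))) * ip2 (\<lambda>t. pi - t) m"
    unfolding G_ip2 using L2.ip_comb[OF ramp_L2 affine_L2 assms, of x "- ((x + pi) / (2 * pi))"]
    by (simp only: prim2_def ip2_def[of "\<lambda>t. max 0 (x - t)"])
  then show ?thesis by (simp add: slope_def ip2_def)
qed

lemma prim_const: assumes "-pi \<le> x" "x \<le> pi" shows "prim (\<lambda>_. c) x = c * (x + pi)"
proof -
  have "prim (\<lambda>_. c) x = (\<integral>t. indicator {-pi..x} t * c \<partial>M)"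
    unfolding prim_def by (intro Bochner_Integration.integral_cong) (auto simp: indicator_def I_def)
  also have "\<dots> = c * x - c * (-pi)"
    by (rule FTC_M[where F = "\<lambda>x. c * x"]) (use assms in \<open>auto intro!: derivative_eq_intros\<close>)
  finally show ?thesis by (simp add: algebra_simps)
qed

lemma prim_prim:
  assumes m: "m \<in> L2" and x: "-pi \<le> x" "x \<le> pi"
  shows "prim (prim m) x = prim2 m x"
proof -
  have "(\<lambda>z::real \<times> real. indicator {z. snd z \<le> fst z} z :: real) \<in> borel_measurable (borel \<Otimes>\<^sub>M borel)"
    unfolding borel_prod
    by (intro borel_measurable_indicator borel_closed closed_Collect_le continuous_intros)
  moreover have "(\<lambda>z::real \<times> real. indicator {..fst z} (snd z) :: real) = (\<lambda>z. indicator {z. snd z \<le> fst z} z)"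
    by (auto simp: indicator_def)
  ultimately have k: "(\<lambda>z::real \<times> real. indicator {..fst z} (snd z) :: real) \<in> borel_measurable (borel \<Otimes>\<^sub>M borel)"
    by simp
  have ix: "(indicator {..x} :: real \<Rightarrow> real) \<in> L2"
    by (rule L2_bounded[of _ 1]) (auto intro: indicator_M simp: indicator_def)
  have "prim (prim m) x = (\<integral>y. (\<integral>t. indicator {..y} t * m t \<partial>M) * indicator {..x} y \<partial>M)"
    unfolding prim_def[of _ x] by (simp add: prim_def mult.commute)
  also have "\<dots> = (\<integral>t. m t * (\<integral>y. indicator {..y} t * indicator {..x} y \<partial>M) \<partial>M)"
  proof (rule kernel_Fubini[OF k, of 1])
    show "\<bar>indicator {..x} t :: real\<bar> \<le> 1" for x t :: real by (simp add: indicator_def)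
  qed (intro L2_integrable m ix)+
  also have "\<dots> = prim2 m x"
    unfolding prim2_def
  proof (intro Bochner_Integration.integral_cong refl)
    fix t assume "t \<in> space M"
    then have t: "-pi \<le> t" by (auto simp: I_def)
    have "(\<integral>y. indicator {..y} t * indicator {..x} y \<partial>M) = (\<integral>y. indicator {t..x} y * (1::real) \<partial>M)"
      by (intro Bochner_Integration.integral_cong) (auto simp: indicator_def)
    also have "\<dots> = max 0 (x - t)"
    proof (cases "t \<le> x")
      case True
      have "(\<integral>y. indicator {t..x} y * (1::real) \<partial>M) = x - t"
        by (rule FTC_M[where F = "\<lambda>x. x"]) (use t x True in auto)
      then show ?thesis using True by simp
    next
      case False then show ?thesis by simp
    qed
    finally show "m t * (\<integral>y. indicator {..y} t * indicator {..x} y \<partial>M) = max 0 (x - t) * m t" by simp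
  qed
  finally show ?thesis .
qed

lemma G_prim:
  assumes m: "m \<in> L2" and x: "-pi \<le> x" "x \<le> pi"
  shows "G m x = prim (\<lambda>y. slope m + prim m y) x"
proof -
  have c: "(\<lambda>y. slope m) \<in> L2" by (rule L2_continuous) simp
  have "prim (\<lambda>y. slope m + 1 * prim m y) x = prim (\<lambda>y. slope m) x + 1 * prim (prim m) x"
    by (intro prim_comb L2_integrable c prim_L2 m)
  then show ?thesis using prim_const[OF x] prim_prim[OF m x] G_slope_prim2[OF m] by simp
qed

lemma slope_prim_L2: "m \<in> L2 \<Longrightarrow> (\<lambda>y. c + prim m y) \<in> L2"
  by (rule L2_continuous) (intro continuous_intros prim_continuous)

lemma AE_M_I: "(\<And>x. x \<in> I \<Longrightarrow> Q x) \<Longrightarrow> AE x in M. Q x"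
  by (intro AE_I2) auto

lemma G_weak_derivs:
  assumes u: "u \<in> L2" and m: "m \<in> L2" and um: "AE x in M. u x = G m x"
  shows "is_weak_deriv 1 u (\<lambda>y. slope m + prim m y)" "is_weak_deriv 2 u m"
proof -
  let ?g = "\<lambda>y. slope m + prim m y"
  have gL: "?g \<in> L2" by (rule slope_prim_L2[OF m])
  have "AE x in M. 0 + prim ?g x = G m x" using G_prim[OF m] by (auto intro!: AE_M_I simp: I_def)
  then have "AE x in M. 0 + prim ?g x = u x" using um by eventually_elim simp
  then show 1: "is_weak_deriv 1 u ?g"
    by (rule weak_deriv_cong_AE[rotated 2, OF _ prim_weak_deriv[OF gL]])
       (use L2_D(1)[OF prim_L2[OF gL]] L2_D(1)[OF u] in auto)
  show "is_weak_deriv 2 u m"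
    unfolding is_weak_deriv_twice[OF 1] by (rule prim_weak_deriv[OF m])
qed

lemma wderiv_AE:
  assumes "is_weak_deriv k u g" "g \<in> L2"
  shows "wderiv k u \<in> L2" "is_weak_deriv k u (wderiv k u)" "AE x in M. wderiv k u x = g x"
proof -
  have "\<exists>g. g \<in> L2 \<and> is_weak_deriv k u g" using assms by blast
  from someI_ex[OF this] have *: "wderiv k u \<in> L2 \<and> is_weak_deriv k u (wderiv k u)"
    unfolding wderiv_def .
  then show "wderiv k u \<in> L2" "is_weak_deriv k u (wderiv k u)" by auto
  show "AE x in M. wderiv k u x = g x" using weak_deriv_unique[of k u] * assms by blast
qed

section \<open>Boundary values and point values\<close>

lemma deriv_test_fun_comb:
  assumes "\<phi> \<in> test_fun" "\<psi> \<in> test_fun"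
  shows "deriv (\<lambda>x. \<phi> x + k * \<psi> x) = (\<lambda>x. deriv \<phi> x + k * deriv \<psi> x)"
proof (intro ext DERIV_imp_deriv)
  fix x
  show "((\<lambda>x. \<phi> x + k * \<psi> x) has_field_derivative deriv \<phi> x + k * deriv \<psi> x) (at x)"
    by (intro DERIV_add DERIV_cmult smooth_DERIV test_fun_D assms)
qed

text \<open>Derivatives of test functions together with the constants are dense in \<open>L2\<close>: a function orthogonal to the
  former is constant by the lemma of du Bois-Reymond. For \<open>g\<close> of mean zero the constant in an
  approximant is orthogonal to \<open>g\<close> and to the derivative, so dropping it reduces the error.\<close>

lemma mean_zero_approx:
  assumes g: "g \<in> L2" and mean: "(\<integral>x. g x \<partial>M) = 0" and "0 < \<epsilon>"
  shows "\<exists>\<phi>\<in>test_fun. ip2 (\<lambda>x. g x - deriv \<phi> x) (\<lambda>x. g x - deriv \<phi> x) < \<epsilon>"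
proof -
  have one: "(\<lambda>_. c) \<in> L2" for c by (rule L2_continuous) simp
  define Y where "Y = {(\<lambda>x. deriv \<phi> x + c) | \<phi> c. \<phi> \<in> test_fun}"
  have YI: "(\<lambda>x. deriv \<phi> x + c) \<in> Y" if "\<phi> \<in> test_fun" for \<phi> c using that by (auto simp: Y_def)
  have dL2: "deriv \<phi> \<in> L2" if "\<phi> \<in> test_fun" for \<phi> using that by (intro test_fun_L2 test_fun_deriv)
  have "\<exists>y\<in>Y. ip2 (\<lambda>x. g x - y x) (\<lambda>x. g x - y x) < \<epsilon>"
  proof (rule L2.dense_of_total[OF _ _ _ _ g \<open>0 < \<epsilon>\<close>])
    show "Y \<subseteq> L2" using L2.add_mem[OF dL2 one] by (auto simp: Y_def)
    have "deriv (\<lambda>x::real. 0) = (\<lambda>x. 0::real)" by (intro ext DERIV_imp_deriv) simp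
    then show "(\<lambda>x. 0) \<in> Y" using YI[OF test_fun_zero, of 0] by simp
    show "(\<lambda>x. f x + k * h x) \<in> Y" if fh: "f \<in> Y" "h \<in> Y" for f h k
    proof -
      obtain \<phi> c \<psi> d where "\<phi> \<in> test_fun" "f = (\<lambda>x. deriv \<phi> x + c)" "\<psi> \<in> test_fun" "h = (\<lambda>x. deriv \<psi> x + d)"
        using fh by (auto simp: Y_def)
      then show ?thesis
        using YI[OF test_fun_comb[of \<phi> \<psi> k], of "c + k * d"] by (simp add: deriv_test_fun_comb algebra_simps)
    qed
    show "ip2 f f = 0" if f: "f \<in> L2" and orth: "\<And>y. y \<in> Y \<Longrightarrow> ip2 f y = 0" for f
    proof -
      have o: "ip2 f (deriv \<phi>) = 0" if "\<phi> \<in> test_fun" for \<phi>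
        using orth[OF YI[OF that, of 0]] by simp
      have z: "(\<lambda>x::real. 0) \<in> L2" by (rule one)
      have "is_weak_deriv 1 f (\<lambda>_. 0)"
        unfolding is_weak_deriv_1 using o by (simp add: ip2_def)
      then obtain c where c: "AE x in M. f x = c + prim (\<lambda>_. 0) x"
        by (rule weak_deriv_imp_prim[OF f z])
      then have c: "AE x in M. f x = c" by (simp add: prim_def)
      have "deriv (\<lambda>x::real. 0) = (\<lambda>x. 0::real)" by (intro ext DERIV_imp_deriv) simp
      then have "ip2 f (\<lambda>_. 1) = 0" using orth[OF YI[OF test_fun_zero, of 1]] by simp
      moreover have "ip2 f (\<lambda>_. 1) = ip2 (\<lambda>_. c) (\<lambda>_. 1)"
        using c by (intro ip2_cong_AE L2_D f one) auto
      ultimately have "c = 0" by (simp add: ip2_def measure_M_I)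
      then show ?thesis using c ip2_zero_iff[OF f] by simp
    qed
  qed
  then obtain \<phi> c where \<phi>: "\<phi> \<in> test_fun"
    and lt: "ip2 (\<lambda>x. g x - (deriv \<phi> x + c)) (\<lambda>x. g x - (deriv \<phi> x + c)) < \<epsilon>" by (auto simp: Y_def)
  let ?h = "\<lambda>x. g x - deriv \<phi> x"
  have h: "?h \<in> L2" using L2.diff_mem[OF g dL2[OF \<phi>]] .
  have "ip2 ?h (\<lambda>_. c) = 0"
  proof -
    have "ip2 ?h (\<lambda>_. c) = ip2 g (\<lambda>_. c) - ip2 (deriv \<phi>) (\<lambda>_. c)" by (rule L2.ip_diff[OF g dL2[OF \<phi>] one])
    then show ?thesis using mean test_fun_integral_deriv[OF \<phi>] by (simp add: ip2_def)
  qed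
  then have "ip2 (\<lambda>x. ?h x - c) (\<lambda>x. ?h x - c) = ip2 ?h ?h + ip2 (\<lambda>_. c) (\<lambda>_. c)"
    using L2.sq_diff[OF h one[of c]] by simp
  moreover have "0 \<le> ip2 (\<lambda>_. c) (\<lambda>_. c)" by (rule L2.ip_nonneg[OF one])
  moreover have "(\<lambda>x. g x - (deriv \<phi> x + c)) = (\<lambda>x. ?h x - c)" by auto
  ultimately have "ip2 ?h ?h < \<epsilon>" using lt by simp
  then show ?thesis using \<phi> by blast
qed

lemma test_fun_prim:
  assumes \<phi>: "\<phi> \<in> test_fun" and x: "x \<in> I" shows "prim (deriv \<phi>) x = \<phi> x"
proof -
  have sm: "smooth \<phi>" by (rule test_fun_D(1)[OF \<phi>])
  have "prim (deriv \<phi>) x = (\<integral>y. indicator {-pi..x} y * deriv \<phi> y \<partial>M)"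
    unfolding prim_def by (intro Bochner_Integration.integral_cong) (auto simp: indicator_def I_def)
  also have "\<dots> = \<phi> x - \<phi> (-pi)"
    using smooth_DERIV[OF smooth_deriv[OF sm]] DERIV_isCont x
    by (intro FTC_M smooth_DERIV[OF sm]) (auto simp: I_def)
  also have "\<phi> (-pi) = 0" by (rule test_fun_D(2)[OF \<phi>]) (simp add: I_def)
  finally show ?thesis by simp
qed

lemma H1_norm_prim:
  assumes w: "w \<in> L2" and h: "h \<in> L2" and wh: "AE x in M. w x = c + prim h x"
  shows "H1_norm w = sqrt (ip2 w w + ip2 h h)"
proof -
  have "is_weak_deriv 1 w h"
  proof (rule weak_deriv_cong_AE[OF _ _ _ prim_weak_deriv[OF h]])
    show "AE x in M. c + prim h x = w x" using wh by eventually_elim simp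
  qed (use L2_D(1)[OF slope_prim_L2[OF h]] L2_D(1)[OF w] in auto)
  note wd = wderiv_AE[OF this h]
  have "(\<integral>x. (wderiv 1 w x)\<^sup>2 \<partial>M) = ip2 h h"
    unfolding ip2_sq[symmetric] by (intro ip2_cong_AE L2_D wd h)
  then show ?thesis by (simp add: H1_norm_def ip2_sq)
qed

lemma test_diff_prim:
  assumes u: "u \<in> L2" and g: "g \<in> L2" and ug: "AE x in M. u x = c + prim g x" and \<phi>: "\<phi> \<in> test_fun"
  shows "AE x in M. u x - \<phi> x = c + prim (\<lambda>x. g x - deriv \<phi> x) x"
proof -
  have d: "deriv \<phi> \<in> L2" by (intro test_fun_L2 test_fun_deriv \<phi>)
  have "prim (\<lambda>x. g x - deriv \<phi> x) x = prim g x - prim (deriv \<phi>) x" for x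
    using prim_comb[OF L2_integrable[OF g] L2_integrable[OF d], of "-1"] by simp
  moreover have "AE x in M. prim (deriv \<phi>) x = \<phi> x" using test_fun_prim[OF \<phi>] by (rule AE_M_I)
  ultimately show ?thesis using ug by auto
qed

text \<open>The primitives of functions of mean zero are limits in \<open>H\<^sup>1\<close> of test functions, since their
  derivatives are approximated by derivatives of test functions and the primitive depends
  continuously on the derivative.\<close>

lemma H10_I:
  assumes u: "u \<in> L2" and g: "g \<in> L2" and ug: "AE x in M. u x = prim g x" and mean: "(\<integral>x. g x \<partial>M) = 0"
  shows "u \<in> H10"
proof -
  have "is_weak_deriv 1 u g"
  proof (rule weak_deriv_cong_AE[OF _ _ _ prim_weak_deriv[OF g]])
    show "AE x in M. 0 + prim g x = u x" using ug by eventually_elim simp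
  qed (use L2_D(1)[OF slope_prim_L2[OF g, of 0]] L2_D(1)[OF u] in auto)
  then have "u \<in> H 1" using u g by (auto simp: H_def)
  moreover have "\<exists>\<phi>\<in>test_fun. H1_norm (\<lambda>x. u x - \<phi> x) < \<epsilon>" if \<epsilon>: "0 < \<epsilon>" for \<epsilon>
  proof -
    define K where "K = 4 * pi\<^sup>2 + 1"
    have K: "0 < K" by (simp add: K_def add_nonneg_pos)
    obtain \<phi> where \<phi>: "\<phi> \<in> test_fun" and lt: "ip2 (\<lambda>x. g x - deriv \<phi> x) (\<lambda>x. g x - deriv \<phi> x) < \<epsilon>\<^sup>2 / K"
      using mean_zero_approx[OF g mean, of "\<epsilon>\<^sup>2 / K"] \<epsilon> K by auto
    define h where "h x = g x - deriv \<phi> x" for x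
    define w where "w x = u x - \<phi> x" for x
    have h: "h \<in> L2" unfolding h_def[abs_def] using L2.diff_mem[OF g test_fun_L2[OF test_fun_deriv[OF \<phi>]]] .
    have w: "w \<in> L2" unfolding w_def[abs_def] using L2.diff_mem[OF u test_fun_L2[OF \<phi>]] .
    have wh: "AE x in M. w x = 0 + prim h x"
      using test_diff_prim[OF u g _ \<phi>, of 0] ug unfolding w_def h_def[abs_def] by simp
    have "ip2 w w = (\<integral>x. (prim h x)\<^sup>2 \<partial>M)"
      unfolding ip2_sq[symmetric] using wh by (intro ip2_cong_AE L2_D w prim_L2 h) auto
    also have "\<dots> \<le> (\<integral>x. 2 * pi * ip2 h h \<partial>M)"
    proof (rule integral_mono)
      show "integrable M (\<lambda>x. (prim h x)\<^sup>2)" by (intro L2_D prim_L2 h)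
      have "(prim h x)\<^sup>2 \<le> (sqrt (2 * pi) * sqrt (ip2 h h))\<^sup>2" for x
        using power_mono[OF prim_bound[OF h, of x], of 2] by simp
      then show "(prim h x)\<^sup>2 \<le> 2 * pi * ip2 h h" for x
        using L2.ip_nonneg[OF h] by (simp add: power_mult_distrib)
    qed simp
    also have "\<dots> = 4 * pi\<^sup>2 * ip2 h h" by (simp add: measure_M_I power2_eq_square)
    finally have "ip2 w w + ip2 h h \<le> K * ip2 h h" by (simp add: K_def algebra_simps)
    also have "\<dots> < \<epsilon>\<^sup>2" using lt K by (simp add: h_def[abs_def] field_simps)
    finally have "sqrt (ip2 w w + ip2 h h) < \<epsilon>" using \<epsilon> by (simp add: real_less_lsqrt)
    then have "H1_norm w < \<epsilon>" using H1_norm_prim[OF w h wh] by simp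
    then show ?thesis using \<phi> unfolding w_def[abs_def] by blast
  qed
  ultimately show ?thesis by (simp add: H10_def)
qed

lemma ip2_const_le:
  assumes "f \<in> L2" "sqrt (ip2 f f) < \<epsilon>" shows "\<bar>\<integral>x. f x \<partial>M\<bar> \<le> sqrt (2 * pi) * \<epsilon>"
proof -
  have "\<bar>\<integral>x. f x \<partial>M\<bar> \<le> (\<integral>x. \<bar>f x\<bar> \<partial>M)" by (rule integral_abs_bound)
  also have "\<dots> \<le> sqrt (2 * pi) * sqrt (ip2 f f)" by (rule L1_le_L2[OF assms(1)])
  also have "\<dots> \<le> sqrt (2 * pi) * \<epsilon>" using assms(2) by (intro mult_left_mono) auto
  finally show ?thesis .
qed

text \<open>Both \<open>c\<close> and the mean of \<open>g\<close> are bounded by a multiple of the \<open>H\<^sup>1\<close>-norm of \<open>u\<close> and vanish for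
  test functions, hence for their limits.\<close>

lemma H10_D:
  assumes "u \<in> H10" and g: "g \<in> L2" and ug: "AE x in M. u x = c + prim g x"
  shows "c = 0" "(\<integral>x. g x \<partial>M) = 0"
proof -
  have u: "u \<in> L2" using assms(1) by (auto simp: H10_def H_def)
  have *: "\<bar>\<integral>x. g x \<partial>M\<bar> \<le> sqrt (2 * pi) * \<epsilon> \<and> 2 * pi * \<bar>c\<bar> \<le> (sqrt (2 * pi) + 2 * pi * sqrt (2 * pi)) * \<epsilon>"
    if \<epsilon>: "0 < \<epsilon>" for \<epsilon>
  proof -
    obtain \<phi> where \<phi>: "\<phi> \<in> test_fun" and lt: "H1_norm (\<lambda>x. u x - \<phi> x) < \<epsilon>"
      using assms(1) \<epsilon> by (auto simp: H10_def)
    define h where "h x = g x - deriv \<phi> x" for x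
    define w where "w x = u x - \<phi> x" for x
    have d: "deriv \<phi> \<in> L2" by (intro test_fun_L2 test_fun_deriv \<phi>)
    have h: "h \<in> L2" unfolding h_def[abs_def] using L2.diff_mem[OF g d] .
    have w: "w \<in> L2" unfolding w_def[abs_def] using L2.diff_mem[OF u test_fun_L2[OF \<phi>]] .
    have wh: "AE x in M. w x = c + prim h x"
      using test_diff_prim[OF u g ug \<phi>] unfolding w_def h_def[abs_def] by simp
    have "sqrt (ip2 w w + ip2 h h) < \<epsilon>" using lt H1_norm_prim[OF w h wh] unfolding w_def[abs_def] by simp
    moreover have "0 \<le> ip2 w w" "0 \<le> ip2 h h" using L2.ip_nonneg w h by auto
    moreover have "sqrt (ip2 w w) \<le> sqrt (ip2 w w + ip2 h h)" "sqrt (ip2 h h) \<le> sqrt (ip2 w w + ip2 h h)"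
      using calculation(2,3) by simp_all
    ultimately have wle: "sqrt (ip2 w w) < \<epsilon>" and hle: "sqrt (ip2 h h) < \<epsilon>" by linarith+
    have "(\<integral>x. h x \<partial>M) = (\<integral>x. g x \<partial>M)"
      unfolding h_def using L2_integrable[OF g] L2_integrable[OF d] test_fun_integral_deriv[OF \<phi>] by simp
    then have 1: "\<bar>\<integral>x. g x \<partial>M\<bar> \<le> sqrt (2 * pi) * \<epsilon>" using ip2_const_le[OF h hle] by simp
    have ph: "\<bar>prim h x\<bar> \<le> sqrt (2 * pi) * \<epsilon>" for x
      by (rule order_trans[OF prim_bound[OF h] mult_left_mono[OF less_imp_le[OF hle]]]) simp
    have "(\<integral>x. w x \<partial>M) = (\<integral>x. c + prim h x \<partial>M)"
      using wh L2_D(1)[OF w] L2_D(1)[OF slope_prim_L2[OF h]] by (intro integral_cong_AE) auto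
    also have "\<dots> = 2 * pi * c + (\<integral>x. prim h x \<partial>M)"
      using L2_integrable[OF prim_L2[OF h]] by (simp add: measure_M_I)
    finally have "2 * pi * c = (\<integral>x. w x \<partial>M) - (\<integral>x. prim h x \<partial>M)" by simp
    moreover have "\<bar>\<integral>x. prim h x \<partial>M\<bar> \<le> 2 * pi * (sqrt (2 * pi) * \<epsilon>)"
    proof -
      have "\<bar>\<integral>x. prim h x \<partial>M\<bar> \<le> (\<integral>x. \<bar>prim h x\<bar> \<partial>M)" by (rule integral_abs_bound)
      also have "\<dots> \<le> (\<integral>x. sqrt (2 * pi) * \<epsilon> \<partial>M)"
        using L2_integrable[OF prim_L2[OF h]] ph by (intro integral_mono) auto
      finally show ?thesis by (simp add: measure_M_I)
    qed
    moreover have "\<bar>2 * pi * c\<bar> = 2 * pi * \<bar>c\<bar>" by (simp add: abs_mult)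
    ultimately have "2 * pi * \<bar>c\<bar> \<le> sqrt (2 * pi) * \<epsilon> + 2 * pi * (sqrt (2 * pi) * \<epsilon>)"
      using ip2_const_le[OF w wle] by linarith
    then show ?thesis using 1 by (simp add: algebra_simps)
  qed
  have small: "x = 0" if "\<And>\<epsilon>. 0 < \<epsilon> \<Longrightarrow> \<bar>x\<bar> \<le> C * \<epsilon>" "0 < C" for x C :: real
  proof (rule ccontr)
    assume "x \<noteq> 0"
    then show False using that(1)[of "\<bar>x\<bar> / (2 * C)"] that(2) by (simp add: field_simps)
  qed
  show "(\<integral>x. g x \<partial>M) = 0" using * by (intro small[of _ "sqrt (2 * pi)"]) auto
  have "2 * pi * c = 0" 
    by (rule small[of _ "sqrt (2 * pi) + 2 * pi * sqrt (2 * pi)"]) (use * in \<open>auto simp: abs_mult intro!: add_pos_pos\<close>)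
  then show "c = 0" by simp
qed

text \<open>The set where two continuous functions differ is open, and a nonempty open set is not null.\<close>

lemma continuous_AE_eq:
  fixes v w :: "real \<Rightarrow> real"
  assumes "continuous_on I v" "continuous_on I w" "AE x in M. v x = w x" "x \<in> I"
  shows "v x = w x"
proof (rule ccontr)
  assume ne: "v x \<noteq> w x"
  have op: "open (I \<inter> (\<lambda>x. v x - w x) -` (- {0}))"
    by (rule continuous_open_preimage) (use assms in \<open>auto intro!: continuous_intros simp: I_def\<close>)
  have "AE x in lebesgue. x \<in> I \<longrightarrow> v x = w x"
    using assms(3) by (subst (asm) AE_restrict_space_iff) auto
  then have "{x \<in> space lebesgue. \<not> (x \<in> I \<longrightarrow> v x = w x)} \<in> null_sets lebesgue"
    by (subst (asm) completion.AE_iff_null_sets) (auto intro: completion.complete_sets_sandwich)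
  moreover have "{x \<in> space lebesgue. \<not> (x \<in> I \<longrightarrow> v x = w x)} = I \<inter> (\<lambda>x. v x - w x) -` (- {0})" by auto
  ultimately have "negligible (I \<inter> (\<lambda>x. v x - w x) -` (- {0}))"
    by (simp add: negligible_iff_null_sets)
  moreover have "x \<in> I \<inter> (\<lambda>x. v x - w x) -` (- {0})" using ne assms(4) by simp
  ultimately show False using open_not_negligible[OF op] by blast
qed

lemma cont_rep_eq:
  assumes "continuous_on I w" "AE x in M. u x = w x" "x \<in> I"
  shows "cont_rep u x = w x"
proof -
  have "\<exists>w. continuous_on I w \<and> (AE x in M. u x = w x)" using assms by blast
  from someI_ex[OF this] have *: "continuous_on I (cont_rep u)" "AE x in M. u x = cont_rep u x"
    unfolding cont_rep_def by auto
  have "AE x in M. cont_rep u x = w x" using *(2) assms(2) by eventually_elim simp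
  then show ?thesis using continuous_AE_eq[OF *(1) assms(1) _ assms(3)] by blast
qed

section \<open>The energy space of the beam with two piers\<close>

locale piers =
  fixes a :: real
  assumes a: "0 < a" "a < 1"
begin

lemma pier_I: "a * pi \<in> I" "- a * pi \<in> I"
proof -
  have "0 < a * pi" "a * pi < 1 * pi" using a by (auto intro!: mult_strict_right_mono)
  then have "-pi < a * pi" "a * pi < pi" by linarith+
  then show "a * pi \<in> I" "- a * pi \<in> I" by (auto simp: I_def)
qed

lemma V_I:
  assumes u: "u \<in> L2" and m: "m \<in> L2" and um: "AE x in M. u x = G m x"
    and piers: "G m (a * pi) = 0" "G m (- a * pi) = 0"
  shows "u \<in> V a" "AE x in M. wderiv 2 u x = m x"
proof -
  note wd = G_weak_derivs[OF u m um]
  have gL: "(\<lambda>y. slope m + prim m y) \<in> L2" by (rule slope_prim_L2[OF m])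
  have "{1..2::nat} = {1, 2}" by auto
  then have "u \<in> H 2" using u wd gL m unfolding H_def by auto
  moreover have "u \<in> H10"
  proof (rule H10_I[OF u gL])
    have "AE x in M. G m x = prim (\<lambda>y. slope m + prim m y) x"
      using G_prim[OF m] by (auto intro!: AE_M_I simp: I_def)
    with um show "AE x in M. u x = prim (\<lambda>y. slope m + prim m y) x" by eventually_elim simp
    show "(\<integral>x. slope m + prim m x \<partial>M) = 0"
      using G_prim[OF m, of pi] prim_right[of pi] G_right[of m] by simp
  qed
  moreover have "cont_rep u x = G m x" if "x \<in> I" for x
    by (rule cont_rep_eq[OF G_continuous[OF m] um that])
  ultimately show "u \<in> V a" unfolding V_def using piers pier_I by auto
  show "AE x in M. wderiv 2 u x = m x" by (rule wderiv_AE(3)[OF wd(2) m])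
qed

text \<open>Two applications of the lemma of du Bois-Reymond write \<open>u\<close> as a twofold primitive of its weak second
  derivative plus an affine function, and the boundary conditions leave only the affine part that occurs
  in the Green operator.\<close>

lemma V_D:
  assumes "u \<in> V a"
  shows "u \<in> L2" "wderiv 2 u \<in> L2" "AE x in M. u x = G (wderiv 2 u) x"
    "G (wderiv 2 u) (a * pi) = 0" "G (wderiv 2 u) (- a * pi) = 0"
proof -
  have u2: "u \<in> H 2" and u10: "u \<in> H10" using assms by (auto simp: V_def)
  show u: "u \<in> L2" using u2 by (auto simp: H_def)
  have deriv: "\<exists>g\<in>L2. is_weak_deriv j u g" if "j \<in> {1..2}" for j using u2 that by (auto simp: H_def)
  obtain g where g: "g \<in> L2" "is_weak_deriv 1 u g" using deriv[of 1] by auto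
  obtain m0 where m0: "m0 \<in> L2" "is_weak_deriv 2 u m0" using deriv[of 2] by auto
  define m where "m = wderiv 2 u"
  have m: "m \<in> L2" "is_weak_deriv 2 u m" unfolding m_def by (rule wderiv_AE[OF m0(2,1)])+
  then show "wderiv 2 u \<in> L2" by (simp add: m_def)
  obtain c where c: "AE x in M. u x = c + prim g x" by (rule weak_deriv_imp_prim[OF u g])
  have "is_weak_deriv 1 g m" using is_weak_deriv_twice[OF g(2)] m(2) by blast
  then obtain s where s: "AE x in M. g x = s + prim m x" by (rule weak_deriv_imp_prim[OF g(1) m(1)])
  have c0: "c = 0" and mean: "(\<integral>x. g x \<partial>M) = 0" using H10_D[OF u10 g(1) c] by auto
  have sp: "(\<lambda>x. s + prim m x) \<in> L2" by (rule slope_prim_L2[OF m(1)])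
  have pg: "prim g x = prim (\<lambda>x. s + prim m x) x" for x
    using s by (intro prim_cong_AE L2_D sp g)
  have sL: "(\<lambda>x. s) \<in> L2" by (rule L2_continuous) simp
  have Jg: "prim g x = s * (x + pi) + prim2 m x" if "-pi \<le> x" "x \<le> pi" for x
    unfolding pg using prim_comb[OF L2_integrable[OF sL] L2_integrable[OF prim_L2[OF m(1)]], of 1 x]
      prim_const[OF that] prim_prim[OF m(1) that] by simp
  have "prim g pi = 0" using prim_right[of pi g] mean by simp
  then have "s * (2 * pi) + prim2 m pi = 0" using Jg[of pi] by simp
  moreover have "slope m * (2 * pi) + prim2 m pi = 0" using G_slope_prim2[OF m(1), of pi] G_right[of m] by simp
  ultimately have "s * (2 * pi) = slope m * (2 * pi)" by linarith
  then have s_eq: "s = slope m" using pi_gt_zero by simp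
  have "prim g x = G m x" if "x \<in> I" for x
    using Jg[of x] G_slope_prim2[OF m(1), of x] that unfolding s_eq by (simp add: I_def)
  then have "AE x in M. prim g x = G m x" by (rule AE_M_I)
  with c c0 have um: "AE x in M. u x = G m x" by auto
  then show "AE x in M. u x = G (wderiv 2 u) x" by (simp add: m_def)
  have "cont_rep u x = G m x" if "x \<in> I" for x
    by (rule cont_rep_eq[OF G_continuous[OF m(1)] um that])
  then show "G (wderiv 2 u) (a * pi) = 0" "G (wderiv 2 u) (- a * pi) = 0"
    using assms pier_I by (auto simp: V_def m_def)
qed

lemma inner_V_ip2: "inner_V u v = ip2 (wderiv 2 u) (wderiv 2 v)"
  by (simp add: inner_V_def ip2_def)

lemma V_comb:
  assumes u: "u \<in> V a" and v: "v \<in> V a"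
  shows "(\<lambda>x. u x + c * v x) \<in> V a"
    "AE x in M. wderiv 2 (\<lambda>x. u x + c * v x) x = wderiv 2 u x + c * wderiv 2 v x"
proof -
  note U = V_D[OF u] and W = V_D[OF v]
  have m: "(\<lambda>x. wderiv 2 u x + c * wderiv 2 v x) \<in> L2" by (intro L2_comb U W)
  have "AE x in M. u x + c * v x = G (\<lambda>x. wderiv 2 u x + c * wderiv 2 v x) x"
    using U(3) W(3) by eventually_elim (simp add: G_comb U W)
  note * = V_I[OF L2_comb[OF U(1) W(1)] m this]
  show "(\<lambda>x. u x + c * v x) \<in> V a"
    "AE x in M. wderiv 2 (\<lambda>x. u x + c * v x) x = wderiv 2 u x + c * wderiv 2 v x"
    using * U(4,5) W(4,5) by (auto simp: G_comb U W)
qed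

lemma G_in_V:
  assumes "m \<in> L2" "G m (a * pi) = 0" "G m (- a * pi) = 0"
  shows "G m \<in> V a" "AE x in M. wderiv 2 (G m) x = m x"
  using V_I[OF G_L2[OF assms(1)] assms(1) _ assms(2,3)] by auto

lemma inner_V_comb:
  assumes "f \<in> V a" "g \<in> V a" "h \<in> V a"
  shows "inner_V (\<lambda>x. f x + c * g x) h = inner_V f h + c * inner_V g h"
proof -
  note F = V_D[OF assms(1)] and Gg = V_D[OF assms(2)] and Hh = V_D[OF assms(3)]
  have "inner_V (\<lambda>x. f x + c * g x) h = ip2 (\<lambda>x. wderiv 2 f x + c * wderiv 2 g x) (wderiv 2 h)"
    unfolding inner_V_ip2
    by (intro ip2_cong_AE L2_D V_D(2) V_comb assms L2_comb) auto
  also have "\<dots> = inner_V f h + c * inner_V g h"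
    unfolding inner_V_ip2 by (rule L2.ip_comb[OF F(2) Gg(2) Hh(2)])
  finally show ?thesis .
qed

sublocale V: form_space "V a" inner_V
proof
  have z: "(\<lambda>x. 0) \<in> L2" by (rule L2.zero_mem)
  have "G (\<lambda>x. 0) x = 0" for x by (simp add: G_def)
  then show "(\<lambda>x. 0) \<in> V a" by (intro V_I(1)[OF z z]) auto
  show "0 \<le> inner_V f f" if "f \<in> V a" for f
    unfolding inner_V_ip2 by (rule L2.ip_nonneg[OF V_D(2)[OF that]])
  show "inner_V f g = inner_V g f" for f g by (simp add: inner_V_def mult.commute)
qed (auto intro: V_comb inner_V_comb)

lemma wderiv_V_diff:
  assumes "u \<in> V a" "v \<in> V a"
  shows "inner_V (\<lambda>x. u x - v x) (\<lambda>x. u x - v x) =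
    ip2 (\<lambda>x. wderiv 2 u x - wderiv 2 v x) (\<lambda>x. wderiv 2 u x - wderiv 2 v x)"
  unfolding V.sq_diff[OF assms] L2.sq_diff[OF V_D(2)[OF assms(1)] V_D(2)[OF assms(2)]] inner_V_ip2 ..

sublocale V: hilbert_space "V a" inner_V
proof
  fix u :: "nat \<Rightarrow> real \<Rightarrow> real"
  assume u: "\<And>n. u n \<in> V a"
    and cauchy: "\<And>\<epsilon>. 0 < \<epsilon> \<Longrightarrow> \<exists>N. \<forall>m\<ge>N. \<forall>n\<ge>N. inner_V (\<lambda>x. u m x - u n x) (\<lambda>x. u m x - u n x) < \<epsilon>"
  note U = V_D[OF u]
  have "\<exists>m\<in>L2. L2.conv (\<lambda>n. wderiv 2 (u n)) m"
    using cauchy by (intro L2.complete U(2)) (simp add: wderiv_V_diff[OF u u])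
  then obtain m where m: "m \<in> L2" "L2.conv (\<lambda>n. wderiv 2 (u n)) m" by blast
  have G0: "G m x = 0" if "\<And>n. G (wderiv 2 (u n)) x = 0" for x
  proof -
    have "(\<lambda>n. ip2 (wderiv 2 (u n)) (green x)) \<longlonglongrightarrow> ip2 m (green x)"
      by (rule L2.conv_ip[OF m(2) U(2) m(1) green_L2])
    moreover have "ip2 (wderiv 2 (u n)) (green x) = 0" for n
      using that[of n] by (simp add: G_ip2 L2.ip_sym[OF green_L2 U(2)])
    ultimately have "ip2 m (green x) = 0" by (simp add: LIMSEQ_const_iff)
    then show ?thesis by (simp add: G_ip2 L2.ip_sym[OF green_L2 m(1)])
  qed
  have GV: "G m \<in> V a" "AE x in M. wderiv 2 (G m) x = m x"
    using G_in_V[OF m(1) G0[OF U(4)] G0[OF U(5)]] by auto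
  have "inner_V (\<lambda>x. u n x - G m x) (\<lambda>x. u n x - G m x) = ip2 (\<lambda>x. wderiv 2 (u n) x - m x) (\<lambda>x. wderiv 2 (u n) x - m x)" for n
  proof -
    have "AE x in M. wderiv 2 (u n) x - wderiv 2 (G m) x = wderiv 2 (u n) x - m x"
      using GV(2) by eventually_elim simp
    then show ?thesis unfolding wderiv_V_diff[OF u GV(1)]
      by (intro ip2_cong_AE L2_D L2.diff_mem U(2) V_D(2)[OF GV(1)] m(1))
  qed
  then have "V.conv u (G m)" using m(2) by (simp add: V.conv_def L2.conv_def)
  then show "\<exists>w\<in>V a. V.conv u w" using GV(1) by blast
qed

lemma V_sup_bound:
  assumes "u \<in> V a"
  shows "AE x in M. \<bar>u x\<bar> \<le> 4 * pi * sqrt (2 * pi) * sqrt (inner_V u u)"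
proof -
  note U = V_D[OF assms]
  have "AE x in M. \<bar>G (wderiv 2 u) x\<bar> \<le> 4 * pi * sqrt (2 * pi) * sqrt (inner_V u u)"
    using G_bound[OF U(2)] by (intro AE_M_I) (simp add: I_def inner_V_ip2)
  with U(3) show ?thesis by eventually_elim simp
qed

lemma ip2_le_sup:
  assumes "u \<in> L2" "AE x in M. \<bar>u x\<bar> \<le> B" shows "ip2 u u \<le> 2 * pi * B\<^sup>2"
proof -
  have "ip2 u u \<le> (\<integral>x. B\<^sup>2 \<partial>M)"
    unfolding ip2_sq
  proof (rule integral_mono_AE)
    show "AE x in M. (u x)\<^sup>2 \<le> B\<^sup>2"
      using assms(2)
    proof eventually_elim
      case (elim x)
      then show ?case using power_mono[OF elim, of 2] by simp
    qed
  qed (use L2_D(2)[OF assms(1)] in auto)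
  then show ?thesis by (simp add: measure_M_I)
qed

lemma V_ip2_bound:
  assumes "u \<in> V a" shows "ip2 u u \<le> 64 * pi ^ 4 * inner_V u u"
proof -
  have "ip2 u u \<le> 2 * pi * (4 * pi * sqrt (2 * pi) * sqrt (inner_V u u))\<^sup>2"
    by (rule ip2_le_sup[OF V_D(1)[OF assms] V_sup_bound[OF assms]])
  also have "\<dots> = 64 * pi ^ 4 * inner_V u u"
    using V.ip_nonneg[OF assms] by (simp add: power_mult_distrib power2_eq_square power4_eq_xxxx)
  finally show ?thesis .
qed

lemma V_null_iff:
  assumes "u \<in> V a" shows "inner_V u u = 0 \<longleftrightarrow> (AE x in M. u x = 0)"
proof
  assume "inner_V u u = 0"
  then show "AE x in M. u x = 0" using V_sup_bound[OF assms] by simp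
next
  assume z: "AE x in M. u x = 0"
  note U = V_D[OF assms]
  have zL: "(\<lambda>x. 0) \<in> L2" by (rule L2.zero_mem)
  have "AE x in M. (0::real) = u x" using z by eventually_elim simp
  then have "is_weak_deriv 2 u (\<lambda>x. 0)"
    by (rule weak_deriv_cong_AE[rotated 2]) (auto simp: is_weak_deriv_def L2_D U)
  then have "AE x in M. wderiv 2 u x = 0" by (rule wderiv_AE(3)) (rule zL)
  then show "inner_V u u = 0" unfolding inner_V_ip2 ip2_zero_iff[OF U(2)] .
qed

text \<open>The continuous representatives of a bounded sequence are uniformly bounded and have a common
  Lipschitz constant.\<close>

lemma V_ip2_compact:
  assumes u: "\<And>n. u n \<in> V a" and C: "\<And>n. inner_V (u n) (u n) \<le> C"
  obtains r :: "nat \<Rightarrow> nat" where "strict_mono r"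
    "\<And>\<epsilon>. 0 < \<epsilon> \<Longrightarrow> \<exists>N. \<forall>m\<ge>N. \<forall>n\<ge>N. ip2 (\<lambda>x. u (r m) x - u (r n) x) (\<lambda>x. u (r m) x - u (r n) x) < \<epsilon>"
proof -
  note U = V_D[OF u]
  define f where "f n = G (wderiv 2 (u n))" for n
  have sq: "sqrt (ip2 (wderiv 2 (u n)) (wderiv 2 (u n))) \<le> sqrt C" for n
    using C[of n] unfolding inner_V_ip2 by simp
  have bound: "norm (f n x) \<le> 4 * pi * sqrt (2 * pi) * sqrt C" if "x \<in> {-pi..pi}" for n x
  proof -
    have "norm (f n x) \<le> 4 * pi * sqrt (2 * pi) * sqrt (ip2 (wderiv 2 (u n)) (wderiv 2 (u n)))"
      using G_bound[OF U(2), of x n] that by (simp add: f_def)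
    also have "\<dots> \<le> 4 * pi * sqrt (2 * pi) * sqrt C" by (intro mult_left_mono sq) auto
    finally show ?thesis .
  qed
  define L where "L = 2 * sqrt (2 * pi) * sqrt C + 1"
  have C0: "0 \<le> C" using C[of 0] V.ip_nonneg[OF u, of 0] by linarith
  have L0: "0 < L" using C0 by (simp add: L_def add_nonneg_pos)
  have lip: "\<bar>f n x - f n y\<bar> \<le> L * \<bar>x - y\<bar>" for n x y
  proof -
    have "\<bar>f n x - f n y\<bar> \<le> 2 * sqrt (2 * pi) * sqrt (ip2 (wderiv 2 (u n)) (wderiv 2 (u n))) * \<bar>x - y\<bar>"
      unfolding f_def by (rule G_lipschitz[OF U(2)])
    also have "\<dots> \<le> 2 * sqrt (2 * pi) * sqrt C * \<bar>x - y\<bar>"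
      by (intro mult_right_mono mult_left_mono sq) auto
    also have "\<dots> \<le> L * \<bar>x - y\<bar>" by (intro mult_right_mono) (auto simp: L_def)
    finally show ?thesis .
  qed
  obtain g r where r: "strict_mono (r :: nat \<Rightarrow> nat)"
    and unif: "\<And>e. 0 < e \<Longrightarrow> \<exists>N. \<forall>n x. n \<ge> N \<and> x \<in> {-pi..pi} \<longrightarrow> norm (f (r n) x - g x) < e"
  proof (rule Arzela_Ascoli[of "{-pi..pi}" f, OF _ bound])
    fix x e :: real assume "0 < e"
    have "norm (f n x - f n y) < e" if "norm (x - y) < e / L" for n y
    proof -
      have "norm (f n x - f n y) \<le> L * \<bar>x - y\<bar>" using lip by simp
      also have "\<dots> < e" using that L0 by (simp add: field_simps)
      finally show ?thesis .
    qed
    then show "\<exists>d. 0 < d \<and> (\<forall>n y. y \<in> {-pi..pi} \<and> norm (x - y) < d \<longrightarrow> norm (f n x - f n y) < e)"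
      using \<open>0 < e\<close> L0 by (intro exI[of _ "e / L"]) auto
  qed auto
  have "\<exists>N. \<forall>m\<ge>N. \<forall>n\<ge>N. ip2 (\<lambda>x. u (r m) x - u (r n) x) (\<lambda>x. u (r m) x - u (r n) x) < \<epsilon>" if \<epsilon>: "0 < \<epsilon>" for \<epsilon>
  proof -
    define e where "e = sqrt (\<epsilon> / (16 * pi))"
    have e: "0 < e" "2 * pi * (2 * e)\<^sup>2 < \<epsilon>" using \<epsilon> by (simp_all add: e_def power_mult_distrib)
    obtain N where N: "\<And>n x. n \<ge> N \<Longrightarrow> x \<in> {-pi..pi} \<Longrightarrow> norm (f (r n) x - g x) < e"
      using unif[OF e(1)] by blast
    have "ip2 (\<lambda>x. u (r m) x - u (r n) x) (\<lambda>x. u (r m) x - u (r n) x) < \<epsilon>" if mn: "m \<ge> N" "n \<ge> N" for m n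
    proof -
      have "AE x in M. \<bar>f (r m) x - f (r n) x\<bar> \<le> 2 * e"
      proof (rule AE_M_I)
        fix x assume "x \<in> I"
        then have "x \<in> {-pi..pi}" by (simp add: I_def)
        then have "\<bar>f (r m) x - g x\<bar> < e" "\<bar>f (r n) x - g x\<bar> < e" using N mn by auto
        then show "\<bar>f (r m) x - f (r n) x\<bar> \<le> 2 * e" by linarith
      qed
      with U(3)[of "r m"] U(3)[of "r n"] have "AE x in M. \<bar>u (r m) x - u (r n) x\<bar> \<le> 2 * e"
        by eventually_elim (simp add: f_def)
      then have "ip2 (\<lambda>x. u (r m) x - u (r n) x) (\<lambda>x. u (r m) x - u (r n) x) \<le> 2 * pi * (2 * e)\<^sup>2"
        by (intro ip2_le_sup L2.diff_mem U(1))
      then show ?thesis using e(2) by linarith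
    qed
    then show ?thesis by blast
  qed
  then show ?thesis using r that by blast
qed

lemma test_fun_V:
  assumes \<phi>: "\<phi> \<in> test_fun" and zero: "\<phi> (a * pi) = 0" "\<phi> (- a * pi) = 0"
  shows "\<phi> \<in> V a"
proof -
  define m where "m = deriv (deriv \<phi>)"
  have d: "deriv \<phi> \<in> test_fun" by (rule test_fun_deriv[OF \<phi>])
  have m: "m \<in> L2" unfolding m_def by (intro test_fun_L2 test_fun_deriv \<phi>)
  have prim2: "prim2 m x = prim (deriv \<phi>) x" if "-pi \<le> x" "x \<le> pi" for x
  proof -
    have "prim (prim m) x = prim (deriv \<phi>) x"
      using test_fun_prim[OF d] by (intro prim_cong_AE L2_D prim_L2 m test_fun_L2 d AE_M_I) (simp add: m_def)
    then show ?thesis using prim_prim[OF m that] by simp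
  qed
  have "prim2 m pi = 0" using prim2[of pi] prim_right[of pi] test_fun_integral_deriv[OF \<phi>] by simp
  then have "slope m = 0" using G_slope_prim2[OF m, of pi] G_right[of m] by simp
  then have GJ: "G m x = prim2 m x" for x using G_slope_prim2[OF m] by simp
  have eq: "\<phi> x = G m x" if "x \<in> I" for x
    using prim2[of x] test_fun_prim[OF \<phi> that] that unfolding GJ by (simp add: I_def)
  show ?thesis
    by (rule V_I(1)[OF test_fun_L2[OF \<phi>] m])
       (use eq[OF pier_I(1)] eq[OF pier_I(2)] zero eq in \<open>auto intro: AE_M_I\<close>)
qed

text \<open>A test function times \<open>(x - a \<pi>) (x + a \<pi>)\<close> vanishes at the piers and so belongs to \<open>V a\<close>. Hence this factor
  times \<open>f\<close> is orthogonal to all test functions.\<close>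

lemma V_total_in_L2:
  assumes f: "f \<in> L2" and orth: "\<And>v. v \<in> V a \<Longrightarrow> ip2 f v = 0"
  shows "ip2 f f = 0"
proof -
  let ?w = "\<lambda>x. (1 * x + - (a * pi)) * (1 * x + a * pi)"
  have sm: "smooth ?w" by (intro smooth_mult smooth_affine)
  have wL: "?w \<in> borel_measurable M"
    by (intro borel_measurable_M borel_measurable_continuous_onI smooth_continuous[OF sm])
  have "(\<lambda>x. ?w x * f x) \<in> L2"
  proof (rule L2_mult_Linf[OF wL _ f])
    show "AE x in M. \<bar>?w x\<bar> \<le> (2 * pi) * (2 * pi)"
    proof (rule AE_M_I)
      fix x assume "x \<in> I"
      then have x: "\<bar>x\<bar> \<le> pi" "\<bar>a * pi\<bar> \<le> pi"
        using pier_I unfolding I_def greaterThanLessThan_iff by linarith+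
      show "\<bar>?w x\<bar> \<le> (2 * pi) * (2 * pi)"
        unfolding abs_mult by (intro mult_mono) (use x in auto)
    qed
  qed
  then have "AE x in M. ?w x * f x = 0"
  proof (rule fundamental_lemma[OF L2_integrable])
    fix \<phi> assume \<phi>: "\<phi> \<in> test_fun"
    have "(\<lambda>x. \<phi> x * ?w x) \<in> V a"
      by (rule test_fun_V[OF test_fun_mult[OF \<phi> sm]]) auto
    from orth[OF this] show "(\<integral>x. ?w x * f x * \<phi> x \<partial>M) = 0"
      by (simp add: ip2_def mult_ac)
  qed
  moreover have "AE x in M. x \<noteq> a * pi" "AE x in M. x \<noteq> - (a * pi)"
  proof -
    have "AE x in M. x \<noteq> c" for c :: real
    proof -
      have "AE x in lebesgue. x \<noteq> c" by (rule AE_completion) (rule AE_lborel_singleton)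
      then have "AE x in lebesgue. x \<in> I \<longrightarrow> x \<noteq> c" by eventually_elim simp
      then show ?thesis using AE_restrict_space_iff[of I lebesgue "\<lambda>x. x \<noteq> c"] by simp
    qed
    then show "AE x in M. x \<noteq> a * pi" "AE x in M. x \<noteq> - (a * pi)" by blast+
  qed
  ultimately have "AE x in M. f x = 0"
    by eventually_elim (auto simp: add_eq_0_iff)
  then show ?thesis using ip2_zero_iff[OF f] by simp
qed

lemma ex_test_fun_in_interval:
  assumes cd: "-pi \<le> c" "c < d" "d \<le> pi"
  shows "\<exists>\<phi>\<in>test_fun. (\<forall>x. x \<notin> {c<..<d} \<longrightarrow> \<phi> x = 0) \<and> (\<exists>x\<in>I. \<phi> x \<noteq> 0)"
proof -
  define x where "x = (c + d) / 2"
  have x: "x \<in> {c<..<d}" "x \<in> I" using cd by (auto simp: x_def I_def field_simps)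
  have "(\<lambda>n. bump c d n x) \<longlonglongrightarrow> 1" using bump_tendsto[of c d x] x by simp
  then have "\<forall>\<^sub>F n in sequentially. 0 < bump c d n x" by (rule order_tendstoD) simp
  then obtain n where n: "0 < bump c d n x" by (auto simp: eventually_sequentially)
  have "bump c d n y = 0" if "y \<notin> {c<..<d}" for y
  proof -
    have "y - c \<le> 1 / real (Suc n) \<or> d - y \<le> 1 / real (Suc n)"
    proof -
      have "y - c \<le> 0 \<or> d - y \<le> 0" using that by auto
      moreover have "0 \<le> 1 / real (Suc n)" by simp
      ultimately show ?thesis by linarith
    qed
    then show ?thesis using step_eq_0 by (auto simp: bump_def)
  qed
  moreover have "bump c d n \<in> test_fun" using cd by (intro bump_test_fun) auto
  moreover have "\<exists>x\<in>I. bump c d n x \<noteq> 0" using n x(2) by (intro bexI[of _ x]) auto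
  ultimately show ?thesis by blast
qed

text \<open>Bumps on disjoint intervals that accumulate at the right pier from the right.\<close>

lemma V_disjoint_sequence:
  obtains \<phi> :: "nat \<Rightarrow> real \<Rightarrow> real" where "\<And>n. \<phi> n \<in> V a" "\<And>n. inner_V (\<phi> n) (\<phi> n) \<noteq> 0"
    "\<And>m n x. m \<noteq> n \<Longrightarrow> \<phi> m x * \<phi> n x = 0"
proof -
  define l where "l = pi - a * pi"
  have l: "0 < l" "a * pi + l = pi" using pier_I by (auto simp: l_def I_def)
  define c where "c n = a * pi + l / real (n + 2)" for n
  define d where "d n = a * pi + l / real (n + 1)" for n
  have cd: "c n < d n" "a * pi < c n" "d n \<le> pi" for n
  proof -
    show "c n < d n" using l by (simp add: c_def d_def frac_less2)
    show "a * pi < c n" using l by (simp add: c_def)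
    have "l / real (n + 1) \<le> l / 1" using l by (intro divide_left_mono) auto
    then show "d n \<le> pi" using l by (simp add: d_def)
  qed
  have "0 < a * pi" using a by simp
  then have "-pi \<le> c n" for n using cd(2)[of n] pi_gt_zero by linarith
  then have "\<exists>\<phi>\<in>test_fun. (\<forall>x. x \<notin> {c n<..<d n} \<longrightarrow> \<phi> x = 0) \<and> (\<exists>x\<in>I. \<phi> x \<noteq> 0)" for n
    by (intro ex_test_fun_in_interval cd)
  then obtain \<phi> where \<phi>: "\<And>n. \<phi> n \<in> test_fun" "\<And>n x. x \<notin> {c n<..<d n} \<Longrightarrow> \<phi> n x = 0"
    "\<And>n. \<exists>x\<in>I. \<phi> n x \<noteq> 0" by metis
  have V: "\<phi> n \<in> V a" for n
  proof (rule test_fun_V[OF \<phi>(1)])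
    show "\<phi> n (a * pi) = 0" by (rule \<phi>(2)) (use cd(2)[of n] in auto)
    have "0 < a * pi" using a by simp
    then show "\<phi> n (- a * pi) = 0" by (intro \<phi>(2)) (use cd(2)[of n] in auto)
  qed
  moreover have "inner_V (\<phi> n) (\<phi> n) \<noteq> 0" for n
  proof
    assume "inner_V (\<phi> n) (\<phi> n) = 0"
    then have "AE x in M. \<phi> n x = 0" using V_null_iff[OF V] by simp
    then have "\<phi> n x = 0" if "x \<in> I" for x
      using continuous_AE_eq[OF test_fun_cont[OF \<phi>(1)] _ _ that, of "\<lambda>_. 0"] by simp
    then show False using \<phi>(3) by blast
  qed
  moreover have "\<phi> m x * \<phi> n x = 0" if "m \<noteq> n" for m n x
  proof -
    have *: "\<phi> m x * \<phi> n x = 0" if "m < n" for m n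
    proof -
      have "l / real (n + 1) \<le> l / real (m + 2)" using l that by (intro divide_left_mono) auto
      then have "d n \<le> c m" by (simp add: c_def d_def)
      then have "x \<notin> {c m<..<d m} \<or> x \<notin> {c n<..<d n}" by auto
      then show ?thesis using \<phi>(2) by auto
    qed
    show ?thesis using *[of m n] *[of n m] that by (cases "m < n") (auto simp: mult.commute)
  qed
  ultimately show ?thesis by (rule that)
qed

end

section \<open>Weak solutions\<close>

text \<open>A Lagrange multiplier rule in its algebraic form.\<close>

lemma linear_functional_factor:
  fixes L K :: "('a \<Rightarrow> real) \<Rightarrow> real"
  assumes S: "\<And>f g c. \<lbrakk>f \<in> S; g \<in> S\<rbrakk> \<Longrightarrow> (\<lambda>x. f x + c * g x) \<in> S"
    and L: "\<And>f g c. \<lbrakk>f \<in> S; g \<in> S\<rbrakk> \<Longrightarrow> L (\<lambda>x. f x + c * g x) = L f + c * L g"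
    and K: "\<And>f g c. \<lbrakk>f \<in> S; g \<in> S\<rbrakk> \<Longrightarrow> K (\<lambda>x. f x + c * g x) = K f + c * K g"
    and ker: "\<And>f. \<lbrakk>f \<in> S; K f = 0\<rbrakk> \<Longrightarrow> L f = 0"
  obtains \<kappa> where "\<And>f. f \<in> S \<Longrightarrow> L f = \<kappa> * K f"
proof (cases "\<exists>z\<in>S. K z \<noteq> 0")
  case False
  then have "L f = 0 * K f" if "f \<in> S" for f using ker that by auto
  then show ?thesis by (rule that)
next
  case True
  then obtain z where z: "z \<in> S" "K z \<noteq> 0" by blast
  have "L f = (L z / K z) * K f" if f: "f \<in> S" for f
  proof -
    have "K (\<lambda>x. f x + (- (K f / K z)) * z x) = K f + (- (K f / K z)) * K z" by (rule K[OF f z(1)])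
    also have "\<dots> = 0" using z(2) by simp
    finally have "L (\<lambda>x. f x + (- (K f / K z)) * z x) = 0" by (rule ker[OF S[OF f z(1)]])
    moreover have "L (\<lambda>x. f x + (- (K f / K z)) * z x) = L f + (- (K f / K z)) * L z" by (rule L[OF f z(1)])
    ultimately show ?thesis by simp
  qed
  then show ?thesis by (rule that)
qed

lemma prim2_continuous: "m \<in> L2 \<Longrightarrow> continuous_on A (prim2 m)"
proof -
  assume m: "m \<in> L2"
  have "prim2 m = (\<lambda>x. G m x - slope m * (x + pi))" using G_slope_prim2[OF m] by auto
  then show ?thesis by (simp add: G_continuous m continuous_intros)
qed

lemma prim2_uminus: "prim2 (\<lambda>x. - m x) x = - prim2 m x"
  by (simp add: prim2_def)

lemma prim2_mono:
  assumes "f \<in> L2" "g \<in> L2" "AE t in M. t < x \<longrightarrow> f t \<le> g t" shows "prim2 f x \<le> prim2 g x"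
  unfolding prim2_def
proof (rule integral_mono_AE)
  show "AE t in M. max 0 (x - t) * f t \<le> max 0 (x - t) * g t"
    using assms(3) by eventually_elim (auto simp: max_def intro: mult_left_mono)
qed (use L2_mult_integrable[OF ramp_L2] assms in auto)

text \<open>A form of Gronwall's inequality. At a maximum of \<open>f x * exp (- 2 D x)\<close> the hypothesis bounds the
  value of \<open>f\<close> by half of itself.\<close>

lemma gronwall:
  assumes f: "continuous_on UNIV f" "\<And>x. 0 \<le> f x" and C: "0 \<le> C"
    and le: "\<And>x. \<lbrakk>-pi \<le> x; x \<le> b\<rbrakk> \<Longrightarrow> f x \<le> C * prim f x"
    and b: "-pi \<le> b" "b \<le> pi" and x: "-pi \<le> x" "x \<le> b"
  shows "f x = 0"
proof -
  \<comment> \<open>The summand \<open>1\<close> excludes a zero rate.\<close>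
  define D where "D = C + 1"
  have D: "0 < D" "C \<le> D" using C by (auto simp: D_def)
  define w where "w x = f x * exp (- (2 * D * x))" for x
  have "continuous_on {-pi..b} w"
    unfolding w_def by (intro continuous_intros continuous_on_subset[OF f(1)]) auto
  then obtain z where z: "z \<in> {-pi..b}" "\<And>y. y \<in> {-pi..b} \<Longrightarrow> w y \<le> w z"
    using continuous_attains_sup[of "{-pi..b}" w] b by auto
  have fz: "f y \<le> w z * exp (2 * D * y)" if "y \<in> {-pi..b}" for y
  proof -
    have "f y = w y * exp (2 * D * y)" by (simp add: w_def mult.assoc exp_add[symmetric])
    also have "\<dots> \<le> w z * exp (2 * D * y)" using z(2)[OF that] by (intro mult_right_mono) auto
    finally show ?thesis .
  qed
  have fL: "integrable M f" by (rule integrable_M_continuous[OF f(1)])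
  have eL: "integrable M (\<lambda>y. w z * exp (2 * D * y))"
    by (intro integrable_M_continuous continuous_intros)
  have "prim f z \<le> (\<integral>y. indicator {-pi..z} y * (w z * exp (2 * D * y)) \<partial>M)"
    unfolding prim_def
  proof (rule integral_mono)
    show "indicator {..z} y * f y \<le> indicator {-pi..z} y * (w z * exp (2 * D * y))" if "y \<in> space M" for y
      using fz[of y] z(1) that by (auto simp: indicator_def I_def)
  qed (use fL eL in \<open>auto intro: indicator_mult_integrable\<close>)
  also have "\<dots> = w z * exp (2 * D * z) / (2 * D) - w z * exp (2 * D * (-pi)) / (2 * D)"
    using D z(1) b by (intro FTC_M[where F = "\<lambda>y. w z * exp (2 * D * y) / (2 * D)"])
      (auto intro!: derivative_eq_intros continuous_intros)
  also have "\<dots> \<le> f z / (2 * D)"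
  proof -
    have "w z * exp (2 * D * z) = f z" by (simp add: w_def mult.assoc exp_add[symmetric])
    moreover have "0 \<le> w z" using f(2) by (simp add: w_def)
    ultimately show ?thesis using D by simp
  qed
  finally have pz: "prim f z \<le> f z / (2 * D)" .
  have "0 \<le> prim f z" unfolding prim_def using f(2) by (intro Bochner_Integration.integral_nonneg) (auto simp: indicator_def)
  then have "C * prim f z \<le> D * prim f z" using D by (intro mult_right_mono) auto
  also have "\<dots> \<le> D * (f z / (2 * D))" using pz D by (intro mult_left_mono) auto
  also have "\<dots> = f z / 2" using D by simp
  finally have "f z \<le> f z / 2" using le[of z] z(1) by simp
  then have "w z = 0" using f(2)[of z] by (simp add: w_def)
  then have "w x \<le> 0" using z(2)[of x] x by simp
  then have "f x \<le> 0" by (simp add: w_def mult_le_0_iff)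
  then show ?thesis using f(2)[of x] by simp
qed

lemma prim_mono:
  assumes "continuous_on UNIV f" "\<And>x. 0 \<le> f x" "x \<le> y" shows "prim f x \<le> prim f y"
  unfolding prim_def
proof (rule integral_mono)
  show "indicator {..x} t * f t \<le> indicator {..y} t * f t" for t
    using assms(2)[of t] assms(3) by (auto simp: indicator_def)
qed (auto intro: indicator_mult_integrable integrable_M_continuous[OF assms(1)])

locale beam = piers +
  fixes p :: "real \<Rightarrow> real" and \<alpha> \<beta> :: real
  assumes \<alpha>: "0 < \<alpha>" and p: "p \<in> P \<alpha> \<beta>"
begin

lemma p_measurable: "p \<in> borel_measurable M" and p_bounds: "AE x in M. \<alpha> \<le> p x \<and> p x \<le> \<beta>"
  using p by (auto simp: P_def Linf_def)

lemma \<beta>_nonneg: "0 \<le> \<beta>"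
proof (rule ccontr)
  assume "\<not> 0 \<le> \<beta>"
  from p_bounds have "AE x in M. False" by eventually_elim (use \<alpha> \<open>\<not> 0 \<le> \<beta>\<close> in auto)
  then have "emeasure M (space M) = 0" by (simp add: AE_iff_measurable[OF _ refl])
  then show False by (simp add: measure_M_I)
qed

lemma p_L2: "f \<in> L2 \<Longrightarrow> (\<lambda>x. p x * f x) \<in> L2"
proof (rule L2_mult_Linf[OF p_measurable, of \<beta>])
  show "AE x in M. \<bar>p x\<bar> \<le> \<beta>" using p_bounds by eventually_elim (use \<alpha> in auto)
qed

lemma inner_p_ip2: "inner_p p u v = ip2 (\<lambda>x. p x * u x) v"
  by (simp add: inner_p_def ip2_def)

lemma inner_p_bounds:
  assumes "f \<in> L2" shows "\<alpha> * ip2 f f \<le> inner_p p f f" "inner_p p f f \<le> \<beta> * ip2 f f"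
proof -
  have i: "integrable M (\<lambda>x. p x * f x * f x)" by (rule L2_mult_integrable[OF p_L2[OF assms] assms])
  have k: "integrable M (\<lambda>x. c * (f x * f x))" for c using L2_mult_integrable[OF assms assms] by simp
  have "AE x in M. \<alpha> * (f x * f x) \<le> p x * f x * f x"
    using p_bounds by eventually_elim (simp add: mult.assoc mult_right_mono)
  then have "(\<integral>x. \<alpha> * (f x * f x) \<partial>M) \<le> (\<integral>x. p x * f x * f x \<partial>M)"
    by (rule integral_mono_AE[OF k i])
  then show "\<alpha> * ip2 f f \<le> inner_p p f f" by (simp add: inner_p_def ip2_def)
  have "AE x in M. p x * f x * f x \<le> \<beta> * (f x * f x)"
    using p_bounds by eventually_elim (simp add: mult.assoc mult_right_mono)
  then have "(\<integral>x. p x * f x * f x \<partial>M) \<le> (\<integral>x. \<beta> * (f x * f x) \<partial>M)"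
    by (rule integral_mono_AE[OF i k])
  then show "inner_p p f f \<le> \<beta> * ip2 f f" by (simp add: inner_p_def ip2_def)
qed

lemma form_inner_p: assumes "X \<subseteq> L2" "(\<lambda>x. 0) \<in> X" "\<And>f g c. \<lbrakk>f \<in> X; g \<in> X\<rbrakk> \<Longrightarrow> (\<lambda>x. f x + c * g x) \<in> X"
  shows "form_space X (inner_p p)"
proof
  show "inner_p p (\<lambda>x. f x + c * g x) h = inner_p p f h + c * inner_p p g h" if "f \<in> X" "g \<in> X" "h \<in> X" for f g h c
  proof -
    have "inner_p p (\<lambda>x. f x + c * g x) h = ip2 (\<lambda>x. p x * f x + c * (p x * g x)) h"
      by (simp add: inner_p_ip2 algebra_simps)
    then show ?thesis using L2.ip_comb[OF p_L2 p_L2, of f g h c] that assms(1) by (auto simp: inner_p_ip2)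
  qed
  show "0 \<le> inner_p p f f" if "f \<in> X" for f
  proof -
    have "f \<in> L2" using that assms(1) by blast
    then have "0 \<le> \<alpha> * ip2 f f" "\<alpha> * ip2 f f \<le> inner_p p f f"
      using L2.ip_nonneg[of f] inner_p_bounds(1)[of f] \<alpha> by auto
    then show ?thesis by linarith
  qed
qed (use assms in \<open>auto simp: inner_p_def mult_ac\<close>)

sublocale V: compact_pair "V a" inner_V "inner_p p" "\<beta> * (64 * pi ^ 4)"
proof -
  interpret B: form_space "V a" "inner_p p"
    by (rule form_inner_p) (auto simp: V_D(1) V.zero_mem intro: V_comb)
  show "compact_pair (V a) inner_V (inner_p p) (\<beta> * (64 * pi ^ 4))"
  proof
    fix f assume f: "f \<in> V a"
    have "inner_p p f f \<le> \<beta> * ip2 f f" by (rule inner_p_bounds(2)[OF V_D(1)[OF f]])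
    also have "\<dots> \<le> \<beta> * (64 * pi ^ 4 * inner_V f f)" by (intro mult_left_mono V_ip2_bound f \<beta>_nonneg)
    finally show "inner_p p f f \<le> \<beta> * (64 * pi ^ 4) * inner_V f f" by simp
    show "inner_V f f = 0" if "inner_p p f f = 0"
    proof -
      have "\<alpha> * ip2 f f \<le> 0" using inner_p_bounds(1)[OF V_D(1)[OF f]] that by simp
      then have "ip2 f f \<le> 0" using \<alpha> by (simp add: mult_le_0_iff)
      then have "ip2 f f = 0" using L2.ip_nonneg[OF V_D(1)[OF f]] by simp
      then show ?thesis using V_null_iff[OF f] ip2_zero_iff[OF V_D(1)[OF f]] by simp
    qed
  next
    fix u :: "nat \<Rightarrow> real \<Rightarrow> real" and C
    assume u: "\<And>n. u n \<in> V a" and C: "\<And>n. inner_V (u n) (u n) \<le> C"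
    obtain r where r: "strict_mono (r :: nat \<Rightarrow> nat)"
      and cauchy: "\<And>\<epsilon>. 0 < \<epsilon> \<Longrightarrow> \<exists>N. \<forall>m\<ge>N. \<forall>n\<ge>N. ip2 (\<lambda>x. u (r m) x - u (r n) x) (\<lambda>x. u (r m) x - u (r n) x) < \<epsilon>"
      by (rule V_ip2_compact[OF u C]) (rule that)
    have "\<exists>N. \<forall>m\<ge>N. \<forall>n\<ge>N. inner_p p (\<lambda>x. u (r m) x - u (r n) x) (\<lambda>x. u (r m) x - u (r n) x) < \<epsilon>" if \<epsilon>: "0 < \<epsilon>" for \<epsilon>
    proof -
      obtain N where N: "\<And>m n. m \<ge> N \<Longrightarrow> n \<ge> N \<Longrightarrow> ip2 (\<lambda>x. u (r m) x - u (r n) x) (\<lambda>x. u (r m) x - u (r n) x) < \<epsilon> / (\<beta> + 1)"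
        using cauchy[of "\<epsilon> / (\<beta> + 1)"] \<epsilon> \<beta>_nonneg by auto
      have "inner_p p (\<lambda>x. u (r m) x - u (r n) x) (\<lambda>x. u (r m) x - u (r n) x) < \<epsilon>" if "m \<ge> N" "n \<ge> N" for m n
      proof -
        let ?d = "\<lambda>x. u (r m) x - u (r n) x"
        have dL: "?d \<in> L2" by (intro L2.diff_mem V_D(1) u)
        have "inner_p p ?d ?d \<le> \<beta> * ip2 ?d ?d" by (rule inner_p_bounds(2)[OF dL])
        also have "\<dots> \<le> (\<beta> + 1) * ip2 ?d ?d" using L2.ip_nonneg[OF dL] by (intro mult_right_mono) auto
        also have "\<dots> < \<epsilon>" using N[OF that] \<beta>_nonneg by (simp add: field_simps)
        finally show ?thesis .
      qed
      then show ?thesis by blast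
    qed
    then show "\<exists>r::nat \<Rightarrow> nat. strict_mono r \<and> (\<forall>\<epsilon>>0. \<exists>N. \<forall>m\<ge>N. \<forall>n\<ge>N.
        inner_p p (\<lambda>x. u (r m) x - u (r n) x) (\<lambda>x. u (r m) x - u (r n) x) < \<epsilon>)"
      using r by (intro exI[of _ r] conjI allI impI)
  qed
qed

lemma eigenfunction_iff: "eigenfunction a p \<mu> e \<longleftrightarrow> V.eig \<mu> e"
  unfolding eigenfunction_def weak_solution_def V.eig_def using V_null_iff by blast

text \<open>For \<open>n\<close> in \<open>L2\<close> such that \<open>G n\<close> vanishes at the piers, the weak equation with \<open>v = G n\<close> and the symmetry of
  \<open>G\<close> say that \<open>n\<close> is orthogonal to \<open>m - G q\<close>, where \<open>q\<close> is the load. The two constraints are the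
  products of \<open>n\<close> with the Green functions of the piers, so \<open>m - G q\<close> is a combination of these two.
  Here all affine parts are collected in one multiple of \<open>t + \<pi>\<close>, which is where \<open>e'' (-\<pi>) = 0\<close> is
  encoded, and each pier adds a ramp that starts there.\<close>

lemma solution_shape:
  assumes e: "weak_solution a p \<mu> e"
  defines "m \<equiv> wderiv 2 e"
  obtains \<kappa>0 \<kappa>1 \<kappa>2 where "AE t in M. m t = prim2 (\<lambda>x. \<mu> * (p x * G m x)) t +
    \<kappa>0 * max 0 (t - - pi) + \<kappa>1 * max 0 (t - - a * pi) + \<kappa>2 * max 0 (t - a * pi)"
proof -
  have eV: "e \<in> V a" and weak: "\<And>v. v \<in> V a \<Longrightarrow> inner_V e v = \<mu> * inner_p p e v"
    using e by (auto simp: weak_solution_def)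
  note E = V_D[OF eV, folded m_def]
  define q where "q = (\<lambda>x. \<mu> * (p x * G m x))"
  have q: "q \<in> L2" unfolding q_def by (intro L2.scale_mem p_L2 G_L2 E)
  define h where "h = (\<lambda>t. m t - G q t)"
  have h: "h \<in> L2" unfolding h_def by (intro L2.diff_mem E G_L2 q)
  let ?g1 = "green (- a * pi)" and ?g2 = "green (a * pi)"
  have ker: "ip2 n h = 0" if n: "n \<in> L2" "G n (- a * pi) = 0" "G n (a * pi) = 0" for n
  proof -
    note N = G_in_V[OF n(1,3,2)]
    have "ip2 m n = inner_V e (G n)"
      unfolding inner_V_ip2 m_def using N(2)
      by (intro ip2_cong_AE L2_D n V_D(2) eV N(1)) auto
    also have "\<dots> = \<mu> * ip2 (\<lambda>x. p x * e x) (G n)" unfolding weak[OF N(1)] inner_p_ip2 ..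
    also have "\<dots> = \<mu> * ip2 (\<lambda>x. p x * G m x) (G n)"
      using E(3) by (intro arg_cong2[where f = "(*)"] refl ip2_cong_AE L2_D p_L2 G_L2 E n) auto
    also have "\<dots> = ip2 q (G n)" unfolding q_def
      by (rule L2.ip_scale[symmetric]) (intro p_L2 G_L2 E n)+
    also have "\<dots> = ip2 (G q) n" using G_symmetric[OF q n(1)] by simp
    finally show ?thesis
      unfolding h_def L2.ip_diff_right[OF E(2) G_L2[OF q] n(1)]
      by (simp add: L2.ip_sym[OF n(1)] E(2) G_L2 q)
  qed
  have lin: "ip2 (\<lambda>x. f x + c * g x) k = ip2 f k + c * ip2 g k" if "f \<in> L2" "g \<in> L2" "k \<in> L2" for f g k c
    by (rule L2.ip_comb[OF that])
  \<comment> \<open>Two constraints, hence two multipliers.\<close>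
  let ?S = "{n \<in> L2. G n (- a * pi) = 0}"
  obtain \<kappa>2 where \<kappa>2: "\<And>n. n \<in> ?S \<Longrightarrow> ip2 n h = \<kappa>2 * ip2 n ?g2"
  proof (rule linear_functional_factor[of ?S "\<lambda>n. ip2 n h" "\<lambda>n. ip2 n ?g2"])
    show "ip2 n h = 0" if "n \<in> ?S" "ip2 n ?g2 = 0" for n
      using that by (intro ker) (auto simp: G_ip2 L2.ip_sym[OF green_L2])
  qed (auto simp: G_comb lin h green_L2 intro: L2_comb)
  obtain \<kappa>1 where \<kappa>1: "\<And>n. n \<in> L2 \<Longrightarrow> ip2 n h - \<kappa>2 * ip2 n ?g2 = \<kappa>1 * ip2 n ?g1"
  proof (rule linear_functional_factor[of L2 "\<lambda>n. ip2 n h - \<kappa>2 * ip2 n ?g2" "\<lambda>n. ip2 n ?g1"])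
    show "ip2 n h - \<kappa>2 * ip2 n ?g2 = 0" if "n \<in> L2" "ip2 n ?g1 = 0" for n
      using that \<kappa>2[of n] by (auto simp: G_ip2 L2.ip_sym[OF green_L2])
  qed (auto simp: lin h green_L2 algebra_simps intro: L2_comb)
  define r where "r = (\<lambda>t. (h t - \<kappa>2 * ?g2 t) - \<kappa>1 * ?g1 t)"
  have r: "r \<in> L2" unfolding r_def by (intro L2.diff_mem L2.scale_mem h green_L2)
  have "ip2 r r = 0"
  proof -
    have "ip2 r r = ip2 r h - \<kappa>2 * ip2 r ?g2 - \<kappa>1 * ip2 r ?g1"
      by (subst (2) r_def)
        (simp add: L2.ip_diff_right L2.diff_mem L2.scale_mem h green_L2 r L2.ip_sym[OF r L2.scale_mem] L2.ip_scale L2.ip_sym[OF green_L2 r])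
    then show ?thesis using \<kappa>1[OF r] by simp
  qed
  then have r0: "AE t in M. r t = 0" using ip2_zero_iff[OF r] by simp
  define \<kappa>0 where "\<kappa>0 = slope q - \<kappa>1 * ((pi + a * pi) / (2 * pi)) - \<kappa>2 * ((pi - a * pi) / (2 * pi))"
  have "m t = prim2 q t + \<kappa>0 * max 0 (t - - pi) + \<kappa>1 * max 0 (t - - a * pi) + \<kappa>2 * max 0 (t - a * pi)"
    if "r t = 0" "t \<in> I" for t
  proof -
    have g: "green x t = max 0 (t - x) - (t + pi) * ((pi - x) / (2 * pi))" for x
      by (simp add: green_sym[of x t]) (simp add: green_def)
    have pos: "max 0 (t - - pi) = t + pi" using that(2) by (simp add: I_def)
    have "m t = prim2 q t + slope q * (t + pi) + \<kappa>2 * ?g2 t + \<kappa>1 * ?g1 t"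
      using that(1) G_slope_prim2[OF q, of t] by (simp add: r_def h_def)
    then show ?thesis unfolding g pos \<kappa>0_def by (simp add: algebra_simps)
  qed
  then have "AE t in M. m t = prim2 q t + \<kappa>0 * max 0 (t - - pi) + \<kappa>1 * max 0 (t - - a * pi) + \<kappa>2 * max 0 (t - a * pi)"
    using r0 AE_M_I[of "\<lambda>t. t \<in> I"] by (auto elim!: AE_mp)
  then show ?thesis unfolding q_def by (rule that)
qed

end

section \<open>Simplicity of the eigenvalues\<close>

context beam
begin

lemma load_L2: "m \<in> L2 \<Longrightarrow> (\<lambda>x. \<mu> * (p x * prim2 m x)) \<in> L2"
  by (rule L2.scale_mem[OF p_L2[OF L2_continuous[OF prim2_continuous]]])

lemma ramp_product_pos:
  assumes "-pi \<le> x0" "x0 < x1" "x1 \<le> pi"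
  shows "0 < prim2 (\<lambda>t. max 0 (t - x0)) x1"
proof -
  let ?f = "\<lambda>t. max 0 (x1 - t) * max 0 (t - x0)"
  have c: "continuous_on UNIV ?f" by (intro continuous_intros)
  have nn: "0 \<le> prim2 (\<lambda>t. max 0 (t - x0)) x1"
    unfolding prim2_def by (intro Bochner_Integration.integral_nonneg) auto
  moreover have "prim2 (\<lambda>t. max 0 (t - x0)) x1 \<noteq> 0"
  proof
    assume "prim2 (\<lambda>t. max 0 (t - x0)) x1 = 0"
    then have "AE t in M. ?f t = 0"
      unfolding prim2_def by (subst (asm) integral_nonneg_eq_0_iff_AE) (auto intro: integrable_M_continuous[OF c])
    moreover have "(x0 + x1) / 2 \<in> I" using assms by (auto simp: I_def field_simps)
    ultimately have "?f ((x0 + x1) / 2) = 0"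
      using continuous_AE_eq[of ?f "\<lambda>_. 0" "(x0 + x1) / 2"] continuous_on_subset[OF c] by auto
    moreover have "0 < x1 - (x0 + x1) / 2" "0 < (x0 + x1) / 2 - x0" using assms by (auto simp: field_simps)
    ultimately show False by simp
  qed
  ultimately show ?thesis by linarith
qed

text \<open>The function \<open>E = prim2 m\<close> solves \<open>E'' = m\<close> and starts with \<open>E = E' = 0\<close> at \<open>-\<pi>\<close>, and to the left of \<open>x1\<close> the function \<open>m\<close> is the twofold
  primitive of the load plus \<open>c\<close> times a ramp. For \<open>c \<ge> 0\<close> the load is the only possible source of
  negative values of \<open>E\<close>, and it is negative only where \<open>E\<close> is. This closes a Gronwall inequality for the
  negative part of \<open>E\<close>, so \<open>E \<ge> 0\<close>; then \<open>E\<close> is at least \<open>c\<close> times a function that is positive at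
  \<open>x1\<close>, and \<open>E x1 = 0\<close> forces \<open>c = 0\<close>.\<close>

lemma segment_sign:
  assumes m: "m \<in> L2" and \<mu>: "0 \<le> \<mu>" and c: "0 \<le> c"
    and x: "-pi \<le> x0" "x0 < x1" "x1 \<le> pi"
    and shape: "AE t in M. t < x1 \<longrightarrow> m t = prim2 (\<lambda>x. \<mu> * (p x * prim2 m x)) t + c * max 0 (t - x0)"
    and zero: "prim2 m x1 = 0"
  shows "c = 0" "\<And>x. \<lbrakk>-pi \<le> x; x \<le> x1\<rbrakk> \<Longrightarrow> 0 \<le> prim2 m x"
proof -
  define q where "q = (\<lambda>x. \<mu> * (p x * prim2 m x))"
  have q: "q \<in> L2" unfolding q_def by (rule load_L2[OF m])
  define f where "f x = max 0 (- prim2 m x)" for x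
  have fc: "continuous_on A f" for A unfolding f_def by (intro continuous_intros prim2_continuous m)
  have f0: "0 \<le> f x" for x by (simp add: f_def)
  have fL: "f \<in> L2" by (rule L2_continuous[OF fc])
  define C1 where "C1 = \<mu> * \<beta> * (2 * pi)"
  have C1: "0 \<le> C1" using \<mu> \<beta>_nonneg by (simp add: C1_def)
  have pc: "(\<lambda>t. c' * prim f t) \<in> L2" for c' by (intro L2.scale_mem prim_L2 fL)
  have prim2_q: "- C1 * prim f t \<le> prim2 q t" if "t \<in> I" for t
  proof -
    have "- C1 * prim f t = (\<integral>y. (- C1) * (indicator {..t} y * f y) \<partial>M)" by (simp add: prim_def)
    also have "\<dots> \<le> prim2 q t"
      unfolding prim2_def
    proof (rule integral_mono_AE)
      show "integrable M (\<lambda>y. (- C1) * (indicator {..t} y * f y))"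
        using indicator_mult_integrable[OF _ L2_integrable[OF fL], of "{..t}"] by simp
      show "integrable M (\<lambda>y. max 0 (t - y) * q y)" by (rule L2_mult_integrable[OF ramp_L2 q])
      have "AE y in M. y \<in> I" by (rule AE_M_I)
      with p_bounds show "AE y in M. (- C1) * (indicator {..t} y * f y) \<le> max 0 (t - y) * q y"
      proof eventually_elim
        case (elim y)
        show ?case
        proof (cases "y \<le> t")
          case True
          have ty: "0 \<le> t - y" "t - y \<le> 2 * pi" using True that elim(2) by (auto simp: I_def)
          have "- q y \<le> \<mu> * \<beta> * f y"
          proof -
            have "- prim2 m y \<le> f y" by (simp add: f_def)
            then have "p y * (- prim2 m y) \<le> p y * f y" using elim(1) \<alpha> by (intro mult_left_mono) auto
            also have "\<dots> \<le> \<beta> * f y" using elim(1) f0 by (intro mult_right_mono) auto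
            finally have "\<mu> * (p y * (- prim2 m y)) \<le> \<mu> * (\<beta> * f y)" using \<mu> by (rule mult_left_mono)
            then show ?thesis by (simp add: q_def)
          qed
          then have "(t - y) * (- q y) \<le> (t - y) * (\<mu> * \<beta> * f y)" using ty by (intro mult_left_mono)
          also have "\<dots> \<le> (2 * pi) * (\<mu> * \<beta> * f y)"
            using ty f0 \<mu> \<beta>_nonneg by (intro mult_right_mono) auto
          finally show ?thesis using True ty by (simp add: C1_def mult_ac)
        next
          case False then show ?thesis by simp
        qed
      qed
    qed
    finally show ?thesis .
  qed
  \<comment> \<open>Integrating the bound \<open>prim2_q\<close> twice gives a Gronwall inequality for \<open>f\<close>; the constant
    absorbs the twofold integral of \<open>1\<close>.\<close>
  define C where "C = C1 * prim2 (\<lambda>_. 1) pi"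
  have one: "(\<lambda>_. 1) \<in> L2" by (rule L2_continuous) simp
  have J1: "0 \<le> prim2 (\<lambda>_. 1) y" for y unfolding prim2_def by (intro Bochner_Integration.integral_nonneg) auto
  have le: "f y \<le> C * prim f y" if y: "-pi \<le> y" "y \<le> x1" for y
  proof -
    have pf: "0 \<le> prim f y" unfolding prim_def using f0 by (intro Bochner_Integration.integral_nonneg) auto
    have "(- C1 * prim f y) * prim2 (\<lambda>_. 1) y = prim2 (\<lambda>_. - C1 * prim f y) y" by (simp add: prim2_def mult.commute)
    also have "\<dots> \<le> prim2 m y"
    proof (rule prim2_mono[OF _ m])
      show "(\<lambda>_. - C1 * prim f y) \<in> L2" by (rule L2_continuous) simp
      have "AE t in M. t \<in> I" by (rule AE_M_I)
      with shape show "AE t in M. t < y \<longrightarrow> - C1 * prim f y \<le> m t"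
      proof eventually_elim
        case (elim t)
        show ?case
        proof
          assume "t < y"
          then have "m t = prim2 q t + c * max 0 (t - x0)" using elim(1) y by (simp add: q_def)
          moreover have "0 \<le> c * max 0 (t - x0)" using c by simp
          moreover have "- C1 * prim f t \<le> prim2 q t" by (rule prim2_q[OF elim(2)])
          moreover have "C1 * prim f t \<le> C1 * prim f y"
            using prim_mono[OF fc f0, of t y] \<open>t < y\<close> C1 by (intro mult_left_mono) auto
          ultimately show "- C1 * prim f y \<le> m t" by linarith
        qed
      qed
    qed
    finally have "- prim2 m y \<le> C1 * prim f y * prim2 (\<lambda>_. 1) y" by simp
    also have "\<dots> \<le> C1 * prim f y * prim2 (\<lambda>_. 1) pi"
    proof (rule mult_left_mono)
      show "prim2 (\<lambda>_. 1) y \<le> prim2 (\<lambda>_. 1) pi"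
        unfolding prim2_def using L2_integrable[OF ramp_L2] y x by (intro integral_mono) auto
    qed (use C1 pf in simp)
    finally have "- prim2 m y \<le> C * prim f y" by (simp add: C_def mult_ac)
    moreover have "0 \<le> C * prim f y" using C1 J1 pf by (simp add: C_def)
    ultimately show ?thesis by (simp add: f_def)
  qed
  have fz: "f y = 0" if "-pi \<le> y" "y \<le> x1" for y
  proof (rule gronwall[OF fc f0 _ le])
    show "0 \<le> C" using C1 J1 by (simp add: C_def)
  qed (use that x in auto)
  then show pos: "0 \<le> prim2 m y" if "-pi \<le> y" "y \<le> x1" for y
    using fz[OF that] by (simp add: f_def max_def split: if_splits)
  have load_nonneg: "0 \<le> prim2 q t" if "t \<in> I" "t \<le> x1" for t
  proof -
    have "prim2 (\<lambda>_. 0) t \<le> prim2 q t"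
    proof (rule prim2_mono[OF _ q])
      show "(\<lambda>_. 0) \<in> L2" by (rule L2.zero_mem)
      have "AE y in M. y \<in> I" by (rule AE_M_I)
      with p_bounds show "AE y in M. y < t \<longrightarrow> 0 \<le> q y"
      proof eventually_elim
        case (elim y)
        then show ?case using pos[of y] that(2) \<mu> \<alpha> by (auto simp: q_def I_def)
      qed
    qed
    then show ?thesis by (simp add: prim2_def)
  qed
  have "AE t in M. t \<in> I" by (rule AE_M_I)
  with shape have "AE t in M. t < x1 \<longrightarrow> c * max 0 (t - x0) \<le> m t"
  proof eventually_elim
    case (elim t)
    then show ?case using load_nonneg[of t] by (simp add: q_def)
  qed
  then have "prim2 (\<lambda>t. c * max 0 (t - x0)) x1 \<le> prim2 m x1"
    by (intro prim2_mono m L2_continuous continuous_intros)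
  moreover have "prim2 (\<lambda>t. c * max 0 (t - x0)) x1 = c * prim2 (\<lambda>t. max 0 (t - x0)) x1"
  proof -
    have "(\<lambda>t. max 0 (x1 - t) * (c * max 0 (t - x0))) = (\<lambda>t. c * (max 0 (x1 - t) * max 0 (t - x0)))"
      by (simp add: mult_ac)
    then show ?thesis by (simp add: prim2_def)
  qed
  ultimately have "c * prim2 (\<lambda>t. max 0 (t - x0)) x1 \<le> 0" using zero by simp
  then show "c = 0" using ramp_product_pos[OF x] c by (auto simp: mult_le_0_iff)
qed

text \<open>The sign argument applies to \<open>m\<close> or to \<open>- m\<close> and gives \<open>c = 0\<close>; after that it applies to both.\<close>

lemma segment_zero:
  assumes m: "m \<in> L2" and \<mu>: "0 \<le> \<mu>"
    and x: "-pi \<le> x0" "x0 < x1" "x1 \<le> pi"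
    and shape: "AE t in M. t < x1 \<longrightarrow> m t = prim2 (\<lambda>x. \<mu> * (p x * prim2 m x)) t + c * max 0 (t - x0)"
    and zero: "prim2 m x1 = 0"
  shows "c = 0" "\<And>x. \<lbrakk>-pi \<le> x; x \<le> x1\<rbrakk> \<Longrightarrow> prim2 m x = 0"
proof -
  let ?n = "\<lambda>x. - m x"
  have n: "?n \<in> L2" using L2.scale_mem[OF m, of "-1"] by simp
  have nshape: "AE t in M. t < x1 \<longrightarrow> ?n t = prim2 (\<lambda>x. \<mu> * (p x * prim2 ?n x)) t + (- c) * max 0 (t - x0)"
    using shape by eventually_elim (simp add: prim2_uminus)
  have nzero: "prim2 ?n x1 = 0" using zero by (simp add: prim2_uminus)
  show c: "c = 0"
  proof (cases "0 \<le> c")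
    case True then show ?thesis by (rule segment_sign(1)[OF m \<mu> _ x shape zero])
  next
    case False
    then have "- c = 0" by (intro segment_sign(1)[OF n \<mu> _ x nshape nzero]) simp
    then show ?thesis by simp
  qed
  fix y assume y: "-pi \<le> y" "y \<le> x1"
  have "0 \<le> prim2 m y" by (rule segment_sign(2)[OF m \<mu> _ x shape zero y]) (simp add: c)
  moreover have "0 \<le> prim2 ?n y" by (rule segment_sign(2)[OF n \<mu> _ x nshape nzero y]) (simp add: c)
  ultimately show "prim2 m y = 0" by (simp add: prim2_uminus)
qed

text \<open>The three ramp coefficients vanish one after another: to the left of a pier the ramps that start at
  this pier and beyond it are zero, so the solution up to there has a single unknown coefficient.\<close>

lemma solution_slope_zero:
  assumes e: "weak_solution a p \<mu> e" and \<mu>: "0 \<le> \<mu>" and s: "slope (wderiv 2 e) = 0"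
  shows "AE x in M. e x = 0"
proof -
  define m where "m = wderiv 2 e"
  have eV: "e \<in> V a" using e by (simp add: weak_solution_def)
  note E = V_D[OF eV, folded m_def]
  have GJ: "G m = prim2 m" using G_slope_prim2[OF E(2)] s by (auto simp: m_def)
  note E' = E[unfolded GJ]
  obtain \<kappa>0 \<kappa>1 \<kappa>2 where shape: "AE t in M. m t = prim2 (\<lambda>x. \<mu> * (p x * prim2 m x)) t +
    \<kappa>0 * max 0 (t - - pi) + \<kappa>1 * max 0 (t - - a * pi) + \<kappa>2 * max 0 (t - a * pi)"
    using solution_shape[OF e] unfolding m_def[symmetric] GJ by blast
  have api: "0 < a * pi" "a * pi < pi" using pier_I(1) a unfolding I_def greaterThanLessThan_iff by auto
  have ord: "-pi < - a * pi" "- a * pi \<le> pi" "-pi \<le> - a * pi" "- a * pi < a * pi" "a * pi \<le> pi" "-pi \<le> a * pi"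
    using api by linarith+
  have shape0: "AE t in M. t < - a * pi \<longrightarrow> m t = prim2 (\<lambda>x. \<mu> * (p x * prim2 m x)) t + \<kappa>0 * max 0 (t - - pi)"
    using shape by eventually_elim (use api in auto)
  have \<kappa>0: "\<kappa>0 = 0"
    by (rule segment_zero(1)[OF E(2) \<mu> order_refl ord(1,2) shape0 E'(5)])
  have shape1: "AE t in M. t < a * pi \<longrightarrow> m t = prim2 (\<lambda>x. \<mu> * (p x * prim2 m x)) t + \<kappa>1 * max 0 (t - - a * pi)"
    using shape by eventually_elim (use api \<kappa>0 in auto)
  have \<kappa>1: "\<kappa>1 = 0"
    by (rule segment_zero(1)[OF E(2) \<mu> ord(3,4,5) shape1 E'(4)])
  have shape2: "AE t in M. t < pi \<longrightarrow> m t = prim2 (\<lambda>x. \<mu> * (p x * prim2 m x)) t + \<kappa>2 * max 0 (t - a * pi)"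
    using shape by eventually_elim (use \<kappa>0 \<kappa>1 in auto)
  have "prim2 m pi = 0" using G_right[of m] unfolding GJ .
  note J0 = segment_zero(2)[OF E(2) \<mu> ord(6) api(2) order_refl shape2 this]
  have "AE x in M. prim2 m x = 0" using J0 by (intro AE_M_I) (auto simp: I_def)
  with E'(3) show ?thesis by eventually_elim simp
qed

lemma weak_solution_comb:
  assumes u: "weak_solution a p \<mu> u" and v: "weak_solution a p \<mu> v"
  shows "weak_solution a p \<mu> (\<lambda>x. u x + c * v x)"
  using assms V_comb(1) unfolding weak_solution_def
  by (auto simp: inner_V_comb V.B.ip_comb algebra_simps)

lemma slope_cong_AE: "\<lbrakk>m \<in> L2; n \<in> L2; AE x in M. m x = n x\<rbrakk> \<Longrightarrow> slope m = slope n"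
  using ip2_cong_AE[of "\<lambda>t. pi - t" "\<lambda>t. pi - t" m n] L2_D(1)[OF affine_L2] L2_D(1)
  by (simp add: slope_def ip2_def)

lemma slope_comb: "\<lbrakk>m \<in> L2; n \<in> L2\<rbrakk> \<Longrightarrow> slope (\<lambda>x. m x + c * n x) = slope m + c * slope n"
  using L2.ip_comb_right[OF _ _ affine_L2, of m n c]
  by (simp add: slope_def ip2_def diff_divide_distrib)

text \<open>The difference \<open>d\<close> of \<open>u\<close> and a multiple of \<open>e\<close> can be given slope zero.\<close>

lemma weak_solutions_proportional:
  assumes e: "eigenfunction a p \<mu> e" and u: "weak_solution a p \<mu> u"
  shows "\<exists>c. AE x in M. u x = c * e x"
proof -
  have eW: "weak_solution a p \<mu> e" and ne: "\<not> (AE x in M. e x = 0)"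
    using e by (auto simp: eigenfunction_def)
  have \<mu>: "0 \<le> \<mu>" using V.eigD(4) e eigenfunction_iff by (auto intro: less_imp_le)
  have eV: "e \<in> V a" and uV: "u \<in> V a" using eW u by (auto simp: weak_solution_def)
  have s: "slope (wderiv 2 e) \<noteq> 0" using solution_slope_zero[OF eW \<mu>] ne by blast
  define c where "c = slope (wderiv 2 u) / slope (wderiv 2 e)"
  define d where "d = (\<lambda>x. u x + (- c) * e x)"
  have d: "weak_solution a p \<mu> d" unfolding d_def by (rule weak_solution_comb[OF u eW])
  have dV: "d \<in> V a" using d by (simp add: weak_solution_def)
  have "slope (wderiv 2 d) = slope (\<lambda>x. wderiv 2 u x + (- c) * wderiv 2 e x)"
    by (rule slope_cong_AE[OF V_D(2)[OF dV] L2_comb[OF V_D(2)[OF uV] V_D(2)[OF eV]]])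
       (unfold d_def, rule V_comb(2)[OF uV eV])
  also have "\<dots> = 0" using s by (simp only: slope_comb[OF V_D(2)[OF uV] V_D(2)[OF eV]]) (simp add: c_def)
  finally have "AE x in M. d x = 0" by (rule solution_slope_zero[OF d \<mu>])
  then have "AE x in M. u x = c * e x" by eventually_elim (simp add: d_def)
  then show ?thesis by blast
qed

section \<open>Completeness of the eigenfunctions\<close>

lemma eig_proportional:
  assumes e: "eigenfunction a p \<mu> e" and u: "eigenfunction a p \<mu> u"
  shows "\<exists>c. inner_V (\<lambda>x. u x - c * e x) (\<lambda>x. u x - c * e x) = 0"
proof -
  obtain c where c: "AE x in M. u x = c * e x"
    using weak_solutions_proportional[OF e] u by (auto simp: eigenfunction_def)
  have "u \<in> V a" "e \<in> V a" using e u by (auto simp: eigenfunction_def weak_solution_def)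
  then have "(\<lambda>x. u x - c * e x) \<in> V a" by (intro V.diff_mem V.scale_mem)
  moreover have "AE x in M. u x - c * e x = 0" using c by eventually_elim simp
  ultimately show ?thesis using V_null_iff by blast
qed

lemma eigenvalue_iff: "eigenvalue a p \<mu> \<longleftrightarrow> (\<exists>e. V.eig \<mu> e)"
  by (simp add: eigenvalue_def eigenfunction_iff)

lemma finite_eigenvalue_set_le: "finite {\<mu> \<in> {\<mu>. eigenvalue a p \<mu>}. \<mu> \<le> R}"
  using V.finite_eigenvalues_le[of R] by (simp add: eigenvalue_iff)

lemma infinite_eigenvalue_set: "infinite {\<mu>. eigenvalue a p \<mu>}"
proof -
  obtain \<phi> :: "nat \<Rightarrow> real \<Rightarrow> real" where \<phi>: "\<And>n. \<phi> n \<in> V a" "\<And>n. inner_V (\<phi> n) (\<phi> n) \<noteq> 0"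
    "\<And>m n x. m \<noteq> n \<Longrightarrow> \<phi> m x * \<phi> n x = 0"
    by (rule V_disjoint_sequence) (rule that)
  have "infinite {\<mu>. \<exists>e. V.eig \<mu> e}"
  proof (rule V.infinite_eigenvalues[OF _ \<phi>(1,2)])
    show "\<exists>c. inner_V (\<lambda>x. h x - c * e x) (\<lambda>x. h x - c * e x) = 0" if "V.eig \<mu> e" "V.eig \<mu> h" for \<mu> e h
      using eig_proportional that by (simp add: eigenfunction_iff)
    show "inner_p p (\<phi> m) (\<phi> n) = 0" if "m \<noteq> n" for m n
    proof -
      have "p x * \<phi> m x * \<phi> n x = 0" for x using \<phi>(3)[OF that, of x] by simp
      then have "inner_p p (\<phi> m) (\<phi> n) = (\<integral>x. 0 \<partial>M)" unfolding inner_p_def by presburger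
      then show ?thesis by simp
    qed
  qed
  then show ?thesis by (simp add: eigenvalue_iff)
qed

context
  fixes idx :: "'j set" and e :: "'j \<Rightarrow> real \<Rightarrow> real" and \<Lambda> :: "'j \<Rightarrow> real"
  assumes \<Lambda>: "{\<mu>. eigenvalue a p \<mu>} = \<Lambda> ` idx" and e: "\<And>j. j \<in> idx \<Longrightarrow> eigenfunction a p (\<Lambda> j) (e j)"
begin

lemma e_V: "j \<in> idx \<Longrightarrow> e j \<in> V a"
  using e by (auto simp: eigenfunction_def weak_solution_def)

lemma eigenfunctions_total:
  assumes f: "f \<in> V a" "\<And>j. j \<in> idx \<Longrightarrow> inner_V f (e j) = 0"
  shows "inner_V f f = 0"
proof (rule V.eig_family_total[OF e_V _ f])
  fix \<mu> h assume h: "V.eig \<mu> h"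
  then have "\<mu> \<in> \<Lambda> ` idx" using \<Lambda> eigenvalue_iff by blast
  then obtain j where "j \<in> idx" "\<mu> = \<Lambda> j" by blast
  then show "\<exists>j\<in>idx. \<exists>c. inner_V (\<lambda>x. h x - c * e j x) (\<lambda>x. h x - c * e j x) = 0"
    using eig_proportional[OF e, of j h] h by (auto simp: eigenfunction_iff)
qed

lemma complete_in_V: "complete_system (V a) inner_V idx e"
  unfolding complete_system_def Let_def
proof (intro conjI ballI allI impI)
  show "e j \<in> V a" if "j \<in> idx" for j using that by (rule e_V)
  fix f \<epsilon> assume f: "f \<in> V a" and \<epsilon>: "(0::real) < \<epsilon>"
  note sub = V.span_of_subspace[of idx e, OF e_V]
  have "\<exists>y\<in>V.span_of idx e. inner_V (\<lambda>x. f x - y x) (\<lambda>x. f x - y x) < \<epsilon>\<^sup>2"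
    by (rule V.dense_of_total[OF sub(1-3) _ f]) (use eigenfunctions_total sub(4) \<epsilon> in auto)
  then obtain F c where F: "finite F" "F \<subseteq> idx"
    and lt: "inner_V (\<lambda>x. f x - (\<Sum>j\<in>F. c j * e j x)) (\<lambda>x. f x - (\<Sum>j\<in>F. c j * e j x)) < \<epsilon>\<^sup>2"
    unfolding V.span_of_def by blast
  have "sqrt (inner_V (\<lambda>x. f x - (\<Sum>j\<in>F. c j * e j x)) (\<lambda>x. f x - (\<Sum>j\<in>F. c j * e j x))) < \<epsilon>"
    by (rule real_less_lsqrt) (use lt \<epsilon> in auto)
  with F show "\<exists>F c. finite F \<and> F \<subseteq> idx \<and>
    sqrt (inner_V (\<lambda>x. f x - (\<Sum>j\<in>F. c j * e j x)) (\<lambda>x. f x - (\<Sum>j\<in>F. c j * e j x))) < \<epsilon>" by blast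
qed

text \<open>A function orthogonal to the family is orthogonal to its closed span, hence to \<open>V a\<close>; convergence
  for the energy implies convergence in \<open>L2\<close>.\<close>

lemma eigenfunctions_total_L2:
  assumes f: "f \<in> L2" and orth: "\<And>j. j \<in> idx \<Longrightarrow> ip2 f (e j) = 0"
  shows "ip2 f f = 0"
proof (rule V_total_in_L2[OF f])
  fix v assume v: "v \<in> V a"
  obtain y where y: "\<And>n. y n \<in> V.span_of idx e" "V.conv y v"
    by (rule V.dense_span_sequence[OF e_V eigenfunctions_total v]) (assumption+, rule that)
  have yV: "y n \<in> V a" for n using y(1) V.span_of_subspace(1)[of idx e] e_V by blast
  have "L2.conv y v" unfolding L2.conv_def
  proof (rule tendsto_sandwich)
    show "\<forall>\<^sub>F n in sequentially. 0 \<le> ip2 (\<lambda>x. y n x - v x) (\<lambda>x. y n x - v x)"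
      by (intro always_eventually allI L2.ip_nonneg L2.diff_mem V_D(1) yV v)
    show "\<forall>\<^sub>F n in sequentially. ip2 (\<lambda>x. y n x - v x) (\<lambda>x. y n x - v x) \<le> 64 * pi ^ 4 * inner_V (\<lambda>x. y n x - v x) (\<lambda>x. y n x - v x)"
      by (intro always_eventually allI V_ip2_bound V.diff_mem yV v)
    show "(\<lambda>n. 64 * pi ^ 4 * inner_V (\<lambda>x. y n x - v x) (\<lambda>x. y n x - v x)) \<longlonglongrightarrow> 0"
      using y(2) unfolding V.conv_def by (rule tendsto_mult_right_zero)
  qed auto
  then have "(\<lambda>n. ip2 (y n) f) \<longlonglongrightarrow> ip2 v f"
    by (rule L2.conv_ip) (intro V_D(1) yV v f)+
  moreover have "ip2 (y n) f = 0" for n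
  proof -
    obtain F c where F: "y n = (\<lambda>x. \<Sum>j\<in>F. c j * e j x)" "F \<subseteq> idx"
      using y(1)[of n] by (auto simp: V.span_of_def)
    have "ip2 (y n) f = (\<Sum>j\<in>F. c j * ip2 (e j) f)"
      unfolding F(1) by (rule L2.ip_sum[OF V_D(1)[OF e_V] f]) (use F(2) in auto)
    also have "\<dots> = 0"
      using orth F(2) L2.ip_sym[OF f V_D(1)[OF e_V]] by (intro sum.neutral) (metis mult_zero_right subsetD)
    finally show ?thesis .
  qed
  ultimately have "ip2 v f = 0" by (simp add: LIMSEQ_const_iff)
  then show "ip2 f v = 0" using L2.ip_sym[OF f V_D(1)[OF v]] by simp
qed

lemma complete_in_L2: "complete_system L2 (inner_p p) idx e"
  unfolding complete_system_def Let_def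
proof (intro conjI ballI allI impI)
  show eL: "e j \<in> L2" if "j \<in> idx" for j using V_D(1)[OF e_V[OF that]] .
  fix f \<epsilon> assume f: "f \<in> L2" and \<epsilon>: "(0::real) < \<epsilon>"
  note sub = L2.span_of_subspace[of idx e, OF eL]
  have "\<exists>y\<in>L2.span_of idx e. ip2 (\<lambda>x. f x - y x) (\<lambda>x. f x - y x) < \<epsilon>\<^sup>2 / (\<beta> + 1)"
    by (rule L2.dense_of_total[OF sub(1-3) _ f]) (use eigenfunctions_total_L2 sub(4) \<epsilon> \<beta>_nonneg in auto)
  then obtain y where y: "y \<in> L2.span_of idx e" and lt: "ip2 (\<lambda>x. f x - y x) (\<lambda>x. f x - y x) < \<epsilon>\<^sup>2 / (\<beta> + 1)"
    by blast
  let ?r = "\<lambda>x. f x - y x"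
  have r: "?r \<in> L2" using sub(1) y f by (intro L2.diff_mem) auto
  have "inner_p p ?r ?r \<le> \<beta> * ip2 ?r ?r" by (rule inner_p_bounds(2)[OF r])
  also have "\<dots> \<le> (\<beta> + 1) * ip2 ?r ?r" using L2.ip_nonneg[OF r] by (intro mult_right_mono) auto
  also have "\<dots> < \<epsilon>\<^sup>2" using lt \<beta>_nonneg by (simp add: field_simps)
  finally have "sqrt (inner_p p ?r ?r) < \<epsilon>" using \<epsilon> by (intro real_less_lsqrt) auto
  moreover obtain F c where F: "y = (\<lambda>x. \<Sum>j\<in>F. c j * e j x)" "finite F" "F \<subseteq> idx"
    using y by (auto simp: L2.span_of_def)
  ultimately show "\<exists>F c. finite F \<and> F \<subseteq> idx \<and>
    sqrt (inner_p p (\<lambda>x. f x - (\<Sum>j\<in>F. c j * e j x)) (\<lambda>x. f x - (\<Sum>j\<in>F. c j * e j x))) < \<epsilon>"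
    unfolding F(1) by blast
qed

end

end

theorem proposition2p4:
  fixes \<alpha> \<beta> a :: real and p :: "real \<Rightarrow> real"
  assumes "0 < \<alpha>" "\<alpha> < 1" "1 < \<beta>"
    and "0 < a" "a < 1"
    and "p \<in> P \<alpha> \<beta>"
  shows "(\<forall>\<mu>. eigenvalue a p \<mu> \<longrightarrow> simple_eigenvalue a p \<mu>) \<and>
    (\<exists>\<Lambda> :: nat \<Rightarrow> real.
       {\<mu>. eigenvalue a p \<mu>} = \<Lambda> ` {1..} \<and>
       strict_mono_on {1..} \<Lambda> \<and>
       filterlim \<Lambda> at_top sequentially \<and>
       (\<forall>e :: nat \<Rightarrow> real \<Rightarrow> real.
          (\<forall>j\<in>{1..}. eigenfunction a p (\<Lambda> j) (e j)) \<longrightarrow>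
            complete_system L2 (inner_p p) {1..} e \<and>
            complete_system (V a) inner_V {1..} e))"
proof
  interpret beam a p \<alpha> \<beta> by unfold_locales (use assms in auto)
  show "\<forall>\<mu>. eigenvalue a p \<mu> \<longrightarrow> simple_eigenvalue a p \<mu>"
  proof (intro allI impI)
    fix \<mu> assume "eigenvalue a p \<mu>"
    then obtain e where e: "eigenfunction a p \<mu> e" by (auto simp: eigenvalue_def)
    then show "simple_eigenvalue a p \<mu>"
      using weak_solutions_proportional[OF e] by (auto simp: simple_eigenvalue_def)
  qed
  obtain \<Lambda> :: "nat \<Rightarrow> real" where \<Lambda>: "{\<mu>. eigenvalue a p \<mu>} = \<Lambda> ` {1..}" "strict_mono_on {1..} \<Lambda>"
    "filterlim \<Lambda> at_top sequentially"
    by (rule enumerate_locally_finite[OF infinite_eigenvalue_set finite_eigenvalue_set_le]) (rule that)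
  show "\<exists>\<Lambda> :: nat \<Rightarrow> real.
       {\<mu>. eigenvalue a p \<mu>} = \<Lambda> ` {1..} \<and>
       strict_mono_on {1..} \<Lambda> \<and>
       filterlim \<Lambda> at_top sequentially \<and>
       (\<forall>e :: nat \<Rightarrow> real \<Rightarrow> real.
          (\<forall>j\<in>{1..}. eigenfunction a p (\<Lambda> j) (e j)) \<longrightarrow>
            complete_system L2 (inner_p p) {1..} e \<and>
            complete_system (V a) inner_V {1..} e)"
  proof (intro exI[of _ \<Lambda>] conjI allI impI)
    fix e :: "nat \<Rightarrow> real \<Rightarrow> real"
    assume "\<forall>j\<in>{1..}. eigenfunction a p (\<Lambda> j) (e j)"
    then have e: "\<And>j. j \<in> {1..} \<Longrightarrow> eigenfunction a p (\<Lambda> j) (e j)" by blast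
    show "complete_system L2 (inner_p p) {1..} e" by (rule complete_in_L2[OF \<Lambda>(1) e])
    show "complete_system (V a) inner_V {1..} e" by (rule complete_in_V[OF \<Lambda>(1) e])
  qed (use \<Lambda> in auto)
qed

end
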